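(* Let $H$ be a Hopf algebra over a field $k$ with invertible antipode. The monoidal structure $\otimes=\otimes_k$ on $\mathsf{Vect}_k$ lifts strictly to actions $$\otimes : {}_H\mathsf{Mod}\times {}_H\mathsf{PMod}\to {}_H\mathsf{PMod},\qquad \otimes : {}_H\mathsf{PMod}\times {}_H\mathsf{Mod}\to {}_H\mathsf{PMod},$$ a left and a right action respectively of the monoidal category ${}_H\mathsf{Mod}$ on ${}_H\mathsf{PMod}$, which make ${}_H\mathsf{PMod}$ a biactegory over ${}_H\mathsf{Mod}$. Here, for a global $H$-module $X$ and a partial $H$-module $M$, the partial $H$-module structures are $$h\bullet(x\otimes m)=h_{(1)}\triangleright x\otimes h_{(2)}\bullet m \ \text{ on } X\otimes M,\qquad h\bullet(m\otimes x)=h_{(1)}\bullet m\otimes h_{(2)}\triangleright x\ \text{ on } M\otimes X .$$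
   Context: Notation: $H$ has antipode $S$, counit $\epsilon$ and comultiplication $\Delta(h)=h_{(1)}\otimes h_{(2)}$ (Sweedler notation). A (global) $H$-module is a left $H$-module, with action written $h\triangleright x$; ${}_H\mathsf{Mod}$ is the monoidal category of these, with $\otimes_k$ and diagonal action. A partial representation of $H$ in a $k$-algebra $B$ is a $k$-linear map $\pi:H\to B$ such that $\pi(1_H)=1_B$; $\pi(h)\pi(l_{(1)})\pi(S(l_{(2)}))=\pi(hl_{(1)})\pi(S(l_{(2)}))$; and $\pi(h_{(1)})\pi(S(h_{(2)}))\pi(l)=\pi(h_{(1)})\pi(S(h_{(2)})l)$ for all $h,l\in H$. A partial $H$-module is a $k$-vector space $M$ with a partial representation $\pi:H\to\mathrm{End}_k(M)$; one writes $h\bullet m=\pi(h)(m)$. Morphisms of partial $H$-modules are $k$-linear maps $f$ with $f(h\bullet m)=h\bullet f(m)$. The resulting category is ${}_H\mathsf{PMod}$. Actegories: let $(\mathcal C,\otimes,I,a,\ell,r)$ be a monoidal category. A left action of $\mathcal C$ on a category $\mathcal M$ is a functor $\triangleright:\mathcal C\times\mathcal M\to\mathcal M$ with natural isomorphisms $\lambda_M:I\triangleright M\to M$ (unitor) and $\mu_{X,Y,M}:(X\otimes Y)\triangleright M\to X\triangleright(Y\triangleright M)$ (multiplicator) such that $\lambda_{X\triangleright M}\circ\mu_{I,X,M}=\ell_X\triangleright M$, $(X\triangleright\lambda_M)\circ\mu_{X,I,M}=r_X\triangleright M$ and $(X\triangleright\mu_{Y,Z,M})\circ\mu_{X,Y\otimes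 Z,M}=\mu_{X,Y,Z\triangleright M}\circ\mu_{X\otimes Y,Z,M}\circ(a_{X,Y,Z}\triangleright M)$. Right actions $\triangleleft$ are defined symmetrically, with unitor $\lambda'_M:M\triangleleft I\to M$ and multiplicator $\mu'_{M,X,Y}:M\triangleleft(X\otimes Y)\to(M\triangleleft X)\triangleleft Y$. A $\mathcal C$-biactegory is a category $\mathcal M$ with a left action $\triangleright$ and a right action $\triangleleft$ of $\mathcal C$ and a natural isomorphism (bimodulator) $\zeta_{X,M,Y}:X\triangleright(M\triangleleft Y)\to(X\triangleright M)\triangleleft Y$ compatible with the multiplicators and unitors: $(\mu_{X,Y,M}\triangleleft Z)\circ\zeta_{X\otimes Y,M,Z}=\zeta_{X,Y\triangleright M,Z}\circ(X\triangleright\zeta_{Y,M,Z})\circ\mu_{X,Y,M\triangleleft Z}$, $\mu'_{X\triangleright M,Y,Z}\circ\zeta_{X,M,Y\otimes Z}=(\zeta_{X,M,Y}\triangleleft Z)\circ\zeta_{X,M\triangleleft Y,Z}\circ(X\triangleright\mu'_{M,Y,Z})$, $(\lambda_M\triangleleft Y)\circ\zeta_{I,M,Y}=\lambda_{M\triangleleft Y}$, $\lambda'_{X\triangleright M}\circ\zeta_{X,M,I}=X\triangleright\lambda'_M$. "Lifts strictly" means that the underlying vector spaces and linear maps of the actions are given by $\otimes_k$, and the unitors, multiplicators and bimodulator are the canonical unit and associativity isomorphisms of $\mathsf{Vect}_k$. *)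

theory Defs
  imports "HOL-Algebra.Module" "HOL-Library.FuncSet"
begin

section \<open>Categories, monoidal categories and biactegories\<close>

record ('o, 'm) category =
  Obj :: "'o set"
  Arr :: "'m set"
  Dom :: "'m \<Rightarrow> 'o"
  Cod :: "'m \<Rightarrow> 'o"
  Ident :: "'o \<Rightarrow> 'm"
  Comp :: "'m \<Rightarrow> 'm \<Rightarrow> 'm" (infixr \<open>\<cdot>\<index>\<close> 70)

definition Hom :: "('o, 'm, 'z) category_scheme \<Rightarrow> 'o \<Rightarrow> 'o \<Rightarrow> 'm set" where
  "Hom C A B = {f \<in> Arr C. Dom C f = A \<and> Cod C f = B}"

locale category =
  fixes C :: "('o, 'm, 'z) category_scheme" (structure)
  assumes dom_cod: "f \<in> Arr C \<Longrightarrow> Dom C f \<in> Obj C \<and> Cod C f \<in> Obj C"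
    and ident: "A \<in> Obj C \<Longrightarrow> Ident C A \<in> Hom C A A"
    and comp: "f \<in> Hom C A B \<Longrightarrow> g \<in> Hom C B D \<Longrightarrow> g \<cdot> f \<in> Hom C A D"
    and comp_ident: "f \<in> Hom C A B \<Longrightarrow> f \<cdot> Ident C A = f"
    and ident_comp: "f \<in> Hom C A B \<Longrightarrow> Ident C B \<cdot> f = f"
    and comp_assoc: "f \<in> Hom C A B \<Longrightarrow> g \<in> Hom C B D \<Longrightarrow> h \<in> Hom C D E \<Longrightarrow>
      (h \<cdot> g) \<cdot> f = h \<cdot> (g \<cdot> f)"

definition inverse_arrows :: "('o, 'm, 'z) category_scheme \<Rightarrow> 'm \<Rightarrow> 'm \<Rightarrow> bool" where
  "inverse_arrows C f g \<longleftrightarrow> f \<in> Arr C \<and> g \<in> Arr C \<and>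
     Dom C g = Cod C f \<and> Cod C g = Dom C f \<and>
     g \<cdot>\<^bsub>C\<^esub> f = Ident C (Dom C f) \<and> f \<cdot>\<^bsub>C\<^esub> g = Ident C (Cod C f)"

definition iso_arrow :: "('o, 'm, 'z) category_scheme \<Rightarrow> 'm \<Rightarrow> bool" where
  "iso_arrow C f \<longleftrightarrow> (\<exists>g. inverse_arrows C f g)"

definition prod_cat ::
  "('o, 'm, 'z) category_scheme \<Rightarrow> ('p, 'n, 'y) category_scheme \<Rightarrow> ('o \<times> 'p, 'm \<times> 'n) category" where
  "prod_cat C D = \<lparr>
     Obj = Obj C \<times> Obj D,
     Arr = Arr C \<times> Arr D,
     Dom = (\<lambda>(f, g). (Dom C f, Dom D g)),
     Cod = (\<lambda>(f, g). (Cod C f, Cod D g)),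
     Ident = (\<lambda>(A, B). (Ident C A, Ident D B)),
     Comp = (\<lambda>(f', g') (f, g). (f' \<cdot>\<^bsub>C\<^esub> f, g' \<cdot>\<^bsub>D\<^esub> g))\<rparr>"

definition is_functor ::
  "('o, 'm, 'z) category_scheme \<Rightarrow> ('p, 'n, 'y) category_scheme \<Rightarrow> ('o \<Rightarrow> 'p) \<Rightarrow> ('m \<Rightarrow> 'n) \<Rightarrow> bool" where
  "is_functor C D FO FA \<longleftrightarrow> category C \<and> category D \<and>
     (\<forall>A\<in>Obj C. FO A \<in> Obj D) \<and>
     (\<forall>f\<in>Arr C. FA f \<in> Hom D (FO (Dom C f)) (FO (Cod C f))) \<and>
     (\<forall>A\<in>Obj C. FA (Ident C A) = Ident D (FO A)) \<and>
     (\<forall>f\<in>Arr C. \<forall>g\<in>Arr C. Dom C g = Cod C f \<longrightarrow> FA (g \<cdot>\<^bsub>C\<^esub> f) = FA g \<cdot>\<^bsub>D\<^esub> FA f)"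

definition nat_iso ::
  "('o, 'm, 'z) category_scheme \<Rightarrow> ('p, 'n, 'y) category_scheme \<Rightarrow>
   ('o \<Rightarrow> 'p) \<Rightarrow> ('m \<Rightarrow> 'n) \<Rightarrow> ('o \<Rightarrow> 'p) \<Rightarrow> ('m \<Rightarrow> 'n) \<Rightarrow> ('o \<Rightarrow> 'n) \<Rightarrow> bool" where
  "nat_iso C D FO FA GO GA \<tau> \<longleftrightarrow> is_functor C D FO FA \<and> is_functor C D GO GA \<and>
     (\<forall>A\<in>Obj C. \<tau> A \<in> Hom D (FO A) (GO A) \<and> iso_arrow D (\<tau> A)) \<and>
     (\<forall>f\<in>Arr C. GA f \<cdot>\<^bsub>D\<^esub> \<tau> (Dom C f) = \<tau> (Cod C f) \<cdot>\<^bsub>D\<^esub> FA f)"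

record ('o, 'm) monoidal = "('o, 'm) category" +
  Tob :: "'o \<Rightarrow> 'o \<Rightarrow> 'o"
  Tarr :: "'m \<Rightarrow> 'm \<Rightarrow> 'm"
  Unit :: "'o"
  Assoc :: "'o \<Rightarrow> 'o \<Rightarrow> 'o \<Rightarrow> 'm"  \<comment> \<open>\<open>(X \<otimes> Y) \<otimes> Z \<rightarrow> X \<otimes> (Y \<otimes> Z)\<close>\<close>
  Lunit :: "'o \<Rightarrow> 'm"                \<comment> \<open>\<open>I \<otimes> X \<rightarrow> X\<close>\<close>
  Runit :: "'o \<Rightarrow> 'm"                \<comment> \<open>\<open>X \<otimes> I \<rightarrow> X\<close>\<close>

locale monoidal_category =
  category C for C :: "('o, 'm, 'z) monoidal_scheme" (structure) +
  assumes tensor_functor: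
      "is_functor (prod_cat C C) C (\<lambda>(X, Y). Tob C X Y) (\<lambda>(f, g). Tarr C f g)"
    and unit_obj: "Unit C \<in> Obj C"
    and assoc_nat: "nat_iso (prod_cat C (prod_cat C C)) C
      (\<lambda>(X, Y, Z). Tob C (Tob C X Y) Z) (\<lambda>(f, g, h). Tarr C (Tarr C f g) h)
      (\<lambda>(X, Y, Z). Tob C X (Tob C Y Z)) (\<lambda>(f, g, h). Tarr C f (Tarr C g h))
      (\<lambda>(X, Y, Z). Assoc C X Y Z)"
    and lunit_nat: "nat_iso C C (Tob C (Unit C)) (Tarr C (Ident C (Unit C)))
      (\<lambda>X. X) (\<lambda>f. f) (Lunit C)"
    and runit_nat: "nat_iso C C (\<lambda>X. Tob C X (Unit C)) (\<lambda>f. Tarr C f (Ident C (Unit C)))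
      (\<lambda>X. X) (\<lambda>f. f) (Runit C)"
    and pentagon: "W \<in> Obj C \<Longrightarrow> X \<in> Obj C \<Longrightarrow> Y \<in> Obj C \<Longrightarrow> Z \<in> Obj C \<Longrightarrow>
      Assoc C W X (Tob C Y Z) \<cdot> Assoc C (Tob C W X) Y Z =
      Tarr C (Ident C W) (Assoc C X Y Z) \<cdot> (Assoc C W (Tob C X Y) Z \<cdot>
        Tarr C (Assoc C W X Y) (Ident C Z))"
    and triangle: "X \<in> Obj C \<Longrightarrow> Y \<in> Obj C \<Longrightarrow>
      Tarr C (Ident C X) (Lunit C Y) \<cdot> Assoc C X (Unit C) Y = Tarr C (Runit C X) (Ident C Y)"

text \<open>In the action records, \<open>'o\<close>, \<open>'m\<close> are the objects and arrows of the acting category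
  and \<open>'p\<close>, \<open>'n\<close> those of the category acted upon.\<close>

record ('o, 'm, 'p, 'n) left_action =
  Lob :: "'o \<Rightarrow> 'p \<Rightarrow> 'p"
  Larr :: "'m \<Rightarrow> 'n \<Rightarrow> 'n"
  Luni :: "'p \<Rightarrow> 'n"                 \<comment> \<open>\<open>\<lambda>\<^sub>M : I \<triangleright> M \<rightarrow> M\<close>\<close>
  Lmul :: "'o \<Rightarrow> 'o \<Rightarrow> 'p \<Rightarrow> 'n"   \<comment> \<open>\<open>\<mu> : (X \<otimes> Y) \<triangleright> M \<rightarrow> X \<triangleright> (Y \<triangleright> M)\<close>\<close>

record ('o, 'm, 'p, 'n) right_action =
  Rob :: "'p \<Rightarrow> 'o \<Rightarrow> 'p"
  Rarr :: "'n \<Rightarrow> 'm \<Rightarrow> 'n"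
  Runi :: "'p \<Rightarrow> 'n"                 \<comment> \<open>\<open>\<lambda>' : M \<triangleleft> I \<rightarrow> M\<close>\<close>
  Rmul :: "'p \<Rightarrow> 'o \<Rightarrow> 'o \<Rightarrow> 'n"   \<comment> \<open>\<open>\<mu>' : M \<triangleleft> (X \<otimes> Y) \<rightarrow> (M \<triangleleft> X) \<triangleleft> Y\<close>\<close>

locale left_actegory =
  C: monoidal_category C + M: category M
  for C :: "('o, 'm, 'z) monoidal_scheme" and M :: "('p, 'n, 'y) category_scheme" (structure) +
  fixes L :: "('o, 'm, 'p, 'n) left_action"
  assumes left_functor:
      "is_functor (prod_cat C M) M (\<lambda>(X, A). Lob L X A) (\<lambda>(f, g). Larr L f g)"
    and left_unitor_nat:
      "nat_iso M M (Lob L (Unit C)) (Larr L (Ident C (Unit C))) (\<lambda>A. A) (\<lambda>f. f) (Luni L)"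
    and left_multiplicator_nat: "nat_iso (prod_cat C (prod_cat C M)) M
      (\<lambda>(X, Y, A). Lob L (Tob C X Y) A) (\<lambda>(f, g, t). Larr L (Tarr C f g) t)
      (\<lambda>(X, Y, A). Lob L X (Lob L Y A)) (\<lambda>(f, g, t). Larr L f (Larr L g t))
      (\<lambda>(X, Y, A). Lmul L X Y A)"
    and left_unit1: "X \<in> Obj C \<Longrightarrow> A \<in> Obj M \<Longrightarrow>
      Luni L (Lob L X A) \<cdot> Lmul L (Unit C) X A = Larr L (Lunit C X) (Ident M A)"
    and left_unit2: "X \<in> Obj C \<Longrightarrow> A \<in> Obj M \<Longrightarrow>
      Larr L (Ident C X) (Luni L A) \<cdot> Lmul L X (Unit C) A = Larr L (Runit C X) (Ident M A)"
    and left_assoc: "X \<in> Obj C \<Longrightarrow> Y \<in> Obj C \<Longrightarrow> Z \<in> Obj C \<Longrightarrow> A \<in> Obj M \<Longrightarrow>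
      Larr L (Ident C X) (Lmul L Y Z A) \<cdot> Lmul L X (Tob C Y Z) A
        \<cdot> Larr L (Assoc C X Y Z) (Ident M A) =
      Lmul L X Y (Lob L Z A) \<cdot> Lmul L (Tob C X Y) Z A"

text \<open>The multiplicators point in opposite directions to the associator on the two sides: with
  \<open>a : (X \<otimes> Y) \<otimes> Z \<rightarrow> X \<otimes> (Y \<otimes> Z)\<close> the pentagons are
  \<open>(X \<triangleright> \<mu>) \<mu> (a \<triangleright> A) = \<mu> \<mu>\<close> and \<open>(\<mu>' \<triangleleft> Z) \<mu>' = \<mu>' \<mu>' (A \<triangleleft> a)\<close>.\<close>

locale right_actegory =
  C: monoidal_category C + M: category M
  for C :: "('o, 'm, 'z) monoidal_scheme" and M :: "('p, 'n, 'y) category_scheme" (structure) +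
  fixes R :: "('o, 'm, 'p, 'n) right_action"
  assumes right_functor:
      "is_functor (prod_cat M C) M (\<lambda>(A, X). Rob R A X) (\<lambda>(g, f). Rarr R g f)"
    and right_unitor_nat:
      "nat_iso M M (\<lambda>A. Rob R A (Unit C)) (\<lambda>f. Rarr R f (Ident C (Unit C)))
        (\<lambda>A. A) (\<lambda>f. f) (Runi R)"
    and right_multiplicator_nat: "nat_iso (prod_cat M (prod_cat C C)) M
      (\<lambda>(A, X, Y). Rob R A (Tob C X Y)) (\<lambda>(t, f, g). Rarr R t (Tarr C f g))
      (\<lambda>(A, X, Y). Rob R (Rob R A X) Y) (\<lambda>(t, f, g). Rarr R (Rarr R t f) g)
      (\<lambda>(A, X, Y). Rmul R A X Y)"
    and right_unit1: "X \<in> Obj C \<Longrightarrow> A \<in> Obj M \<Longrightarrow>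
      Runi R (Rob R A X) \<cdot> Rmul R A X (Unit C) = Rarr R (Ident M A) (Runit C X)"
    and right_unit2: "X \<in> Obj C \<Longrightarrow> A \<in> Obj M \<Longrightarrow>
      Rarr R (Runi R A) (Ident C X) \<cdot> Rmul R A (Unit C) X = Rarr R (Ident M A) (Lunit C X)"
    and right_assoc: "X \<in> Obj C \<Longrightarrow> Y \<in> Obj C \<Longrightarrow> Z \<in> Obj C \<Longrightarrow> A \<in> Obj M \<Longrightarrow>
      Rarr R (Rmul R A X Y) (Ident C Z) \<cdot> Rmul R A (Tob C X Y) Z =
      Rmul R (Rob R A X) Y Z \<cdot> Rmul R A X (Tob C Y Z)
        \<cdot> Rarr R (Ident M A) (Assoc C X Y Z)"

locale biactegory =
  left_actegory C M L + right_actegory C M R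
  for C :: "('o, 'm, 'z) monoidal_scheme" and M :: "('p, 'n, 'y) category_scheme" (structure)
    and L :: "('o, 'm, 'p, 'n) left_action" and R :: "('o, 'm, 'p, 'n) right_action" +
  fixes \<zeta> :: "'o \<Rightarrow> 'p \<Rightarrow> 'o \<Rightarrow> 'n"  \<comment> \<open>\<open>X \<triangleright> (A \<triangleleft> Y) \<rightarrow> (X \<triangleright> A) \<triangleleft> Y\<close>\<close>
  assumes bimodulator_nat: "nat_iso (prod_cat C (prod_cat M C)) M
      (\<lambda>(X, A, Y). Lob L X (Rob R A Y)) (\<lambda>(f, t, g). Larr L f (Rarr R t g))
      (\<lambda>(X, A, Y). Rob R (Lob L X A) Y) (\<lambda>(f, t, g). Rarr R (Larr L f t) g)
      (\<lambda>(X, A, Y). \<zeta> X A Y)"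
    and left_compat: "X \<in> Obj C \<Longrightarrow> Y \<in> Obj C \<Longrightarrow> Z \<in> Obj C \<Longrightarrow> A \<in> Obj M \<Longrightarrow>
      Rarr R (Lmul L X Y A) (Ident C Z) \<cdot> \<zeta> (Tob C X Y) A Z =
      \<zeta> X (Lob L Y A) Z \<cdot> Larr L (Ident C X) (\<zeta> Y A Z) \<cdot> Lmul L X Y (Rob R A Z)"
    and right_compat: "X \<in> Obj C \<Longrightarrow> Y \<in> Obj C \<Longrightarrow> Z \<in> Obj C \<Longrightarrow> A \<in> Obj M \<Longrightarrow>
      Rmul R (Lob L X A) Y Z \<cdot> \<zeta> X A (Tob C Y Z) =
      Rarr R (\<zeta> X A Y) (Ident C Z) \<cdot> \<zeta> X (Rob R A Y) Z \<cdot> Larr L (Ident C X) (Rmul R A Y Z)"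
    and left_unit_compat: "Y \<in> Obj C \<Longrightarrow> A \<in> Obj M \<Longrightarrow>
      Rarr R (Luni L A) (Ident C Y) \<cdot> \<zeta> (Unit C) A Y = Luni L (Rob R A Y)"
    and right_unit_compat: "X \<in> Obj C \<Longrightarrow> A \<in> Obj M \<Longrightarrow>
      Runi R (Lob L X A) \<cdot> \<zeta> X A (Unit C) = Larr L (Ident C X) (Runi R A)"

definition strict_monoidal_functor ::
  "('o, 'm, 'z) monoidal_scheme \<Rightarrow> ('p, 'n, 'y) monoidal_scheme \<Rightarrow>
   ('o \<Rightarrow> 'p) \<Rightarrow> ('m \<Rightarrow> 'n) \<Rightarrow> bool" where
  "strict_monoidal_functor C V FO FA \<longleftrightarrow>
     monoidal_category C \<and> monoidal_category V \<and> is_functor C V FO FA \<and>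
     FO (Unit C) = Unit V \<and>
     (\<forall>X\<in>Obj C. \<forall>Y\<in>Obj C. FO (Tob C X Y) = Tob V (FO X) (FO Y)) \<and>
     (\<forall>f\<in>Arr C. \<forall>g\<in>Arr C. FA (Tarr C f g) = Tarr V (FA f) (FA g)) \<and>
     (\<forall>X\<in>Obj C. \<forall>Y\<in>Obj C. \<forall>Z\<in>Obj C.
        FA (Assoc C X Y Z) = Assoc V (FO X) (FO Y) (FO Z)) \<and>
     (\<forall>X\<in>Obj C. FA (Lunit C X) = Lunit V (FO X) \<and> FA (Runit C X) = Runit V (FO X))"

text \<open>Strict lifting of the tensor product of a monoidal category \<open>V\<close> along functors
  \<open>F : C \<rightarrow> V\<close> and \<open>G : M \<rightarrow> V\<close>: the left action, the right action and the bimodulator on \<open>M\<close> lie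
  over the tensor product of \<open>V\<close> and its constraints. By the chosen directions, \<open>\<mu>\<close> lies over the
  associator of \<open>V\<close>, and \<open>\<mu>'\<close> and \<open>\<zeta>\<close> lie over its inverse.\<close>

definition left_action_lifts_strictly ::
  "('u, 'v, 'w) monoidal_scheme \<Rightarrow> ('o, 'm, 'z) monoidal_scheme \<Rightarrow> ('p, 'n, 'y) category_scheme \<Rightarrow>
   ('o \<Rightarrow> 'u) \<Rightarrow> ('m \<Rightarrow> 'v) \<Rightarrow> ('p \<Rightarrow> 'u) \<Rightarrow> ('n \<Rightarrow> 'v) \<Rightarrow>
   ('o, 'm, 'p, 'n) left_action \<Rightarrow> bool" where
  "left_action_lifts_strictly V C M FO FA GO GA L \<longleftrightarrow>
     strict_monoidal_functor C V FO FA \<and> is_functor M V GO GA \<and>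
     (\<forall>X\<in>Obj C. \<forall>A\<in>Obj M. GO (Lob L X A) = Tob V (FO X) (GO A)) \<and>
     (\<forall>f\<in>Arr C. \<forall>g\<in>Arr M. GA (Larr L f g) = Tarr V (FA f) (GA g)) \<and>
     (\<forall>A\<in>Obj M. GA (Luni L A) = Lunit V (GO A)) \<and>
     (\<forall>X\<in>Obj C. \<forall>Y\<in>Obj C. \<forall>A\<in>Obj M.
        GA (Lmul L X Y A) = Assoc V (FO X) (FO Y) (GO A))"

definition right_action_lifts_strictly ::
  "('u, 'v, 'w) monoidal_scheme \<Rightarrow> ('o, 'm, 'z) monoidal_scheme \<Rightarrow> ('p, 'n, 'y) category_scheme \<Rightarrow>
   ('o \<Rightarrow> 'u) \<Rightarrow> ('m \<Rightarrow> 'v) \<Rightarrow> ('p \<Rightarrow> 'u) \<Rightarrow> ('n \<Rightarrow> 'v) \<Rightarrow>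
   ('o, 'm, 'p, 'n) right_action \<Rightarrow> bool" where
  "right_action_lifts_strictly V C M FO FA GO GA R \<longleftrightarrow>
     strict_monoidal_functor C V FO FA \<and> is_functor M V GO GA \<and>
     (\<forall>A\<in>Obj M. \<forall>X\<in>Obj C. GO (Rob R A X) = Tob V (GO A) (FO X)) \<and>
     (\<forall>g\<in>Arr M. \<forall>f\<in>Arr C. GA (Rarr R g f) = Tarr V (GA g) (FA f)) \<and>
     (\<forall>A\<in>Obj M. GA (Runi R A) = Runit V (GO A)) \<and>
     (\<forall>A\<in>Obj M. \<forall>X\<in>Obj C. \<forall>Y\<in>Obj C.
        inverse_arrows V (Assoc V (GO A) (FO X) (FO Y)) (GA (Rmul R A X Y)))"

definition bimodulator_lifts_strictly ::
  "('u, 'v, 'w) monoidal_scheme \<Rightarrow> ('o, 'm, 'z) monoidal_scheme \<Rightarrow> ('p, 'n, 'y) category_scheme \<Rightarrow>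
   ('o \<Rightarrow> 'u) \<Rightarrow> ('p \<Rightarrow> 'u) \<Rightarrow> ('n \<Rightarrow> 'v) \<Rightarrow> ('o \<Rightarrow> 'p \<Rightarrow> 'o \<Rightarrow> 'n) \<Rightarrow> bool" where
  "bimodulator_lifts_strictly V C M FO GO GA \<zeta> \<longleftrightarrow>
     (\<forall>X\<in>Obj C. \<forall>A\<in>Obj M. \<forall>Y\<in>Obj C.
        inverse_arrows V (Assoc V (FO X) (GO A) (FO Y)) (GA (\<zeta> X A Y)))"


section \<open>Tensor products of vector spaces\<close>

text \<open>The carriers of all vector spaces lie in one type, so that the spaces form a category, closed
  under \<open>\<otimes>\<close>. The type contains a copy \<open>Scalar\<close> of the ground field, a copy \<open>Atom\<close> of an
  arbitrary type \<open>'a\<close> (so every vector space on a subset of \<open>'a\<close> has an isomorphic copy), and formal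
  sums \<open>Tens [(x\<^sub>1, y\<^sub>1), \<dots>, (x\<^sub>n, y\<^sub>n)]\<close>, which serve as representatives of the elements
  \<open>x\<^sub>1 \<otimes> y\<^sub>1 + \<dots> + x\<^sub>n \<otimes> y\<^sub>n\<close> of tensor products.\<close>

datatype ('k, 'a) univ =
    Scalar (scalar: 'k)
  | Atom 'a
  | Tens (summands: "(('k, 'a) univ \<times> ('k, 'a) univ) list")

text \<open>Vector spaces are HOL-Algebra modules over a field; the fields \<open>mult\<close> and \<open>one\<close> of the record
  carry no meaning for them.\<close>

type_synonym ('k, 'a) vs = "('k, ('k, 'a) univ) module"

definition lin ::
  "('k, 'r) ring_scheme \<Rightarrow> ('k, 'b, 'm) module_scheme \<Rightarrow> ('k, 'c, 'n) module_scheme \<Rightarrow> ('b \<Rightarrow> 'c) set" where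
  "lin K M N = {f \<in> carrier M \<rightarrow>\<^sub>E carrier N.
     (\<forall>x\<in>carrier M. \<forall>y\<in>carrier M. f (x \<oplus>\<^bsub>M\<^esub> y) = f x \<oplus>\<^bsub>N\<^esub> f y) \<and>
     (\<forall>a\<in>carrier K. \<forall>x\<in>carrier M. f (a \<odot>\<^bsub>M\<^esub> x) = a \<odot>\<^bsub>N\<^esub> f x)}"

text \<open>Equality of formal sums in \<open>M \<otimes> N\<close>.\<close>

inductive tens_eq ::
  "('k, 'r) ring_scheme \<Rightarrow> ('k, 'b, 'm) module_scheme \<Rightarrow> ('k, 'c, 'n) module_scheme \<Rightarrow>
   ('b \<times> 'c) list \<Rightarrow> ('b \<times> 'c) list \<Rightarrow> bool"
  for K :: "('k, 'r) ring_scheme" and M :: "('k, 'b, 'm) module_scheme"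
    and N :: "('k, 'c, 'n) module_scheme" where
  refl: "l \<in> lists (carrier M \<times> carrier N) \<Longrightarrow> tens_eq K M N l l"
| sym: "tens_eq K M N l l' \<Longrightarrow> tens_eq K M N l' l"
| trans: "tens_eq K M N l l' \<Longrightarrow> tens_eq K M N l' l'' \<Longrightarrow> tens_eq K M N l l''"
| append: "tens_eq K M N l l' \<Longrightarrow> tens_eq K M N r r' \<Longrightarrow> tens_eq K M N (l @ r) (l' @ r')"
| commute: "l \<in> lists (carrier M \<times> carrier N) \<Longrightarrow> r \<in> lists (carrier M \<times> carrier N) \<Longrightarrow>
    tens_eq K M N (l @ r) (r @ l)"
| add_left: "x \<in> carrier M \<Longrightarrow> x' \<in> carrier M \<Longrightarrow> y \<in> carrier N \<Longrightarrow>
    tens_eq K M N [(x \<oplus>\<^bsub>M\<^esub> x', y)] [(x, y), (x', y)]"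
| add_right: "x \<in> carrier M \<Longrightarrow> y \<in> carrier N \<Longrightarrow> y' \<in> carrier N \<Longrightarrow>
    tens_eq K M N [(x, y \<oplus>\<^bsub>N\<^esub> y')] [(x, y), (x, y')]"
| balanced: "a \<in> carrier K \<Longrightarrow> x \<in> carrier M \<Longrightarrow> y \<in> carrier N \<Longrightarrow>
    tens_eq K M N [(a \<odot>\<^bsub>M\<^esub> x, y)] [(x, a \<odot>\<^bsub>N\<^esub> y)]"
| zero: "y \<in> carrier N \<Longrightarrow> tens_eq K M N [(\<zero>\<^bsub>M\<^esub>, y)] []"

definition tcls ::
  "('k, 'r) ring_scheme \<Rightarrow> ('k, ('k, 'a) univ, 'm) module_scheme \<Rightarrow>
   ('k, ('k, 'a) univ, 'n) module_scheme \<Rightarrow> (('k, 'a) univ \<times> ('k, 'a) univ) list \<Rightarrow> ('k, 'a) univ" where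
  "tcls K M N l = Tens (SOME l'. tens_eq K M N l l')"

definition tensor ::
  "('k, 'r) ring_scheme \<Rightarrow> ('k, ('k, 'a) univ, 'm) module_scheme \<Rightarrow>
   ('k, ('k, 'a) univ, 'n) module_scheme \<Rightarrow> ('k, 'a) vs" where
  "tensor K M N = \<lparr>
     carrier = tcls K M N ` lists (carrier M \<times> carrier N),
     monoid.mult = undefined,
     one = undefined,
     zero = tcls K M N [],
     add = (\<lambda>s t. tcls K M N (summands s @ summands t)),
     smult = (\<lambda>a t. tcls K M N (map (\<lambda>(x, y). (a \<odot>\<^bsub>M\<^esub> x, y)) (summands t)))\<rparr>"

definition pure ::
  "('k, 'r) ring_scheme \<Rightarrow> ('k, ('k, 'a) univ, 'm) module_scheme \<Rightarrow>
   ('k, ('k, 'a) univ, 'n) module_scheme \<Rightarrow> ('k, 'a) univ \<Rightarrow> ('k, 'a) univ \<Rightarrow> ('k, 'a) univ" where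
  "pure K M N x y = tcls K M N [(x, y)]"

text \<open>The value at \<open>t = \<Sum> x\<^sub>i \<otimes> y\<^sub>i\<close> of the linear map into \<open>B\<close> induced by a bilinear map
  \<open>f\<close>, that is \<open>\<Sum> f x\<^sub>i y\<^sub>i\<close>. With \<open>t = \<Delta> h\<close> this renders Sweedler notation:
  \<open>tsum B (\<lambda>a b. \<dots> a \<dots> b \<dots>) (\<Delta> h)\<close> is the sum \<open>\<dots> h\<^sub>(\<^sub>1\<^sub>) \<dots> h\<^sub>(\<^sub>2\<^sub>) \<dots>\<close> in \<open>B\<close>.\<close>

definition tsum ::
  "('b, 'm) ring_scheme \<Rightarrow> (('k, 'a) univ \<Rightarrow> ('k, 'a) univ \<Rightarrow> 'b) \<Rightarrow> ('k, 'a) univ \<Rightarrow> 'b" where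
  "tsum B f t = foldr (\<lambda>(x, y) s. f x y \<oplus>\<^bsub>B\<^esub> s) (summands t) \<zero>\<^bsub>B\<^esub>"

definition ground :: "('k, 'r) ring_scheme \<Rightarrow> ('k, 'a) vs" where
  "ground K = \<lparr>
     carrier = Scalar ` carrier K,
     monoid.mult = (\<lambda>s t. Scalar (scalar s \<otimes>\<^bsub>K\<^esub> scalar t)),
     one = Scalar \<one>\<^bsub>K\<^esub>,
     zero = Scalar \<zero>\<^bsub>K\<^esub>,
     add = (\<lambda>s t. Scalar (scalar s \<oplus>\<^bsub>K\<^esub> scalar t)),
     smult = (\<lambda>a t. Scalar (a \<otimes>\<^bsub>K\<^esub> scalar t))\<rparr>"

definition tmap ::
  "('k, 'r) ring_scheme \<Rightarrow> ('k, ('k, 'a) univ, 'm) module_scheme \<Rightarrow> ('k, ('k, 'a) univ, 'n) module_scheme \<Rightarrow>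
   ('k, ('k, 'b) univ, 'p) module_scheme \<Rightarrow> ('k, ('k, 'b) univ, 'q) module_scheme \<Rightarrow>
   (('k, 'a) univ \<Rightarrow> ('k, 'b) univ) \<Rightarrow> (('k, 'a) univ \<Rightarrow> ('k, 'b) univ) \<Rightarrow>
   ('k, 'a) univ \<Rightarrow> ('k, 'b) univ" where
  "tmap K M N M' N' f g = (\<lambda>t\<in>carrier (tensor K M N).
     tsum (tensor K M' N') (\<lambda>x y. pure K M' N' (f x) (g y)) t)"

definition assoc_map ::
  "('k, 'r) ring_scheme \<Rightarrow> ('k, ('k, 'a) univ, 'm) module_scheme \<Rightarrow> ('k, ('k, 'a) univ, 'n) module_scheme \<Rightarrow>
   ('k, ('k, 'a) univ, 'p) module_scheme \<Rightarrow> ('k, 'a) univ \<Rightarrow> ('k, 'a) univ" where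
  "assoc_map K X Y Z = (\<lambda>t\<in>carrier (tensor K (tensor K X Y) Z).
     (let T = tensor K X (tensor K Y Z) in
      tsum T (\<lambda>s z. tsum T (\<lambda>x y. pure K X (tensor K Y Z) x (pure K Y Z y z)) s) t))"

definition assoc_inv_map ::
  "('k, 'r) ring_scheme \<Rightarrow> ('k, ('k, 'a) univ, 'm) module_scheme \<Rightarrow> ('k, ('k, 'a) univ, 'n) module_scheme \<Rightarrow>
   ('k, ('k, 'a) univ, 'p) module_scheme \<Rightarrow> ('k, 'a) univ \<Rightarrow> ('k, 'a) univ" where
  "assoc_inv_map K X Y Z = (\<lambda>t\<in>carrier (tensor K X (tensor K Y Z)).
     (let T = tensor K (tensor K X Y) Z in
      tsum T (\<lambda>x s. tsum T (\<lambda>y z. pure K (tensor K X Y) Z (pure K X Y x y) z) s) t))"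

definition lunit_map ::
  "('k, 'r) ring_scheme \<Rightarrow> ('k, ('k, 'a) univ, 'm) module_scheme \<Rightarrow> ('k, 'a) univ \<Rightarrow> ('k, 'a) univ" where
  "lunit_map K X = (\<lambda>t\<in>carrier (tensor K (ground K) X). tsum X (\<lambda>c x. scalar c \<odot>\<^bsub>X\<^esub> x) t)"

definition runit_map ::
  "('k, 'r) ring_scheme \<Rightarrow> ('k, ('k, 'a) univ, 'm) module_scheme \<Rightarrow> ('k, 'a) univ \<Rightarrow> ('k, 'a) univ" where
  "runit_map K X = (\<lambda>t\<in>carrier (tensor K X (ground K)). tsum X (\<lambda>x c. scalar c \<odot>\<^bsub>X\<^esub> x) t)"


section \<open>Hopf algebras, modules and partial modules\<close>

locale unital_algebra =
  fixes K :: "('k, 'r) ring_scheme" and B :: "('k, 'b, 'm) module_scheme"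
  assumes module: "module K B"
    and ring: "ring B"
    and smult_mult: "a \<in> carrier K \<Longrightarrow> x \<in> carrier B \<Longrightarrow> y \<in> carrier B \<Longrightarrow>
      (a \<odot>\<^bsub>B\<^esub> x) \<otimes>\<^bsub>B\<^esub> y = a \<odot>\<^bsub>B\<^esub> (x \<otimes>\<^bsub>B\<^esub> y)"
    and mult_smult: "a \<in> carrier K \<Longrightarrow> x \<in> carrier B \<Longrightarrow> y \<in> carrier B \<Longrightarrow>
      x \<otimes>\<^bsub>B\<^esub> (a \<odot>\<^bsub>B\<^esub> y) = a \<odot>\<^bsub>B\<^esub> (x \<otimes>\<^bsub>B\<^esub> y)"

record ('k, 'b) hopf = "('k, 'b) module" +
  comul :: "'b \<Rightarrow> 'b"
  counit :: "'b \<Rightarrow> 'k"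
  antipode :: "'b \<Rightarrow> 'b"

locale hopf_algebra =
  unital_algebra K H
  for K :: "('k, 'r) ring_scheme" and H :: "('k, ('k, 'h) univ, 'z) hopf_scheme" +
  assumes field: "field K"
    and comul_lin: "comul H \<in> lin K H (tensor K H H)"
    and counit_closed: "h \<in> carrier H \<Longrightarrow> counit H h \<in> carrier K"
    and counit_add: "h \<in> carrier H \<Longrightarrow> l \<in> carrier H \<Longrightarrow>
      counit H (h \<oplus>\<^bsub>H\<^esub> l) = counit H h \<oplus>\<^bsub>K\<^esub> counit H l"
    and counit_smult: "a \<in> carrier K \<Longrightarrow> h \<in> carrier H \<Longrightarrow>
      counit H (a \<odot>\<^bsub>H\<^esub> h) = a \<otimes>\<^bsub>K\<^esub> counit H h"
    and coassoc: "h \<in> carrier H \<Longrightarrow>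
      assoc_map K H H H
        (tmap K H H (tensor K H H) H (comul H) (\<lambda>x\<in>carrier H. x) (comul H h)) =
      tmap K H H H (tensor K H H) (\<lambda>x\<in>carrier H. x) (comul H) (comul H h)"
    and counit_left: "h \<in> carrier H \<Longrightarrow> tsum H (\<lambda>a b. counit H a \<odot>\<^bsub>H\<^esub> b) (comul H h) = h"
    and counit_right: "h \<in> carrier H \<Longrightarrow> tsum H (\<lambda>a b. counit H b \<odot>\<^bsub>H\<^esub> a) (comul H h) = h"
    and comul_one: "comul H \<one>\<^bsub>H\<^esub> = pure K H H \<one>\<^bsub>H\<^esub> \<one>\<^bsub>H\<^esub>"
    and comul_mult: "h \<in> carrier H \<Longrightarrow> l \<in> carrier H \<Longrightarrow> comul H (h \<otimes>\<^bsub>H\<^esub> l) =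
      tsum (tensor K H H) (\<lambda>a b.
        tsum (tensor K H H) (\<lambda>c d. pure K H H (a \<otimes>\<^bsub>H\<^esub> c) (b \<otimes>\<^bsub>H\<^esub> d)) (comul H l)) (comul H h)"
    and counit_one: "counit H \<one>\<^bsub>H\<^esub> = \<one>\<^bsub>K\<^esub>"
    and counit_mult: "h \<in> carrier H \<Longrightarrow> l \<in> carrier H \<Longrightarrow>
      counit H (h \<otimes>\<^bsub>H\<^esub> l) = counit H h \<otimes>\<^bsub>K\<^esub> counit H l"
    and antipode_lin: "antipode H \<in> lin K H H"
    and antipode_left: "h \<in> carrier H \<Longrightarrow>
      tsum H (\<lambda>a b. antipode H a \<otimes>\<^bsub>H\<^esub> b) (comul H h) = counit H h \<odot>\<^bsub>H\<^esub> \<one>\<^bsub>H\<^esub>"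
    and antipode_right: "h \<in> carrier H \<Longrightarrow>
      tsum H (\<lambda>a b. a \<otimes>\<^bsub>H\<^esub> antipode H b) (comul H h) = counit H h \<odot>\<^bsub>H\<^esub> \<one>\<^bsub>H\<^esub>"

definition invertible_antipode :: "('k, 'b, 'z) hopf_scheme \<Rightarrow> bool" where
  "invertible_antipode H \<longleftrightarrow> bij_betw (antipode H) (carrier H) (carrier H)"

definition End_alg :: "('k, 'r) ring_scheme \<Rightarrow> ('k, 'b, 'm) module_scheme \<Rightarrow> ('k, 'b \<Rightarrow> 'b) module" where
  "End_alg K M = \<lparr>
     carrier = lin K M M,
     monoid.mult = (\<lambda>f g. compose (carrier M) f g),
     one = (\<lambda>x\<in>carrier M. x),
     zero = (\<lambda>x\<in>carrier M. \<zero>\<^bsub>M\<^esub>),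
     add = (\<lambda>f g. \<lambda>x\<in>carrier M. f x \<oplus>\<^bsub>M\<^esub> g x),
     smult = (\<lambda>a f. \<lambda>x\<in>carrier M. a \<odot>\<^bsub>M\<^esub> f x)\<rparr>"

definition global_rep ::
  "('k, 'r) ring_scheme \<Rightarrow> ('k, ('k, 'h) univ, 'z) hopf_scheme \<Rightarrow> ('k, 'b, 'm) module_scheme \<Rightarrow>
   (('k, 'h) univ \<Rightarrow> 'b) \<Rightarrow> bool" where
  "global_rep K H B \<rho> \<longleftrightarrow> \<rho> \<in> lin K H B \<and> \<rho> \<in> ring_hom H B"

definition partial_rep ::
  "('k, 'r) ring_scheme \<Rightarrow> ('k, ('k, 'h) univ, 'z) hopf_scheme \<Rightarrow> ('k, 'b, 'm) module_scheme \<Rightarrow>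
   (('k, 'h) univ \<Rightarrow> 'b) \<Rightarrow> bool" where
  "partial_rep K H B \<pi> \<longleftrightarrow> \<pi> \<in> lin K H B \<and> \<pi> \<one>\<^bsub>H\<^esub> = \<one>\<^bsub>B\<^esub> \<and>
     (\<forall>h\<in>carrier H. \<forall>l\<in>carrier H.
        tsum B (\<lambda>a b. \<pi> h \<otimes>\<^bsub>B\<^esub> \<pi> a \<otimes>\<^bsub>B\<^esub> \<pi> (antipode H b)) (comul H l) =
        tsum B (\<lambda>a b. \<pi> (h \<otimes>\<^bsub>H\<^esub> a) \<otimes>\<^bsub>B\<^esub> \<pi> (antipode H b)) (comul H l)) \<and>
     (\<forall>h\<in>carrier H. \<forall>l\<in>carrier H.
        tsum B (\<lambda>a b. \<pi> a \<otimes>\<^bsub>B\<^esub> \<pi> (antipode H b) \<otimes>\<^bsub>B\<^esub> \<pi> l) (comul H h) =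
        tsum B (\<lambda>a b. \<pi> a \<otimes>\<^bsub>B\<^esub> \<pi> (antipode H b \<otimes>\<^bsub>H\<^esub> l)) (comul H h))"

text \<open>Global and partial modules are pairs \<open>(M, \<pi>)\<close> of a vector space and a representation in its
  endomorphism algebra. The atoms \<open>'h\<close> of the carrier of \<open>H\<close> are independent of the atoms \<open>'a\<close> of the
  modules. The same notion of morphism serves for both.\<close>

type_synonym ('k, 'h, 'a) rep = "('k, 'a) vs \<times> (('k, 'h) univ \<Rightarrow> ('k, 'a) univ \<Rightarrow> ('k, 'a) univ)"

definition rep_hom ::
  "('k, 'r) ring_scheme \<Rightarrow> ('k, ('k, 'h) univ, 'z) hopf_scheme \<Rightarrow>
   ('k, 'h, 'a) rep \<Rightarrow> ('k, 'h, 'a) rep \<Rightarrow> (('k, 'a) univ \<Rightarrow> ('k, 'a) univ) set" where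
  "rep_hom K H = (\<lambda>(M, \<pi>) (N, \<sigma>). {f \<in> lin K M N.
     \<forall>h\<in>carrier H. \<forall>x\<in>carrier M. f (\<pi> h x) = \<sigma> h (f x)})"

text \<open>\<open>h \<bullet> (x \<otimes> m) = h\<^sub>(\<^sub>1\<^sub>) \<bullet> x \<otimes> h\<^sub>(\<^sub>2\<^sub>) \<bullet> m\<close>\<close>

definition tensor_rep ::
  "('k, 'r) ring_scheme \<Rightarrow> ('k, ('k, 'h) univ, 'z) hopf_scheme \<Rightarrow>
   ('k, 'h, 'a) rep \<Rightarrow> ('k, 'h, 'a) rep \<Rightarrow> ('k, 'h, 'a) rep" where
  "tensor_rep K H = (\<lambda>(X, \<rho>) (M, \<pi>). (tensor K X M,
     \<lambda>h\<in>carrier H. tsum (End_alg K (tensor K X M)) (\<lambda>a b. tmap K X M X M (\<rho> a) (\<pi> b)) (comul H h)))"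

definition trivial_rep ::
  "('k, 'r) ring_scheme \<Rightarrow> ('k, ('k, 'h) univ, 'z) hopf_scheme \<Rightarrow> ('k, 'h, 'a) rep" where
  "trivial_rep K H = (ground K,
     \<lambda>h\<in>carrier H. \<lambda>c\<in>carrier (ground K). counit H h \<odot>\<^bsub>ground K\<^esub> c)"


section \<open>The categories of vector spaces, modules and partial modules\<close>

text \<open>Arrows are triples \<open>(A, f, B)\<close> of domain, extensional map on the carrier of \<open>A\<close>, and codomain.\<close>

definition concrete_cat ::
  "'o set \<Rightarrow> ('o \<Rightarrow> 'u set) \<Rightarrow> ('o \<Rightarrow> 'o \<Rightarrow> ('u \<Rightarrow> 'u) set) \<Rightarrow> ('o, 'o \<times> ('u \<Rightarrow> 'u) \<times> 'o) category" where
  "concrete_cat Ob car hm = \<lparr>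
     Obj = Ob,
     Arr = {(A, f, B). A \<in> Ob \<and> B \<in> Ob \<and> f \<in> hm A B},
     Dom = (\<lambda>(A, f, B). A),
     Cod = (\<lambda>(A, f, B). B),
     Ident = (\<lambda>A. (A, \<lambda>x\<in>car A. x, A)),
     Comp = (\<lambda>(B', g, C) (A, f, B). (A, compose (car A) g f, C))\<rparr>"

type_synonym ('k, 'a) vs_arr =
  "('k, 'a) vs \<times> (('k, 'a) univ \<Rightarrow> ('k, 'a) univ) \<times> ('k, 'a) vs"

type_synonym ('k, 'h, 'a) rep_arr =
  "('k, 'h, 'a) rep \<times> (('k, 'a) univ \<Rightarrow> ('k, 'a) univ) \<times> ('k, 'h, 'a) rep"

definition Vect :: "('k, 'r) ring_scheme \<Rightarrow> (('k, 'a) vs, ('k, 'a) vs_arr) monoidal" where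
  "Vect K = category.extend (concrete_cat {M. module K M} carrier (lin K))
     (monoidal.fields
       (tensor K)
       (\<lambda>(M, f, M') (N, g, N'). (tensor K M N, tmap K M N M' N' f g, tensor K M' N'))
       (ground K)
       (\<lambda>X Y Z. (tensor K (tensor K X Y) Z, assoc_map K X Y Z, tensor K X (tensor K Y Z)))
       (\<lambda>X. (tensor K (ground K) X, lunit_map K X, X))
       (\<lambda>X. (tensor K X (ground K), runit_map K X, X)))"

definition rep_tensor_arr ::
  "('k, 'r) ring_scheme \<Rightarrow> ('k, ('k, 'h) univ, 'z) hopf_scheme \<Rightarrow>
   ('k, 'h, 'a) rep_arr \<Rightarrow> ('k, 'h, 'a) rep_arr \<Rightarrow> ('k, 'h, 'a) rep_arr" where
  "rep_tensor_arr K H = (\<lambda>(M, f, M') (N, g, N').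
     (tensor_rep K H M N, tmap K (fst M) (fst N) (fst M') (fst N') f g, tensor_rep K H M' N'))"

definition rep_assoc ::
  "('k, 'r) ring_scheme \<Rightarrow> ('k, ('k, 'h) univ, 'z) hopf_scheme \<Rightarrow>
   ('k, 'h, 'a) rep \<Rightarrow> ('k, 'h, 'a) rep \<Rightarrow> ('k, 'h, 'a) rep \<Rightarrow> ('k, 'h, 'a) rep_arr" where
  "rep_assoc K H X Y Z = (tensor_rep K H (tensor_rep K H X Y) Z,
     assoc_map K (fst X) (fst Y) (fst Z), tensor_rep K H X (tensor_rep K H Y Z))"

definition rep_assoc_inv ::
  "('k, 'r) ring_scheme \<Rightarrow> ('k, ('k, 'h) univ, 'z) hopf_scheme \<Rightarrow>
   ('k, 'h, 'a) rep \<Rightarrow> ('k, 'h, 'a) rep \<Rightarrow> ('k, 'h, 'a) rep \<Rightarrow> ('k, 'h, 'a) rep_arr" where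
  "rep_assoc_inv K H X Y Z = (tensor_rep K H X (tensor_rep K H Y Z),
     assoc_inv_map K (fst X) (fst Y) (fst Z), tensor_rep K H (tensor_rep K H X Y) Z)"

definition rep_lunit ::
  "('k, 'r) ring_scheme \<Rightarrow> ('k, ('k, 'h) univ, 'z) hopf_scheme \<Rightarrow>
   ('k, 'h, 'a) rep \<Rightarrow> ('k, 'h, 'a) rep_arr" where
  "rep_lunit K H X = (tensor_rep K H (trivial_rep K H) X, lunit_map K (fst X), X)"

definition rep_runit ::
  "('k, 'r) ring_scheme \<Rightarrow> ('k, ('k, 'h) univ, 'z) hopf_scheme \<Rightarrow>
   ('k, 'h, 'a) rep \<Rightarrow> ('k, 'h, 'a) rep_arr" where
  "rep_runit K H X = (tensor_rep K H X (trivial_rep K H), runit_map K (fst X), X)"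

definition HMod ::
  "('k, 'r) ring_scheme \<Rightarrow> ('k, ('k, 'h) univ, 'z) hopf_scheme \<Rightarrow>
   (('k, 'h, 'a) rep, ('k, 'h, 'a) rep_arr) monoidal" where
  "HMod K H = category.extend
     (concrete_cat {(M, \<rho>). module K M \<and> global_rep K H (End_alg K M) \<rho>}
       (\<lambda>M. carrier (fst M)) (rep_hom K H))
     (monoidal.fields (tensor_rep K H) (rep_tensor_arr K H) (trivial_rep K H)
       (rep_assoc K H) (rep_lunit K H) (rep_runit K H))"

definition HPMod ::
  "('k, 'r) ring_scheme \<Rightarrow> ('k, ('k, 'h) univ, 'z) hopf_scheme \<Rightarrow>
   (('k, 'h, 'a) rep, ('k, 'h, 'a) rep_arr) category" where
  "HPMod K H = concrete_cat {(M, \<pi>). module K M \<and> partial_rep K H (End_alg K M) \<pi>}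
     (\<lambda>M. carrier (fst M)) (rep_hom K H)"

definition forget_arr :: "('k, 'h, 'a) rep_arr \<Rightarrow> ('k, 'a) vs_arr" where
  "forget_arr = (\<lambda>(M, f, N). (fst M, f, fst N))"

definition left_tensor_action ::
  "('k, 'r) ring_scheme \<Rightarrow> ('k, ('k, 'h) univ, 'z) hopf_scheme \<Rightarrow>
   (('k, 'h, 'a) rep, ('k, 'h, 'a) rep_arr, ('k, 'h, 'a) rep, ('k, 'h, 'a) rep_arr) left_action" where
  "left_tensor_action K H = \<lparr>
     Lob = tensor_rep K H,
     Larr = rep_tensor_arr K H,
     Luni = rep_lunit K H,
     Lmul = rep_assoc K H\<rparr>"

definition right_tensor_action ::
  "('k, 'r) ring_scheme \<Rightarrow> ('k, ('k, 'h) univ, 'z) hopf_scheme \<Rightarrow>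
   (('k, 'h, 'a) rep, ('k, 'h, 'a) rep_arr, ('k, 'h, 'a) rep, ('k, 'h, 'a) rep_arr) right_action" where
  "right_tensor_action K H = \<lparr>
     Rob = tensor_rep K H,
     Rarr = rep_tensor_arr K H,
     Runi = rep_runit K H,
     Rmul = rep_assoc_inv K H\<rparr>"

end

theory Submission
  imports Defs
begin

text \<open>The coherence conditions of the statement involve only the maps on the underlying vector
  spaces, so they follow from evaluation at pure tensors; what depends on \<open>H\<close> is that the tensor
  product of a global module \<open>X\<close> and a partial module \<open>M\<close> is again a partial module. Since
  \<open>\<Delta>(S(l)) = S(l\<^sub>(\<^sub>2\<^sub>)) \<otimes> S(l\<^sub>(\<^sub>1\<^sub>))\<close>, the operator \<open>l\<^sub>(\<^sub>1\<^sub>) \<bullet> S(l\<^sub>(\<^sub>2\<^sub>)) \<bullet> -\<close> acts on the left factor of a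
  tensor product through \<open>l\<^sub>(\<^sub>1\<^sub>)\<close>, \<open>S(l\<^sub>(\<^sub>4\<^sub>))\<close> and on the right one through \<open>l\<^sub>(\<^sub>2\<^sub>)\<close>, \<open>S(l\<^sub>(\<^sub>3\<^sub>))\<close>. If the
  partial module is on the right, its axioms apply to the adjacent legs \<open>2\<close> and \<open>3\<close>; if it is on the
  left, the legs \<open>2\<close> and \<open>3\<close> act globally, so they cancel and the axioms apply to the remaining
  two.\<close>

section \<open>Linear and bilinear maps\<close>

text \<open>The work is arranged so that every coherence law is proved only once. All
  \<open>K\<close>-linear maps from \<open>H\<close> into endomorphism algebras, with no condition
  on products or units, form the class \<open>linear_reps\<close>. The coalgebra structure of
  \<open>H\<close> already makes it a monoidal category: coassociativity is equivariance of the
  associator, and the counit laws are equivariance of the unit constraints. Global and partial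
  modules are full subcategories of it, and a full subcategory inherits functors, natural
  isomorphisms and equations. What is left are closure properties of object classes under the tensor
  product; there the algebra structure and the antipode enter. The technical obstacle is that a
  Sweedler sum runs over a list picked by \<open>SOME\<close>. Two such sums can always be
  exchanged, but replacing the list by an equivalent one, as coassociativity or the formula for the
  coproduct of an antipode demands, is legitimate only for multilinear summands. Each use of a Hopf
  algebra axiom therefore comes with side conditions of linearity in every leg, which
  syntax-directed rules discharge.\<close>

definition linear_on ::
  "('k, 'r) ring_scheme \<Rightarrow> ('k, 'b, 'm) module_scheme \<Rightarrow> ('k, 'c, 'n) module_scheme \<Rightarrow> ('b \<Rightarrow> 'c) \<Rightarrow> bool" where
  "linear_on K M N f \<longleftrightarrow> (\<forall>x\<in>carrier M. f x \<in> carrier N) \<and>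
     (\<forall>x\<in>carrier M. \<forall>y\<in>carrier M. f (x \<oplus>\<^bsub>M\<^esub> y) = f x \<oplus>\<^bsub>N\<^esub> f y) \<and>
     (\<forall>a\<in>carrier K. \<forall>x\<in>carrier M. f (a \<odot>\<^bsub>M\<^esub> x) = a \<odot>\<^bsub>N\<^esub> f x)"

definition bilinear_on ::
  "('k, 'r) ring_scheme \<Rightarrow> ('k, 'b, 'm) module_scheme \<Rightarrow> ('k, 'c, 'n) module_scheme \<Rightarrow>
   ('k, 'd, 'p) module_scheme \<Rightarrow> ('b \<Rightarrow> 'c \<Rightarrow> 'd) \<Rightarrow> bool" where
  "bilinear_on K M N B f \<longleftrightarrow>
     (\<forall>y\<in>carrier N. linear_on K M B (\<lambda>x. f x y)) \<and> (\<forall>x\<in>carrier M. linear_on K N B (\<lambda>y. f x y))"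

text \<open>Extensionality is split off from linearity because the maps inside Sweedler sums are
  plain abstractions, composed and substituted freely; it returns only when equality of arrows is at
  stake.\<close>

lemma lin_iff: "f \<in> lin K M N \<longleftrightarrow> linear_on K M N f \<and> f \<in> extensional (carrier M)"
  by (auto simp: lin_def linear_on_def PiE_def)

lemma linear_onI:
  assumes "\<And>x. x \<in> carrier M \<Longrightarrow> f x \<in> carrier N"
    and "\<And>x y. x \<in> carrier M \<Longrightarrow> y \<in> carrier M \<Longrightarrow> f (x \<oplus>\<^bsub>M\<^esub> y) = f x \<oplus>\<^bsub>N\<^esub> f y"
    and "\<And>a x. a \<in> carrier K \<Longrightarrow> x \<in> carrier M \<Longrightarrow> f (a \<odot>\<^bsub>M\<^esub> x) = a \<odot>\<^bsub>N\<^esub> f x"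
  shows "linear_on K M N f"
  using assms by (auto simp: linear_on_def)

lemma linear_onD:
  assumes "linear_on K M N f"
  shows "x \<in> carrier M \<Longrightarrow> f x \<in> carrier N"
    and "x \<in> carrier M \<Longrightarrow> y \<in> carrier M \<Longrightarrow> f (x \<oplus>\<^bsub>M\<^esub> y) = f x \<oplus>\<^bsub>N\<^esub> f y"
    and "a \<in> carrier K \<Longrightarrow> x \<in> carrier M \<Longrightarrow> f (a \<odot>\<^bsub>M\<^esub> x) = a \<odot>\<^bsub>N\<^esub> f x"
  using assms by (auto simp: linear_on_def)

lemma linear_on_zero:
  assumes "module K M" "module K N" "linear_on K M N f"
  shows "f \<zero>\<^bsub>M\<^esub> = \<zero>\<^bsub>N\<^esub>"
proof -
  interpret M: module K M by fact
  interpret N: module K N by fact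
  have "f (\<zero>\<^bsub>K\<^esub> \<odot>\<^bsub>M\<^esub> \<zero>\<^bsub>M\<^esub>) = \<zero>\<^bsub>K\<^esub> \<odot>\<^bsub>N\<^esub> f \<zero>\<^bsub>M\<^esub>"
    by (rule linear_onD(3)[OF assms(3)]) simp_all
  then show ?thesis
    using linear_onD(1)[OF assms(3)] by simp
qed

lemma bilinear_onI:
  assumes "\<And>y. y \<in> carrier N \<Longrightarrow> linear_on K M B (\<lambda>x. f x y)"
    and "\<And>x. x \<in> carrier M \<Longrightarrow> linear_on K N B (\<lambda>y. f x y)"
  shows "bilinear_on K M N B f"
  using assms by (auto simp: bilinear_on_def)

lemma bilinear_onD:
  assumes "bilinear_on K M N B f"
  shows "y \<in> carrier N \<Longrightarrow> linear_on K M B (\<lambda>x. f x y)"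
    and "x \<in> carrier M \<Longrightarrow> linear_on K N B (\<lambda>y. f x y)"
    and "x \<in> carrier M \<Longrightarrow> y \<in> carrier N \<Longrightarrow> f x y \<in> carrier B"
  using assms by (auto simp: bilinear_on_def linear_on_def)

lemma linear_on_id: "linear_on K M M (\<lambda>x. x)"
  by (simp add: linear_on_def)

lemma linear_on_comp:
  assumes "linear_on K N P f" "linear_on K M N g"
  shows "linear_on K M P (\<lambda>x. f (g x))"
  using assms by (simp add: linear_on_def)

lemma linear_on_cong:
  assumes "module K M" "\<And>x. x \<in> carrier M \<Longrightarrow> f x = g x"
  shows "linear_on K M N f \<longleftrightarrow> linear_on K M N g"
proof -
  interpret M: module K M by fact
  show ?thesis using assms(2) by (simp add: linear_on_def)
qed

lemma linear_on_restrict: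
  assumes "module K M"
  shows "linear_on K M N (\<lambda>x\<in>carrier M. f x) \<longleftrightarrow> linear_on K M N f"
  by (rule linear_on_cong[OF assms]) simp

lemma lin_eqI:
  assumes "f \<in> lin K M N" "g \<in> lin K M N'" "\<And>x. x \<in> carrier M \<Longrightarrow> f x = g x"
  shows "f = g"
  using assms by (auto simp: lin_iff intro: extensionalityI)

lemma lin_id:
  assumes "module K M"
  shows "(\<lambda>x\<in>carrier M. x) \<in> lin K M M"
  by (simp add: lin_iff linear_on_restrict[OF assms] linear_on_id)

lemma lin_compose:
  assumes "module K M" "f \<in> lin K M N" "g \<in> lin K N P"
  shows "compose (carrier M) g f \<in> lin K M P"
  using assms(2,3) by (auto simp: lin_iff compose_def linear_on_restrict[OF assms(1)] linear_on_comp)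

lemma linear_on_smult:
  assumes "module K M" "module K N" "a \<in> carrier K" "linear_on K M N f"
  shows "linear_on K M N (\<lambda>x. a \<odot>\<^bsub>N\<^esub> f x)"
proof -
  interpret M: module K M by fact
  interpret N: module K N by fact
  show ?thesis
    using assms(3) linear_onD[OF assms(4)]
    by (intro linear_onI) (auto simp: N.smult_r_distr N.smult_assoc1[symmetric] M.m_comm)
qed

lemma linear_on_add:
  assumes "module K M" "module K N" "linear_on K M N f" "linear_on K M N g"
  shows "linear_on K M N (\<lambda>x. f x \<oplus>\<^bsub>N\<^esub> g x)"
proof -
  interpret M: module K M by fact
  interpret N: module K N by fact
  show ?thesis
    using linear_onD[OF assms(3)] linear_onD[OF assms(4)]
    by (intro linear_onI) (auto simp: N.smult_r_distr N.a_ac)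
qed

lemma linear_on_const_zero:
  assumes "module K N"
  shows "linear_on K M N (\<lambda>x. \<zero>\<^bsub>N\<^esub>)"
proof -
  interpret N: module K N by fact
  show ?thesis by (intro linear_onI) auto
qed


section \<open>Formal sums\<close>

text \<open>The counterpart of \<open>tsum\<close> for an explicit list: arguments by induction on a
  formal sum are carried out here, before any representative is chosen.\<close>

definition lsum :: "('b, 'm) ring_scheme \<Rightarrow> ('x \<Rightarrow> 'y \<Rightarrow> 'b) \<Rightarrow> ('x \<times> 'y) list \<Rightarrow> 'b" where
  "lsum B f l = foldr (\<lambda>(x, y) s. f x y \<oplus>\<^bsub>B\<^esub> s) l \<zero>\<^bsub>B\<^esub>"

text \<open>Membership in \<open>lists\<close> is kept as an inductive premise that
  \<open>induction\<close> can consume, instead of being turned into a statement about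
  \<open>set\<close>.\<close>

declare in_lists_conv_set [simp del] in_listsD [rule del]

lemma lsum_simps [simp]:
  "lsum B f [] = \<zero>\<^bsub>B\<^esub>"
  "lsum B f ((x, y) # l) = f x y \<oplus>\<^bsub>B\<^esub> lsum B f l"
  by (simp_all add: lsum_def)

lemma tsum_lsum: "tsum B f t = lsum B f (summands t)"
  by (simp add: tsum_def lsum_def)

lemma lsum_closed:
  assumes "abelian_group B" "l \<in> lists (X \<times> Y)"
    and "\<And>x y. x \<in> X \<Longrightarrow> y \<in> Y \<Longrightarrow> f x y \<in> carrier B"
  shows "lsum B f l \<in> carrier B"
proof -
  interpret B: abelian_group B by fact
  show ?thesis using assms(2) by induction (auto simp: assms(3))
qed

lemma lsum_append:
  assumes "abelian_group B" "l \<in> lists (X \<times> Y)" "l' \<in> lists (X \<times> Y)"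
    and f: "\<And>x y. x \<in> X \<Longrightarrow> y \<in> Y \<Longrightarrow> f x y \<in> carrier B"
  shows "lsum B f (l @ l') = lsum B f l \<oplus>\<^bsub>B\<^esub> lsum B f l'"
proof -
  interpret B: abelian_group B by fact
  show ?thesis using assms(2)
    by induction (auto simp: f lsum_closed[OF assms(1) _ f, of _ X Y] assms(3) B.a_assoc)
qed

lemma lsum_cong:
  assumes "l \<in> lists (X \<times> Y)" "\<And>x y. x \<in> X \<Longrightarrow> y \<in> Y \<Longrightarrow> f x y = g x y"
  shows "lsum B f l = lsum B g l"
  using assms(1) by induction (auto simp: assms(2))

lemma lsum_linear:
  assumes "module K B" "module K B'" "linear_on K B B' \<phi>" "l \<in> lists (X \<times> Y)"
    and f: "\<And>x y. x \<in> X \<Longrightarrow> y \<in> Y \<Longrightarrow> f x y \<in> carrier B"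
  shows "\<phi> (lsum B f l) = lsum B' (\<lambda>x y. \<phi> (f x y)) l"
proof -
  have B: "abelian_group B" using assms(1) by (simp add: module.axioms)
  show ?thesis using assms(4)
    by induction (auto simp: f linear_onD[OF assms(3)] lsum_closed[OF B _ f, of _ X Y]
        linear_on_zero[OF assms(1,2,3)])
qed

lemma linear_on_lsum:
  assumes "module K M" "module K B" "l \<in> lists (X \<times> Y)"
    and "\<And>x y. x \<in> X \<Longrightarrow> y \<in> Y \<Longrightarrow> linear_on K M B (\<lambda>m. f m x y)"
  shows "linear_on K M B (\<lambda>m. lsum B (f m) l)"
  using assms(3)
  by induction (auto intro!: linear_on_add linear_on_const_zero assms)

lemma tens_eq_lists:
  assumes "module K M" "module K N" "tens_eq K M N l l'"
  shows "l \<in> lists (carrier M \<times> carrier N) \<and> l' \<in> lists (carrier M \<times> carrier N)"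
proof -
  interpret M: module K M by fact
  interpret N: module K N by fact
  show ?thesis using assms(3) by induction auto
qed

text \<open>The existence half of the universal property: bilinearity of \<open>f\<close> is what
  the generating relations of \<open>tens_eq\<close> ask for, and commutativity of addition in
  \<open>B\<close> takes care of the reordering.\<close>

lemma lsum_tens_eq:
  assumes "module K M" "module K N" "module K B" "bilinear_on K M N B f" "tens_eq K M N l l'"
  shows "lsum B f l = lsum B f l'"
proof -
  interpret M: module K M by fact
  interpret N: module K N by fact
  interpret B: module K B by fact
  note D = bilinear_onD[OF assms(4)]
  note app = lsum_append[OF B.abelian_group_axioms _ _ D(3), of _ "carrier M" "carrier N"]
  note cl = lsum_closed[OF B.abelian_group_axioms _ D(3), of _ "carrier M" "carrier N"]
  note mem = tens_eq_lists[OF assms(1,2)]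
  show ?thesis using assms(5)
  proof induction
    case (append l l' r r')
    then show ?case using mem[OF append.hyps(1)] mem[OF append.hyps(2)] by (simp add: app)
  next
    case (commute l r)
    then show ?case by (simp add: app cl B.a_comm)
  next
    case (add_left x x' y)
    then show ?case by (simp add: linear_onD[OF D(1)])
  next
    case (add_right x y y')
    then show ?case by (simp add: linear_onD[OF D(2)])
  next
    case (balanced a x y)
    then show ?case by (simp add: linear_onD[OF D(2)] linear_onD[OF D(1)])
  next
    case (zero y)
    then show ?case by (simp add: linear_on_zero[OF assms(1,3) D(1)])
  qed auto
qed


section \<open>Tensor products\<close>

text \<open>Since \<open>tens_eq\<close> is symmetric and transitive, equivalent lists define the
  same predicate, and \<open>SOME\<close> picks the same witness from equal predicates.\<close>

lemma tcls_cong: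
  assumes "tens_eq K M N l l'"
  shows "tcls K M N l = tcls K M N l'"
proof -
  have "tens_eq K M N l = tens_eq K M N l'"
    using assms by (auto intro: tens_eq.sym tens_eq.trans)
  then show ?thesis by (simp add: tcls_def)
qed

lemma tens_eq_summands:
  assumes "l \<in> lists (carrier M \<times> carrier N)"
  shows "tens_eq K M N l (summands (tcls K M N l))"
  unfolding tcls_def univ.sel using tens_eq.refl[OF assms] by (rule someI)

lemma tcls_tensor:
  "l \<in> lists (carrier M \<times> carrier N) \<Longrightarrow> tcls K M N l \<in> carrier (tensor K M N)"
  by (simp add: tensor_def)

text \<open>Elements are normal forms: the list stored in an element represents that very element,
  so it may be used wherever a formal sum is wanted.\<close>

lemma tensor_summands:
  assumes "module K M" "module K N" "t \<in> carrier (tensor K M N)"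
  shows "summands t \<in> lists (carrier M \<times> carrier N)" "tcls K M N (summands t) = t"
proof -
  obtain l where l: "l \<in> lists (carrier M \<times> carrier N)" "t = tcls K M N l"
    using assms(3) by (auto simp: tensor_def)
  note eq = tens_eq_summands[OF l(1), of K, folded l(2)]
  show "summands t \<in> lists (carrier M \<times> carrier N)"
    using tens_eq_lists[OF assms(1,2) eq] by simp
  show "tcls K M N (summands t) = t"
    using tcls_cong[OF eq] l(2) by simp
qed

lemma tensor_cases:
  assumes "module K M" "module K N" "t \<in> carrier (tensor K M N)"
  obtains l where "l \<in> lists (carrier M \<times> carrier N)" "t = tcls K M N l"
  using tensor_summands[OF assms] by metis

lemma tensor_zero: "\<zero>\<^bsub>tensor K M N\<^esub> = tcls K M N []"
  by (simp add: tensor_def)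

lemma tensor_add:
  assumes "module K M" "module K N" "l \<in> lists (carrier M \<times> carrier N)" "l' \<in> lists (carrier M \<times> carrier N)"
  shows "tcls K M N l \<oplus>\<^bsub>tensor K M N\<^esub> tcls K M N l' = tcls K M N (l @ l')"
  using assms tcls_cong[OF tens_eq.append[OF tens_eq_summands[of l M N K] tens_eq_summands[of l' M N K]]]
  by (simp add: tensor_def)

text \<open>Scalars act on left entries only; the relation \<open>balanced\<close> survives this
  because multiplication in \<open>K\<close> is commutative.\<close>

lemma tens_eq_smult:
  assumes "module K M" "module K N" "a \<in> carrier K" "tens_eq K M N l l'"
  shows "tens_eq K M N (map (\<lambda>(x, y). (a \<odot>\<^bsub>M\<^esub> x, y)) l) (map (\<lambda>(x, y). (a \<odot>\<^bsub>M\<^esub> x, y)) l')"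
proof -
  interpret M: module K M by fact
  interpret N: module K N by fact
  have *: "map (\<lambda>(x, y). (a \<odot>\<^bsub>M\<^esub> x, y)) l \<in> lists (carrier M \<times> carrier N)"
    if "l \<in> lists (carrier M \<times> carrier N)" for l
    using that assms(3) by induction auto
  show ?thesis using assms(4)
  proof induction
    case (refl l)
    then show ?case by (intro tens_eq.refl *)
  next
    case (commute l r)
    then show ?case using tens_eq.commute[OF * *] by simp
  next
    case (add_left x x' y)
    then show ?case using assms(3) by (simp add: M.smult_r_distr tens_eq.add_left)
  next
    case (balanced b x y)
    then show ?case using assms(3) tens_eq.balanced[of b K "a \<odot>\<^bsub>M\<^esub> x" M y N]
      by (simp add: M.smult_assoc1[symmetric] M.m_comm)
  next
    case (zero y)
    then show ?case using assms(3) by (simp add: tens_eq.zero)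
  qed (auto simp: assms(3) intro: tens_eq.sym tens_eq.trans tens_eq.append tens_eq.add_right)
qed

lemma tensor_smult:
  assumes "module K M" "module K N" "a \<in> carrier K" "l \<in> lists (carrier M \<times> carrier N)"
  shows "a \<odot>\<^bsub>tensor K M N\<^esub> tcls K M N l = tcls K M N (map (\<lambda>(x, y). (a \<odot>\<^bsub>M\<^esub> x, y)) l)"
  using tcls_cong[OF tens_eq_smult[OF assms(1-3) tens_eq_summands[OF assms(4)]]]
  by (simp add: tensor_def)

lemma tensor_module:
  assumes "module K M" "module K N"
  shows "module K (tensor K M N)"
proof -
  interpret M: module K M by fact
  interpret N: module K N by fact
  let ?L = "lists (carrier M \<times> carrier N)" and ?T = "tensor K M N"
  note add = tensor_add[OF assms] and smult = tensor_smult[OF assms] and cases = tensor_cases[OF assms]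
  have sL: "map (\<lambda>(x, y). (a \<odot>\<^bsub>M\<^esub> x, y)) l \<in> ?L" if "a \<in> carrier K" "l \<in> ?L" for a l
    using that(2,1) by induction auto
  have cons: "tens_eq K M N (p # q # l @ l') (l @ p # q # l')"
    if "p \<in> carrier M \<times> carrier N" "q \<in> carrier M \<times> carrier N" "l \<in> ?L" "l' \<in> ?L" for p q l l'
    using tens_eq.append[OF tens_eq.commute[of "[p, q]" M N l K] tens_eq.refl[OF that(4)]] that by simp
  \<comment> \<open>Negating the left entries gives the additive inverse: each entry is moved next
    to its negative with \<open>commute\<close>, and the two merge by \<open>add_left\<close> into a
    pair with left entry zero.\<close>
  have neg: "tens_eq K M N (map (\<lambda>(x, y). (\<ominus>\<^bsub>M\<^esub> x, y)) l @ l) []" if "l \<in> ?L" for l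
    using that
  proof induction
    case (Cons p l)
    obtain x y where p: "p = (x, y)" "x \<in> carrier M" "y \<in> carrier N" using Cons.hyps by auto
    let ?n = "map (\<lambda>(x, y). (\<ominus>\<^bsub>M\<^esub> x, y)) l"
    have n: "?n \<in> ?L" using \<open>l \<in> ?L\<close> by induction auto
    have "tens_eq K M N [(\<ominus>\<^bsub>M\<^esub> x, y), (x, y)] []"
      using tens_eq.trans[OF tens_eq.sym[OF tens_eq.add_left[of "\<ominus>\<^bsub>M\<^esub> x" M x y N K]]
          tens_eq.zero[of y N K M, folded M.l_neg[OF p(2)]]] p by simp
    then have "tens_eq K M N ([(\<ominus>\<^bsub>M\<^esub> x, y), (x, y)] @ ?n @ l) ([] @ [])"
      using Cons.IH by (rule tens_eq.append)
    moreover have "tens_eq K M N ((\<ominus>\<^bsub>M\<^esub> x, y) # ?n @ (x, y) # l) ([(\<ominus>\<^bsub>M\<^esub> x, y), (x, y)] @ ?n @ l)"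
      using tens_eq.append[OF tens_eq.refl[of "[(\<ominus>\<^bsub>M\<^esub> x, y)]"]
          tens_eq.append[OF tens_eq.commute[of ?n M N "[(x, y)]" K] tens_eq.refl[OF \<open>l \<in> ?L\<close>]]] p n
      by simp
    ultimately show ?case using p(1) tens_eq.trans by fastforce
  qed (simp add: tens_eq.refl)
  \<comment> \<open>Distributivity over sums of scalars is the one scalar law that fails for lists
    as they stand: entries have to be split and regrouped. The other scalar laws hold for the lists
    themselves.\<close>
  have l_distr: "tens_eq K M N (map (\<lambda>(x, y). ((a \<oplus>\<^bsub>K\<^esub> b) \<odot>\<^bsub>M\<^esub> x, y)) l)
      (map (\<lambda>(x, y). (a \<odot>\<^bsub>M\<^esub> x, y)) l @ map (\<lambda>(x, y). (b \<odot>\<^bsub>M\<^esub> x, y)) l)"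
    if "a \<in> carrier K" "b \<in> carrier K" "l \<in> ?L" for a b l
    using that(3)
  proof induction
    case (Cons p l)
    obtain x y where p: "p = (x, y)" "x \<in> carrier M" "y \<in> carrier N" using Cons.hyps by auto
    let ?a = "map (\<lambda>(x, y). (a \<odot>\<^bsub>M\<^esub> x, y)) l" and ?b = "map (\<lambda>(x, y). (b \<odot>\<^bsub>M\<^esub> x, y)) l"
    have L: "?a \<in> ?L" "?b \<in> ?L" using sL that Cons.hyps by auto
    have "tens_eq K M N ([((a \<oplus>\<^bsub>K\<^esub> b) \<odot>\<^bsub>M\<^esub> x, y)] @ map (\<lambda>(x, y). ((a \<oplus>\<^bsub>K\<^esub> b) \<odot>\<^bsub>M\<^esub> x, y)) l)
        ([(a \<odot>\<^bsub>M\<^esub> x, y), (b \<odot>\<^bsub>M\<^esub> x, y)] @ ?a @ ?b)"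
      using Cons.IH p that by (intro tens_eq.append) (simp_all add: M.smult_l_distr tens_eq.add_left)
    moreover have "tens_eq K M N ([(a \<odot>\<^bsub>M\<^esub> x, y), (b \<odot>\<^bsub>M\<^esub> x, y)] @ ?a @ ?b)
        ((a \<odot>\<^bsub>M\<^esub> x, y) # ?a @ (b \<odot>\<^bsub>M\<^esub> x, y) # ?b)"
      using tens_eq.append[OF tens_eq.refl[of "[(a \<odot>\<^bsub>M\<^esub> x, y)]"]
          tens_eq.append[OF tens_eq.commute[of "[(b \<odot>\<^bsub>M\<^esub> x, y)]" M N ?a K] tens_eq.refl[OF L(2)]]] p L that
      by simp
    ultimately show ?case using p(1) tens_eq.trans by fastforce
  qed (simp add: tens_eq.refl)
  have grp: "abelian_group ?T"
  proof (rule abelian_groupI)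
    fix s t assume "s \<in> carrier ?T" "t \<in> carrier ?T"
    then obtain l l' where ll: "l \<in> ?L" "s = tcls K M N l" "l' \<in> ?L" "t = tcls K M N l'"
      using cases by metis
    then show "s \<oplus>\<^bsub>?T\<^esub> t \<in> carrier ?T" by (simp add: add tcls_tensor)
    show "s \<oplus>\<^bsub>?T\<^esub> t = t \<oplus>\<^bsub>?T\<^esub> s"
      using ll tcls_cong[OF tens_eq.commute[OF ll(1,3)]] by (simp add: add)
    fix u assume "u \<in> carrier ?T"
    then obtain l'' where "l'' \<in> ?L" "u = tcls K M N l''" using cases by metis
    then show "s \<oplus>\<^bsub>?T\<^esub> t \<oplus>\<^bsub>?T\<^esub> u = s \<oplus>\<^bsub>?T\<^esub> (t \<oplus>\<^bsub>?T\<^esub> u)" using ll by (simp add: add)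
  next
    fix s assume "s \<in> carrier ?T"
    then obtain l where l: "l \<in> ?L" "s = tcls K M N l" using cases by metis
    show "\<zero>\<^bsub>?T\<^esub> \<oplus>\<^bsub>?T\<^esub> s = s" using l by (simp add: tensor_zero add)
    have "map (\<lambda>(x, y). (\<ominus>\<^bsub>M\<^esub> x, y)) l \<in> ?L" using l(1) by induction auto
    then show "\<exists>t\<in>carrier ?T. t \<oplus>\<^bsub>?T\<^esub> s = \<zero>\<^bsub>?T\<^esub>"
      using l tcls_cong[OF neg[OF l(1)]]
      by (intro bexI[of _ "tcls K M N (map (\<lambda>(x, y). (\<ominus>\<^bsub>M\<^esub> x, y)) l)"])
        (simp_all add: tensor_zero add tcls_tensor)
  qed (simp add: tensor_zero tcls_tensor)
  show ?thesis
  proof (rule moduleI[OF M.is_cring grp])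
    fix a s assume a: "a \<in> carrier K" and "s \<in> carrier ?T"
    then obtain l where l: "l \<in> ?L" "s = tcls K M N l" using cases by metis
    show "a \<odot>\<^bsub>?T\<^esub> s \<in> carrier ?T" using a l sL by (simp add: smult tcls_tensor)
    fix b assume b: "b \<in> carrier K"
    show "(a \<oplus>\<^bsub>K\<^esub> b) \<odot>\<^bsub>?T\<^esub> s = (a \<odot>\<^bsub>?T\<^esub> s) \<oplus>\<^bsub>?T\<^esub> (b \<odot>\<^bsub>?T\<^esub> s)"
      using a b l sL tcls_cong[OF l_distr[OF a b l(1)]] by (simp add: smult add)
    have "map (\<lambda>(x, y). ((a \<otimes>\<^bsub>K\<^esub> b) \<odot>\<^bsub>M\<^esub> x, y)) l
        = map (\<lambda>(x, y). (a \<odot>\<^bsub>M\<^esub> x, y)) (map (\<lambda>(x, y). (b \<odot>\<^bsub>M\<^esub> x, y)) l)"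
      using l(1) a b by induction (auto simp: M.smult_assoc1)
    then show "(a \<otimes>\<^bsub>K\<^esub> b) \<odot>\<^bsub>?T\<^esub> s = a \<odot>\<^bsub>?T\<^esub> (b \<odot>\<^bsub>?T\<^esub> s)"
      using a b l sL by (simp add: smult del: map_map map_eq_conv)
  next
    fix a s t assume a: "a \<in> carrier K" and "s \<in> carrier ?T" "t \<in> carrier ?T"
    then obtain l l' where "l \<in> ?L" "s = tcls K M N l" "l' \<in> ?L" "t = tcls K M N l'"
      using cases by metis
    then show "a \<odot>\<^bsub>?T\<^esub> (s \<oplus>\<^bsub>?T\<^esub> t) = (a \<odot>\<^bsub>?T\<^esub> s) \<oplus>\<^bsub>?T\<^esub> (a \<odot>\<^bsub>?T\<^esub> t)"
      using a sL by (simp add: add smult)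
  next
    fix s assume "s \<in> carrier ?T"
    then obtain l where l: "l \<in> ?L" "s = tcls K M N l" using cases by metis
    have "map (\<lambda>(x, y). (\<one>\<^bsub>K\<^esub> \<odot>\<^bsub>M\<^esub> x, y)) l = l" using l(1) by induction auto
    then show "\<one>\<^bsub>K\<^esub> \<odot>\<^bsub>?T\<^esub> s = s" using l by (simp add: smult)
  qed
qed

lemma pure_closed:
  "x \<in> carrier M \<Longrightarrow> y \<in> carrier N \<Longrightarrow> pure K M N x y \<in> carrier (tensor K M N)"
  by (simp add: pure_def tcls_tensor)

lemma bilinear_pure:
  assumes "module K M" "module K N"
  shows "bilinear_on K M N (tensor K M N) (pure K M N)"
proof -
  interpret M: module K M by fact
  interpret N: module K N by fact
  have "pure K M N x (a \<odot>\<^bsub>N\<^esub> y) = a \<odot>\<^bsub>tensor K M N\<^esub> pure K M N x y"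
    if "a \<in> carrier K" "x \<in> carrier M" "y \<in> carrier N" for a x y
    using that tcls_cong[OF tens_eq.balanced[OF that]] by (simp add: pure_def tensor_smult[OF assms])
  moreover have "pure K M N (x \<oplus>\<^bsub>M\<^esub> x') y = pure K M N x y \<oplus>\<^bsub>tensor K M N\<^esub> pure K M N x' y"
    if "x \<in> carrier M" "x' \<in> carrier M" "y \<in> carrier N" for x x' y
    using that tcls_cong[OF tens_eq.add_left[OF that]] by (simp add: pure_def tensor_add[OF assms])
  moreover have "pure K M N x (y \<oplus>\<^bsub>N\<^esub> y') = pure K M N x y \<oplus>\<^bsub>tensor K M N\<^esub> pure K M N x y'"
    if "x \<in> carrier M" "y \<in> carrier N" "y' \<in> carrier N" for x y y'
    using that tcls_cong[OF tens_eq.add_right[OF that]] by (simp add: pure_def tensor_add[OF assms])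
  moreover have "pure K M N (a \<odot>\<^bsub>M\<^esub> x) y = a \<odot>\<^bsub>tensor K M N\<^esub> pure K M N x y"
    if "a \<in> carrier K" "x \<in> carrier M" "y \<in> carrier N" for a x y
    using that by (simp add: pure_def tensor_smult[OF assms])
  ultimately show ?thesis
    by (auto intro!: bilinear_onI linear_onI pure_closed)
qed

text \<open>Turns the class of a list into a sum inside the module, so that linear maps can be
  pushed through it.\<close>

lemma tcls_lsum:
  assumes "module K M" "module K N" "l \<in> lists (carrier M \<times> carrier N)"
  shows "tcls K M N l = lsum (tensor K M N) (pure K M N) l"
  using assms(3)
proof induction
  case (Cons p l)
  then have "tcls K M N (p # l) = pure K M N (fst p) (snd p) \<oplus>\<^bsub>tensor K M N\<^esub> tcls K M N l"
    using tensor_add[OF assms(1,2), of "[p]" l] by (simp add: pure_def)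
  with Cons show ?case by (cases p) simp
qed (simp add: tensor_zero)

lemma tensor_ext:
  assumes "module K M" "module K N" "module K B"
    and "linear_on K (tensor K M N) B F" "linear_on K (tensor K M N) B G"
    and "\<And>x y. x \<in> carrier M \<Longrightarrow> y \<in> carrier N \<Longrightarrow> F (pure K M N x y) = G (pure K M N x y)"
    and "t \<in> carrier (tensor K M N)"
  shows "F t = G t"
proof -
  note T = tensor_module[OF assms(1,2)]
  obtain l where l: "l \<in> lists (carrier M \<times> carrier N)" "t = tcls K M N l"
    using tensor_cases[OF assms(1,2,7)] .
  have *: "\<phi> t = lsum B (\<lambda>x y. \<phi> (pure K M N x y)) l" if "linear_on K (tensor K M N) B \<phi>" for \<phi>
    unfolding l(2) tcls_lsum[OF assms(1,2) l(1)]
    by (rule lsum_linear[OF T assms(3) that l(1)]) (rule pure_closed)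
  show ?thesis
    unfolding *[OF assms(4)] *[OF assms(5)] by (rule lsum_cong[OF l(1) assms(6)])
qed

text \<open>By itself \<open>tsum\<close> reads off the list chosen by \<open>SOME\<close>; for
  bilinear \<open>f\<close> any other representative gives the same value, and this is how
  \<open>tsum\<close> gets evaluated at a concrete element.\<close>

lemma tsum_tcls:
  assumes "module K M" "module K N" "module K B" "bilinear_on K M N B f"
    and "l \<in> lists (carrier M \<times> carrier N)"
  shows "tsum B f (tcls K M N l) = lsum B f l"
  using lsum_tens_eq[OF assms(1-4) tens_eq_summands[OF assms(5)]] by (simp add: tsum_lsum)

lemma tsum_pure:
  assumes "module K M" "module K N" "module K B" "bilinear_on K M N B f"
    and "x \<in> carrier M" "y \<in> carrier N"
  shows "tsum B f (pure K M N x y) = f x y"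
proof -
  interpret B: module K B by fact
  show ?thesis unfolding pure_def using assms bilinear_onD(3)[OF assms(4)]
    by (subst tsum_tcls[OF assms(1-4)]) auto
qed

lemma tsum_closed:
  assumes "module K M" "module K N" "abelian_group B" "t \<in> carrier (tensor K M N)"
    and "\<And>x y. x \<in> carrier M \<Longrightarrow> y \<in> carrier N \<Longrightarrow> f x y \<in> carrier B"
  shows "tsum B f t \<in> carrier B"
  unfolding tsum_lsum using lsum_closed[OF assms(3) tensor_summands(1)[OF assms(1,2,4)] assms(5)] .

lemma tsum_cong:
  assumes "module K M" "module K N" "t \<in> carrier (tensor K M N)"
    and "\<And>x y. x \<in> carrier M \<Longrightarrow> y \<in> carrier N \<Longrightarrow> f x y = g x y"
  shows "tsum B f t = tsum B g t"
  unfolding tsum_lsum using lsum_cong[OF tensor_summands(1)[OF assms(1-3)] assms(4)] .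

lemma linear_tsum:
  assumes "module K M" "module K N" "module K B" "module K B'" "linear_on K B B' \<phi>"
    and "t \<in> carrier (tensor K M N)"
    and "\<And>x y. x \<in> carrier M \<Longrightarrow> y \<in> carrier N \<Longrightarrow> f x y \<in> carrier B"
  shows "\<phi> (tsum B f t) = tsum B' (\<lambda>x y. \<phi> (f x y)) t"
  unfolding tsum_lsum
  using lsum_linear[OF assms(3-5) tensor_summands(1)[OF assms(1,2,6)] assms(7)] .

text \<open>Linearity in a parameter while the tensor, and hence its list, stays fixed. Linearity in
  the tensor itself is \<open>linear_on_tsum\<close>, which rests on bilinearity of the
  summand.\<close>

lemma linear_on_tsum_fun:
  assumes "module K M" "module K N" "module K L" "module K B" "t \<in> carrier (tensor K M N)"
    and "\<And>x y. x \<in> carrier M \<Longrightarrow> y \<in> carrier N \<Longrightarrow> linear_on K L B (\<lambda>m. f m x y)"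
  shows "linear_on K L B (\<lambda>m. tsum B (\<lambda>x y. f m x y) t)"
  unfolding tsum_lsum
  using linear_on_lsum[OF assms(3,4) tensor_summands(1)[OF assms(1,2,5)] assms(6)] .

lemma linear_on_tsum:
  assumes "module K M" "module K N" "module K B" "bilinear_on K M N B f"
  shows "linear_on K (tensor K M N) B (tsum B f)"
proof -
  interpret M: module K M by fact
  interpret B: module K B by fact
  note D = bilinear_onD[OF assms(4)] and cases = tensor_cases[OF assms(1,2)]
    and sum = tsum_tcls[OF assms]
  show ?thesis
  proof (rule linear_onI)
    fix s assume "s \<in> carrier (tensor K M N)"
    then show "tsum B f s \<in> carrier B"
      using D(3) by (rule tsum_closed[OF assms(1,2) B.abelian_group_axioms])
  next
    fix s t assume "s \<in> carrier (tensor K M N)" "t \<in> carrier (tensor K M N)"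
    then obtain l l' where l: "l \<in> lists (carrier M \<times> carrier N)" "s = tcls K M N l"
      "l' \<in> lists (carrier M \<times> carrier N)" "t = tcls K M N l'" using cases by metis
    then show "tsum B f (s \<oplus>\<^bsub>tensor K M N\<^esub> t) = tsum B f s \<oplus>\<^bsub>B\<^esub> tsum B f t"
      by (simp add: tensor_add[OF assms(1,2)] sum
          lsum_append[OF B.abelian_group_axioms l(1,3) D(3)])
  next
    fix a s assume a: "a \<in> carrier K" and "s \<in> carrier (tensor K M N)"
    then obtain l where l: "l \<in> lists (carrier M \<times> carrier N)" "s = tcls K M N l" using cases by metis
    have L: "map (\<lambda>(x, y). (a \<odot>\<^bsub>M\<^esub> x, y)) l \<in> lists (carrier M \<times> carrier N)"
      using l(1) a by induction auto
    have "lsum B f (map (\<lambda>(x, y). (a \<odot>\<^bsub>M\<^esub> x, y)) l) = a \<odot>\<^bsub>B\<^esub> lsum B f l"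
      using l(1) a
      by induction (auto simp: linear_onD[OF D(1)] B.smult_r_distr D(3)
          lsum_closed[OF B.abelian_group_axioms _ D(3), of _ "carrier M" "carrier N"])
    then show "tsum B f (a \<odot>\<^bsub>tensor K M N\<^esub> s) = a \<odot>\<^bsub>B\<^esub> tsum B f s"
      using l L a by (simp add: tensor_smult[OF assms(1,2)] sum)
  qed
qed

text \<open>Both tensors stay fixed, so this is the exchange of two finite sums over their lists and
  not a statement about equivalent representatives.\<close>

lemma tsum_swap:
  assumes "module K M" "module K N" "module K M'" "module K N'" "module K B"
    and "s \<in> carrier (tensor K M N)" "t \<in> carrier (tensor K M' N')"
    and "\<And>a b c d. a \<in> carrier M \<Longrightarrow> b \<in> carrier N \<Longrightarrow> c \<in> carrier M' \<Longrightarrow> d \<in> carrier N' \<Longrightarrow>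
      f a b c d \<in> carrier B"
  shows "tsum B (\<lambda>a b. tsum B (\<lambda>c d. f a b c d) t) s = tsum B (\<lambda>c d. tsum B (\<lambda>a b. f a b c d) s) t"
proof -
  interpret B: module K B by fact
  note S = tensor_summands(1)[OF assms(1,2,6)] and T = tensor_summands(1)[OF assms(3,4,7)]
  have zero: "lsum B (\<lambda>c d. \<zero>\<^bsub>B\<^esub>) l = \<zero>\<^bsub>B\<^esub>" for l :: "('x \<times> 'y) list"
    by (induction l) auto
  have add: "lsum B (\<lambda>c d. g c d \<oplus>\<^bsub>B\<^esub> h c d) l = lsum B g l \<oplus>\<^bsub>B\<^esub> lsum B h l"
    if "l \<in> lists (carrier M' \<times> carrier N')"
      "\<And>c d. c \<in> carrier M' \<Longrightarrow> d \<in> carrier N' \<Longrightarrow> g c d \<in> carrier B"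
      "\<And>c d. c \<in> carrier M' \<Longrightarrow> d \<in> carrier N' \<Longrightarrow> h c d \<in> carrier B" for l g h
    using that(1) lsum_closed[OF B.abelian_group_axioms _ that(2), of _ "carrier M'" "carrier N'"]
      lsum_closed[OF B.abelian_group_axioms _ that(3), of _ "carrier M'" "carrier N'"]
    by induction (auto simp: B.a_ac that(2,3))
  show ?thesis unfolding tsum_lsum using S
  proof induction
    case (Cons p l)
    then show ?case using T assms(8)
      by (cases p) (auto simp: add lsum_closed[OF B.abelian_group_axioms])
  qed (simp add: zero)
qed

section \<open>Spanning sets\<close>

text \<open>Encoded as an induction principle and not through linear combinations. The closure
  conditions concern only those elements of \<open>T\<close> that lie in the carrier, so
  \<open>T\<close> can be the extension of any predicate on the whole type.\<close>

definition spans :: "('k, 'r) ring_scheme \<Rightarrow> ('k, 'b, 'm) module_scheme \<Rightarrow> 'b set \<Rightarrow> bool" where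
  "spans K M S \<longleftrightarrow> S \<subseteq> carrier M \<and>
     (\<forall>T. S \<subseteq> T \<longrightarrow> \<zero>\<^bsub>M\<^esub> \<in> T \<longrightarrow>
        (\<forall>x\<in>T \<inter> carrier M. \<forall>y\<in>T \<inter> carrier M. x \<oplus>\<^bsub>M\<^esub> y \<in> T) \<longrightarrow>
        (\<forall>a\<in>carrier K. \<forall>x\<in>T \<inter> carrier M. a \<odot>\<^bsub>M\<^esub> x \<in> T) \<longrightarrow> carrier M \<subseteq> T)"

definition pures where
  "pures K M N S S' = (\<lambda>(x, y). pure K M N x y) ` (S \<times> S')"

lemma spans_carrier: "spans K M (carrier M)"
  by (auto simp: spans_def)

lemma spans_subset: "spans K M S \<Longrightarrow> x \<in> S \<Longrightarrow> x \<in> carrier M"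
  by (auto simp: spans_def)

lemma spansD:
  assumes "spans K M S" "\<And>x. x \<in> S \<Longrightarrow> P x" "P \<zero>\<^bsub>M\<^esub>"
    and "\<And>x y. x \<in> carrier M \<Longrightarrow> y \<in> carrier M \<Longrightarrow> P x \<Longrightarrow> P y \<Longrightarrow> P (x \<oplus>\<^bsub>M\<^esub> y)"
    and "\<And>a x. a \<in> carrier K \<Longrightarrow> x \<in> carrier M \<Longrightarrow> P x \<Longrightarrow> P (a \<odot>\<^bsub>M\<^esub> x)"
    and "x \<in> carrier M"
  shows "P x"
proof -
  have "carrier M \<subseteq> {x. P x}"
    using assms(1)[unfolded spans_def, THEN conjunct2, rule_format, of "{x. P x}"] assms(2-5) by auto
  then show ?thesis using assms(6) by auto
qed

lemma spans_preimage:
  assumes "module K M" "module K N" "linear_on K M N f" "spans K M S" "x \<in> carrier M"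
    and "\<And>x. x \<in> S \<Longrightarrow> f x \<in> Q" "\<zero>\<^bsub>N\<^esub> \<in> Q"
    and "\<And>x y. x \<in> carrier N \<Longrightarrow> y \<in> carrier N \<Longrightarrow> x \<in> Q \<Longrightarrow> y \<in> Q \<Longrightarrow> x \<oplus>\<^bsub>N\<^esub> y \<in> Q"
    and "\<And>a x. a \<in> carrier K \<Longrightarrow> x \<in> carrier N \<Longrightarrow> x \<in> Q \<Longrightarrow> a \<odot>\<^bsub>N\<^esub> x \<in> Q"
  shows "f x \<in> Q"
proof (rule spansD[OF assms(4) assms(6) _ _ _ assms(5)])
  show "f \<zero>\<^bsub>M\<^esub> \<in> Q" using linear_on_zero[OF assms(1-3)] assms(7) by simp
qed (use linear_onD[OF assms(3)] assms(8,9) in metis)+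

text \<open>Linearity of a pure tensor in each entry allows two passes: from \<open>S'\<close> to
  all of \<open>N\<close> with the left entry in \<open>S\<close>, then from \<open>S\<close> to all
  of \<open>M\<close>. Iterated, this shows that nested pure tensors span iterated tensor products
  in either bracketing.\<close>

lemma spans_pures:
  assumes "module K M" "module K N" "spans K M S" "spans K N S'"
  shows "spans K (tensor K M N) (pures K M N S S')"
  unfolding spans_def
proof (intro conjI allI impI subsetI)
  interpret T: module K "tensor K M N" by (rule tensor_module[OF assms(1,2)])
  note D = bilinear_onD[OF bilinear_pure[OF assms(1,2)]]
  fix Q t
  assume Q: "pures K M N S S' \<subseteq> Q" "\<zero>\<^bsub>tensor K M N\<^esub> \<in> Q"
    "\<forall>x\<in>Q \<inter> carrier (tensor K M N). \<forall>y\<in>Q \<inter> carrier (tensor K M N). x \<oplus>\<^bsub>tensor K M N\<^esub> y \<in> Q"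
    "\<forall>a\<in>carrier K. \<forall>x\<in>Q \<inter> carrier (tensor K M N). a \<odot>\<^bsub>tensor K M N\<^esub> x \<in> Q"
    and t: "t \<in> carrier (tensor K M N)"
  have Q3: "x \<oplus>\<^bsub>tensor K M N\<^esub> y \<in> Q"
    if "x \<in> carrier (tensor K M N)" "y \<in> carrier (tensor K M N)" "x \<in> Q" "y \<in> Q" for x y
    using Q(3) that by blast
  have Q4: "a \<odot>\<^bsub>tensor K M N\<^esub> x \<in> Q"
    if "a \<in> carrier K" "x \<in> carrier (tensor K M N)" "x \<in> Q" for a x
    using Q(4) that by blast
  have 1: "pure K M N x y \<in> Q" if "x \<in> S" "y \<in> carrier N" for x y
  proof (rule spans_preimage[OF assms(2) T.module_axioms D(2) assms(4) that(2) _ Q(2) Q3 Q4])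
    show "x \<in> carrier M" using spans_subset[OF assms(3) that(1)] .
    show "pure K M N x y \<in> Q" if "y \<in> S'" for y using that \<open>x \<in> S\<close> Q(1) by (auto simp: pures_def)
  qed
  have 2: "pure K M N x y \<in> Q" if "x \<in> carrier M" "y \<in> carrier N" for x y
    by (rule spans_preimage[OF assms(1) T.module_axioms D(1)[OF that(2)] assms(3) that(1) _ Q(2) Q3 Q4])
      (rule 1[OF _ that(2)])
  obtain l where l: "l \<in> lists (carrier M \<times> carrier N)" "t = tcls K M N l"
    using tensor_cases[OF assms(1,2) t] .
  have "lsum (tensor K M N) (pure K M N) l \<in> Q \<inter> carrier (tensor K M N)"
    using l(1)
  proof induction
    case (Cons p l)
    then show ?case using 2 Q3 by (cases p) (simp add: pure_closed)
  qed (simp add: Q(2))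
  then show "t \<in> Q" using l tcls_lsum[OF assms(1,2) l(1)] by simp
next
  fix t assume "t \<in> pures K M N S S'"
  then show "t \<in> carrier (tensor K M N)"
    using spans_subset[OF assms(3)] spans_subset[OF assms(4)] by (auto simp: pures_def pure_closed)
qed

lemma linear_on_eq:
  assumes "spans K M S" "module K M" "module K B" "linear_on K M B F" "linear_on K M B G"
    and "\<And>x. x \<in> S \<Longrightarrow> F x = G x" "x \<in> carrier M"
  shows "F x = G x"
  by (rule spansD[OF assms(1) _ _ _ _ assms(7)])
    (simp_all add: assms(6) linear_onD[OF assms(4)] linear_onD[OF assms(5)]
      linear_on_zero[OF assms(2,3,4)] linear_on_zero[OF assms(2,3,5)])

lemma lin_linear: "f \<in> lin K M N \<Longrightarrow> linear_on K M N f"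
  by (simp add: lin_iff)

text \<open>The common pattern of the coherence proofs: both maps are linear, a set of nested pure
  tensors spans the domain, the values agree there, and extensionality turns this into equality of
  functions.\<close>

lemma lin_eq:
  assumes "f \<in> lin K M B" "g \<in> lin K M B" "module K M" "module K B" "spans K M S"
    and "\<And>x. x \<in> S \<Longrightarrow> f x = g x"
  shows "f = g"
proof (rule lin_eqI[OF assms(1,2)])
  fix x assume x: "x \<in> carrier M"
  show "f x = g x"
    by (rule linear_on_eq[OF assms(5,3,4) lin_linear[OF assms(1)] lin_linear[OF assms(2)] assms(6) x])
qed


section \<open>Structure maps of the tensor product\<close>

lemma lin_closed: "f \<in> lin K M N \<Longrightarrow> x \<in> carrier M \<Longrightarrow> f x \<in> carrier N"
  by (auto simp: lin_def)

lemma linear_on_pure1: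
  assumes "module K M" "module K N" "linear_on K L M f" "y \<in> carrier N"
  shows "linear_on K L (tensor K M N) (\<lambda>m. pure K M N (f m) y)"
  using linear_on_comp[OF bilinear_onD(1)[OF bilinear_pure[OF assms(1,2)] assms(4)] assms(3)] .

lemma linear_on_pure2:
  assumes "module K M" "module K N" "linear_on K L N f" "x \<in> carrier M"
  shows "linear_on K L (tensor K M N) (\<lambda>m. pure K M N x (f m))"
  using linear_on_comp[OF bilinear_onD(2)[OF bilinear_pure[OF assms(1,2)] assms(4)] assms(3)] .

text \<open>The associator is given by nested sums; this derives bilinearity of the inner sum from
  linearity in the three variables separately.\<close>

lemma bilinear_on_tsum1:
  assumes "module K X" "module K Y" "module K Z" "module K B"
    and "\<And>y z. y \<in> carrier Y \<Longrightarrow> z \<in> carrier Z \<Longrightarrow> linear_on K X B (\<lambda>x. f x y z)"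
    and "\<And>x z. x \<in> carrier X \<Longrightarrow> z \<in> carrier Z \<Longrightarrow> linear_on K Y B (\<lambda>y. f x y z)"
    and "\<And>x y. x \<in> carrier X \<Longrightarrow> y \<in> carrier Y \<Longrightarrow> linear_on K Z B (\<lambda>z. f x y z)"
  shows "bilinear_on K (tensor K X Y) Z B (\<lambda>s z. tsum B (\<lambda>x y. f x y z) s)"
  using assms
  by (intro bilinear_onI linear_on_tsum linear_on_tsum_fun[OF assms(1,2)]) auto

lemma bilinear_on_tsum2:
  assumes "module K X" "module K Y" "module K Z" "module K B"
    and "\<And>y z. y \<in> carrier Y \<Longrightarrow> z \<in> carrier Z \<Longrightarrow> linear_on K X B (\<lambda>x. f x y z)"
    and "\<And>x z. x \<in> carrier X \<Longrightarrow> z \<in> carrier Z \<Longrightarrow> linear_on K Y B (\<lambda>y. f x y z)"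
    and "\<And>x y. x \<in> carrier X \<Longrightarrow> y \<in> carrier Y \<Longrightarrow> linear_on K Z B (\<lambda>z. f x y z)"
  shows "bilinear_on K X (tensor K Y Z) B (\<lambda>x s. tsum B (\<lambda>y z. f x y z) s)"
  using assms
  by (intro bilinear_onI linear_on_tsum linear_on_tsum_fun[OF assms(2,3)]) auto

lemma restrict_tsum_lin:
  assumes "module K M" "module K N" "module K B" "bilinear_on K M N B f"
  shows "(\<lambda>t\<in>carrier (tensor K M N). tsum B f t) \<in> lin K (tensor K M N) B"
  by (simp add: lin_iff linear_on_restrict tensor_module assms(1,2) linear_on_tsum[OF assms])

lemma bilinear_on_pure_lin:
  assumes "module K M'" "module K N'" "f \<in> lin K M M'" "g \<in> lin K N N'"
  shows "bilinear_on K M N (tensor K M' N') (\<lambda>x y. pure K M' N' (f x) (g y))"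
  using assms lin_closed[OF assms(3)] lin_closed[OF assms(4)]
  by (intro bilinear_onI linear_on_pure1 linear_on_pure2) (auto simp: lin_linear)

lemma tmap_lin:
  assumes "f \<in> lin K M M'" "g \<in> lin K N N'" "module K M" "module K N" "module K M'" "module K N'"
  shows "tmap K M N M' N' f g \<in> lin K (tensor K M N) (tensor K M' N')"
  unfolding tmap_def
  by (rule restrict_tsum_lin[OF assms(3,4) tensor_module[OF assms(5,6)]
        bilinear_on_pure_lin[OF assms(5,6,1,2)]])

lemma tmap_pure:
  assumes "f \<in> lin K M M'" "g \<in> lin K N N'" "module K M" "module K N" "module K M'" "module K N'"
    and "x \<in> carrier M" "y \<in> carrier N"
  shows "tmap K M N M' N' f g (pure K M N x y) = pure K M' N' (f x) (g y)"
  unfolding tmap_def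
  by (simp add: pure_closed assms(7,8) tsum_pure[OF assms(3,4) tensor_module[OF assms(5,6)]
        bilinear_on_pure_lin[OF assms(5,6,1,2)]])

lemma bilinear_on_assoc:
  assumes "module K X" "module K Y" "module K Z"
  shows "bilinear_on K (tensor K X Y) Z (tensor K X (tensor K Y Z))
    (\<lambda>s z. tsum (tensor K X (tensor K Y Z)) (\<lambda>x y. pure K X (tensor K Y Z) x (pure K Y Z y z)) s)"
  by (intro bilinear_on_tsum1 linear_on_pure1 linear_on_pure2 linear_on_id tensor_module
      pure_closed assms)

lemma bilinear_on_assoc_inv:
  assumes "module K X" "module K Y" "module K Z"
  shows "bilinear_on K X (tensor K Y Z) (tensor K (tensor K X Y) Z)
    (\<lambda>x s. tsum (tensor K (tensor K X Y) Z) (\<lambda>y z. pure K (tensor K X Y) Z (pure K X Y x y) z) s)"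
  by (intro bilinear_on_tsum2 linear_on_pure1 linear_on_pure2 linear_on_id tensor_module
      pure_closed assms)

lemma assoc_map_lin:
  assumes "module K X" "module K Y" "module K Z"
  shows "assoc_map K X Y Z \<in> lin K (tensor K (tensor K X Y) Z) (tensor K X (tensor K Y Z))"
  unfolding assoc_map_def Let_def
  by (intro restrict_tsum_lin bilinear_on_assoc tensor_module assms)

lemma assoc_inv_map_lin:
  assumes "module K X" "module K Y" "module K Z"
  shows "assoc_inv_map K X Y Z \<in> lin K (tensor K X (tensor K Y Z)) (tensor K (tensor K X Y) Z)"
  unfolding assoc_inv_map_def Let_def
  by (intro restrict_tsum_lin bilinear_on_assoc_inv tensor_module assms)

lemma assoc_map_pure:
  assumes "module K X" "module K Y" "module K Z" "s \<in> carrier (tensor K X Y)" "z \<in> carrier Z"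
  shows "assoc_map K X Y Z (pure K (tensor K X Y) Z s z) =
    tsum (tensor K X (tensor K Y Z)) (\<lambda>x y. pure K X (tensor K Y Z) x (pure K Y Z y z)) s"
  by (simp add: assoc_map_def pure_closed assms
      tsum_pure[OF _ _ _ bilinear_on_assoc[OF assms(1-3)]] tensor_module)

lemma assoc_map_pure_pure:
  assumes "module K X" "module K Y" "module K Z" "x \<in> carrier X" "y \<in> carrier Y" "z \<in> carrier Z"
  shows "assoc_map K X Y Z (pure K (tensor K X Y) Z (pure K X Y x y) z) =
    pure K X (tensor K Y Z) x (pure K Y Z y z)"
proof -
  have "bilinear_on K X Y (tensor K X (tensor K Y Z))
      (\<lambda>x y. pure K X (tensor K Y Z) x (pure K Y Z y z))"
    by (intro bilinear_onI linear_on_pure1 linear_on_pure2 linear_on_id tensor_module pure_closed assms)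
  from tsum_pure[OF assms(1,2) _ this assms(4,5)] show ?thesis
    by (simp add: assoc_map_pure pure_closed tensor_module assms)
qed

lemma assoc_inv_map_pure:
  assumes "module K X" "module K Y" "module K Z" "x \<in> carrier X" "s \<in> carrier (tensor K Y Z)"
  shows "assoc_inv_map K X Y Z (pure K X (tensor K Y Z) x s) =
    tsum (tensor K (tensor K X Y) Z) (\<lambda>y z. pure K (tensor K X Y) Z (pure K X Y x y) z) s"
  by (simp add: assoc_inv_map_def pure_closed assms
      tsum_pure[OF _ _ _ bilinear_on_assoc_inv[OF assms(1-3)]] tensor_module)

lemma assoc_inv_map_pure_pure:
  assumes "module K X" "module K Y" "module K Z" "x \<in> carrier X" "y \<in> carrier Y" "z \<in> carrier Z"
  shows "assoc_inv_map K X Y Z (pure K X (tensor K Y Z) x (pure K Y Z y z)) =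
    pure K (tensor K X Y) Z (pure K X Y x y) z"
proof -
  have "bilinear_on K Y Z (tensor K (tensor K X Y) Z)
      (\<lambda>y z. pure K (tensor K X Y) Z (pure K X Y x y) z)"
    by (intro bilinear_onI linear_on_pure1 linear_on_pure2 linear_on_id tensor_module pure_closed assms)
  from tsum_pure[OF assms(2,3) _ this assms(5,6)] show ?thesis
    by (simp add: assoc_inv_map_pure pure_closed tensor_module assms)
qed

lemma assoc_inv_assoc:
  assumes "module K X" "module K Y" "module K Z"
  shows "compose (carrier (tensor K (tensor K X Y) Z)) (assoc_inv_map K X Y Z) (assoc_map K X Y Z) =
    (\<lambda>t\<in>carrier (tensor K (tensor K X Y) Z). t)" (is "?l = ?r")
proof (rule lin_eq[OF lin_compose lin_id _ _
      spans_pures[OF _ _ spans_pures[OF _ _ spans_carrier spans_carrier] spans_carrier]])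
  fix t assume "t \<in> pures K (tensor K X Y) Z (pures K X Y (carrier X) (carrier Y)) (carrier Z)"
  then show "?l t = ?r t"
    by (auto simp: pures_def compose_eq pure_closed assoc_map_pure_pure assoc_inv_map_pure_pure assms)
qed (rule assoc_map_lin assoc_inv_map_lin tensor_module assms)+

lemma assoc_assoc_inv:
  assumes "module K X" "module K Y" "module K Z"
  shows "compose (carrier (tensor K X (tensor K Y Z))) (assoc_map K X Y Z) (assoc_inv_map K X Y Z) =
    (\<lambda>t\<in>carrier (tensor K X (tensor K Y Z)). t)" (is "?l = ?r")
proof (rule lin_eq[OF lin_compose lin_id _ _
      spans_pures[OF _ _ spans_carrier spans_pures[OF _ _ spans_carrier spans_carrier]]])
  fix t assume "t \<in> pures K X (tensor K Y Z) (carrier X) (pures K Y Z (carrier Y) (carrier Z))"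
  then show "?l t = ?r t"
    by (auto simp: pures_def compose_eq pure_closed assoc_map_pure_pure assoc_inv_map_pure_pure assms)
qed (rule assoc_map_lin assoc_inv_map_lin tensor_module assms)+

section \<open>Unit constraints and their inverses\<close>

lemma ground_module:
  assumes "cring K"
  shows "module K (ground K)"
proof -
  interpret cring K by fact
  have "abelian_group (ground K)"
  proof (rule abelian_groupI)
    fix x assume "x \<in> carrier (ground K)"
    then obtain c where "c \<in> carrier K" "x = Scalar c" by (auto simp: ground_def)
    then show "\<exists>y\<in>carrier (ground K). y \<oplus>\<^bsub>ground K\<^esub> x = \<zero>\<^bsub>ground K\<^esub>"
      by (intro bexI[of _ "Scalar (\<ominus>\<^bsub>K\<^esub> c)"]) (auto simp: ground_def l_neg)
  qed (auto simp: ground_def a_ac)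
  then show ?thesis
    by (rule moduleI[OF assms]) (auto simp: ground_def l_distr r_distr m_assoc)
qed

lemma ground_carrier: "c \<in> carrier (ground K) \<longleftrightarrow> (\<exists>a\<in>carrier K. c = Scalar a)"
  by (auto simp: ground_def)

definition lunit_inv_map ::
  "('k, 'r) ring_scheme \<Rightarrow> ('k, ('k, 'a) univ, 'm) module_scheme \<Rightarrow> ('k, 'a) univ \<Rightarrow> ('k, 'a) univ" where
  "lunit_inv_map K X = (\<lambda>x\<in>carrier X. pure K (ground K) X (Scalar \<one>\<^bsub>K\<^esub>) x)"

definition runit_inv_map ::
  "('k, 'r) ring_scheme \<Rightarrow> ('k, ('k, 'a) univ, 'm) module_scheme \<Rightarrow> ('k, 'a) univ \<Rightarrow> ('k, 'a) univ" where
  "runit_inv_map K X = (\<lambda>x\<in>carrier X. pure K X (ground K) x (Scalar \<one>\<^bsub>K\<^esub>))"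

lemma bilinear_on_lunit:
  assumes "module K X"
  shows "bilinear_on K (ground K) X X (\<lambda>c x. scalar c \<odot>\<^bsub>X\<^esub> x)"
proof -
  interpret module K X by fact
  show ?thesis
    by (intro bilinear_onI linear_onI)
      (auto simp: ground_def smult_l_distr smult_r_distr smult_assoc1[symmetric] m_comm)
qed

lemma bilinear_on_flip: "bilinear_on K M N B f \<Longrightarrow> bilinear_on K N M B (\<lambda>y x. f x y)"
  by (auto simp: bilinear_on_def)

lemma lunit_map_lin:
  assumes "module K X"
  shows "lunit_map K X \<in> lin K (tensor K (ground K) X) X"
  unfolding lunit_map_def using assms module.axioms(1)
  by (intro restrict_tsum_lin ground_module bilinear_on_lunit) 

lemma runit_map_lin:
  assumes "module K X"
  shows "runit_map K X \<in> lin K (tensor K X (ground K)) X"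
  unfolding runit_map_def using assms module.axioms(1)
  by (intro restrict_tsum_lin ground_module bilinear_on_flip[OF bilinear_on_lunit]) 

lemma lunit_map_pure:
  assumes "module K X" "c \<in> carrier (ground K)" "x \<in> carrier X"
  shows "lunit_map K X (pure K (ground K) X c x) = scalar c \<odot>\<^bsub>X\<^esub> x"
  using tsum_pure[OF ground_module assms(1) assms(1) bilinear_on_lunit[OF assms(1)] assms(2,3)]
    assms module.axioms(1)[OF assms(1)]
  by (simp add: lunit_map_def pure_closed)

lemma runit_map_pure:
  assumes "module K X" "c \<in> carrier (ground K)" "x \<in> carrier X"
  shows "runit_map K X (pure K X (ground K) x c) = scalar c \<odot>\<^bsub>X\<^esub> x"
  using tsum_pure[OF assms(1) ground_module assms(1) bilinear_on_flip[OF bilinear_on_lunit[OF assms(1)]] assms(3,2)]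
    assms module.axioms(1)[OF assms(1)]
  by (simp add: runit_map_def pure_closed)

lemma one_ground: "cring K \<Longrightarrow> Scalar \<one>\<^bsub>K\<^esub> \<in> carrier (ground K)"
  by (simp add: ground_def cring.cring_simprules)

lemma lunit_inv_map_lin:
  assumes "module K X"
  shows "lunit_inv_map K X \<in> lin K X (tensor K (ground K) X)"
  unfolding lunit_inv_map_def using module.axioms(1)[OF assms]
  by (simp add: lin_iff linear_on_restrict[OF assms] linear_on_pure2 ground_module assms
      linear_on_id one_ground)

lemma runit_inv_map_lin:
  assumes "module K X"
  shows "runit_inv_map K X \<in> lin K X (tensor K X (ground K))"
  unfolding runit_inv_map_def using module.axioms(1)[OF assms]
  by (simp add: lin_iff linear_on_restrict[OF assms] linear_on_pure1 ground_module assms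
      linear_on_id one_ground)

lemma pure_scalar:
  assumes "module K X" "module K Y" "a \<in> carrier K" "x \<in> carrier X" "y \<in> carrier Y"
  shows "pure K X Y (a \<odot>\<^bsub>X\<^esub> x) y = pure K X Y x (a \<odot>\<^bsub>Y\<^esub> y)"
    and "a \<odot>\<^bsub>tensor K X Y\<^esub> pure K X Y x y = pure K X Y (a \<odot>\<^bsub>X\<^esub> x) y"
proof -
  note D = bilinear_onD[OF bilinear_pure[OF assms(1,2)]]
  show 1: "a \<odot>\<^bsub>tensor K X Y\<^esub> pure K X Y x y = pure K X Y (a \<odot>\<^bsub>X\<^esub> x) y"
    using linear_onD(3)[OF D(1)[OF assms(5)] assms(3,4)] by simp
  then show "pure K X Y (a \<odot>\<^bsub>X\<^esub> x) y = pure K X Y x (a \<odot>\<^bsub>Y\<^esub> y)"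
    using linear_onD(3)[OF D(2)[OF assms(4)] assms(3,5)] by simp
qed

lemma lunit_inv_lunit:
  fixes X :: "('k, ('k, 'a) univ, 'm) module_scheme"
  assumes "module K X"
  shows "compose (carrier (tensor K (ground K) X)) (lunit_inv_map K X) (lunit_map K X) =
    (\<lambda>t\<in>carrier (tensor K (ground K) X). t)"
proof -
  interpret X: module K X by fact
  note G = ground_module[OF X.is_cring]
  show ?thesis
  proof (rule lin_eq[OF lin_compose lin_id _ _ spans_pures[OF _ _ spans_carrier spans_carrier]])
    fix t assume "t \<in> pures K (ground K) X (carrier (ground K)) (carrier X)"
    then obtain a x where t: "a \<in> carrier K" "x \<in> carrier X" "t = pure K (ground K) X (Scalar a) x"
      by (auto simp: pures_def ground_carrier)
    then have c: "(Scalar a :: ('k, 'a) univ) \<in> carrier (ground K)" by (simp add: ground_carrier)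
    \<comment> \<open>The scalar is written as a multiple of one, so that it can cross the tensor
      sign by \<open>pure_scalar\<close>.\<close>
    have "a \<odot>\<^bsub>ground K\<^esub> Scalar \<one>\<^bsub>K\<^esub> = (Scalar a :: ('k, 'a) univ)"
      using t(1) by (simp add: ground_def)
    then show "compose (carrier (tensor K (ground K) X)) (lunit_inv_map K X) (lunit_map K X) t =
        (\<lambda>t\<in>carrier (tensor K (ground K) X). t) t"
      using t c pure_scalar(1)[OF G assms t(1) one_ground[OF X.is_cring] t(2)]
      by (simp add: compose_def pure_closed lunit_map_pure[OF assms] lunit_inv_map_def one_ground[OF X.is_cring])
  qed (rule lunit_map_lin lunit_inv_map_lin tensor_module assms G)+
qed

lemma runit_inv_runit:
  fixes X :: "('k, ('k, 'a) univ, 'm) module_scheme"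
  assumes "module K X"
  shows "compose (carrier (tensor K X (ground K))) (runit_inv_map K X) (runit_map K X) =
    (\<lambda>t\<in>carrier (tensor K X (ground K)). t)"
proof -
  interpret X: module K X by fact
  note G = ground_module[OF X.is_cring]
  show ?thesis
  proof (rule lin_eq[OF lin_compose lin_id _ _ spans_pures[OF _ _ spans_carrier spans_carrier]])
    fix t assume "t \<in> pures K X (ground K) (carrier X) (carrier (ground K))"
    then obtain a x where t: "a \<in> carrier K" "x \<in> carrier X" "t = pure K X (ground K) x (Scalar a)"
      by (auto simp: pures_def ground_carrier)
    then have c: "(Scalar a :: ('k, 'a) univ) \<in> carrier (ground K)" by (simp add: ground_carrier)
    have "a \<odot>\<^bsub>ground K\<^esub> Scalar \<one>\<^bsub>K\<^esub> = (Scalar a :: ('k, 'a) univ)"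
      using t(1) by (simp add: ground_def)
    then show "compose (carrier (tensor K X (ground K))) (runit_inv_map K X) (runit_map K X) t =
        (\<lambda>t\<in>carrier (tensor K X (ground K)). t) t"
      using t c pure_scalar(1)[OF assms G t(1) t(2) one_ground[OF X.is_cring]]
      by (simp add: compose_def pure_closed runit_map_pure[OF assms] runit_inv_map_def one_ground[OF X.is_cring])
  qed (rule runit_map_lin runit_inv_map_lin tensor_module assms G)+
qed

lemma lunit_lunit_inv:
  assumes "module K X"
  shows "compose (carrier X) (lunit_map K X) (lunit_inv_map K X) = (\<lambda>x\<in>carrier X. x)"
proof -
  interpret X: module K X by fact
  show ?thesis
    by (auto simp: compose_def lunit_inv_map_def lunit_map_pure[OF assms] one_ground[OF X.is_cring] fun_eq_iff)
qed

lemma runit_runit_inv: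
  assumes "module K X"
  shows "compose (carrier X) (runit_map K X) (runit_inv_map K X) = (\<lambda>x\<in>carrier X. x)"
proof -
  interpret X: module K X by fact
  show ?thesis
    by (auto simp: compose_def runit_inv_map_def runit_map_pure[OF assms] one_ground[OF X.is_cring] fun_eq_iff)
qed

section \<open>Full subcategories\<close>

lemma inverse_arrows_sym: "inverse_arrows C f g \<Longrightarrow> inverse_arrows C g f"
  by (simp add: inverse_arrows_def)

lemma id_functor: "category C \<Longrightarrow> is_functor C C (\<lambda>X. X) (\<lambda>f. f)"
  by (auto simp: is_functor_def Hom_def)

text \<open>Domains, codomains, identities and composition agree as total functions, so equations
  between arrows carry over verbatim. The two record schemes may differ: a monoidal record can be a
  full subcategory of a plain one.\<close>

definition full_subcategory ::
  "('o, 'm, 'z) category_scheme \<Rightarrow> ('o, 'm, 'y) category_scheme \<Rightarrow> bool" where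
  "full_subcategory C D \<longleftrightarrow> Obj C \<subseteq> Obj D \<and>
     Arr C = {f \<in> Arr D. Dom D f \<in> Obj C \<and> Cod D f \<in> Obj C} \<and>
     Dom C = Dom D \<and> Cod C = Cod D \<and> Ident C = Ident D \<and> Comp C = Comp D"

lemma full_subcategory_Hom:
  assumes "full_subcategory C D"
  shows "f \<in> Hom C A B \<longleftrightarrow> f \<in> Hom D A B \<and> A \<in> Obj C \<and> B \<in> Obj C"
  using assms by (auto simp: full_subcategory_def Hom_def)

lemma full_subcategory_category:
  assumes "full_subcategory C D" "category D"
  shows "category C"
proof -
  interpret D: category D by fact
  note Hom = full_subcategory_Hom[OF assms(1)]
  have *: "Obj C \<subseteq> Obj D" "Ident C = Ident D" "Comp C = Comp D"
    "f \<in> Arr C \<Longrightarrow> Dom C f \<in> Obj C \<and> Cod C f \<in> Obj C" for f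
    using assms(1) by (auto simp: full_subcategory_def)
  show ?thesis
    by unfold_locales
      (use * D.ident D.comp D.comp_ident D.ident_comp D.comp_assoc in \<open>auto simp: Hom subset_iff\<close>)
qed

lemma full_subcategory_prod:
  assumes "full_subcategory C C'" "full_subcategory D D'"
  shows "full_subcategory (prod_cat C D) (prod_cat C' D')"
  using assms by (auto simp: full_subcategory_def prod_cat_def)

lemma full_subcategory_functor:
  assumes "is_functor C D FO FA" "full_subcategory C' C" "full_subcategory D' D"
    and "\<And>A. A \<in> Obj C' \<Longrightarrow> FO A \<in> Obj D'"
  shows "is_functor C' D' FO FA"
proof -
  note F = assms(1)[unfolded is_functor_def]
  have "category C'" "category D'"
    using F full_subcategory_category[OF assms(2)] full_subcategory_category[OF assms(3)] by auto
  then show ?thesis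
    using F assms(2-4) unfolding is_functor_def full_subcategory_Hom[OF assms(3)]
    by (auto simp: full_subcategory_def subset_iff)
qed

text \<open>Fullness also makes the inverse of each component an arrow of the subcategory, because
  both its ends lie there.\<close>

lemma full_subcategory_nat_iso:
  assumes "nat_iso C D FO FA GO GA \<tau>" "full_subcategory C' C" "full_subcategory D' D"
    and "\<And>A. A \<in> Obj C' \<Longrightarrow> FO A \<in> Obj D'" "\<And>A. A \<in> Obj C' \<Longrightarrow> GO A \<in> Obj D'"
  shows "nat_iso C' D' FO FA GO GA \<tau>"
proof -
  note N = assms(1)[unfolded nat_iso_def]
  have sub: "Obj C' \<subseteq> Obj C" "Arr C' \<subseteq> Arr C" "Dom C' = Dom C" "Cod C' = Cod C" "Comp D' = Comp D"
    using assms(2,3) by (auto simp: full_subcategory_def)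
  have "\<tau> A \<in> Hom D' (FO A) (GO A) \<and> iso_arrow D' (\<tau> A)" if A: "A \<in> Obj C'" for A
  proof -
    have \<tau>: "\<tau> A \<in> Hom D (FO A) (GO A)" "iso_arrow D (\<tau> A)" using N A sub(1) by auto
    then obtain g where "inverse_arrows D (\<tau> A) g" by (auto simp: iso_arrow_def)
    then have "inverse_arrows D' (\<tau> A) g"
      using \<tau>(1) assms(3) assms(4,5)[OF A] by (auto simp: inverse_arrows_def full_subcategory_def Hom_def)
    then show ?thesis
      using \<tau>(1) assms(4,5)[OF A] by (auto simp: full_subcategory_Hom[OF assms(3)] iso_arrow_def)
  qed
  then show ?thesis
    using N sub full_subcategory_functor[OF _ assms(2,3)] assms(4,5)
    unfolding nat_iso_def by (auto simp: subset_iff)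
qed

section \<open>Product categories\<close>

lemma prod_cat_simps [simp]:
  "Obj (prod_cat C D) = Obj C \<times> Obj D" "Arr (prod_cat C D) = Arr C \<times> Arr D"
  "Dom (prod_cat C D) (f, g) = (Dom C f, Dom D g)" "Cod (prod_cat C D) (f, g) = (Cod C f, Cod D g)"
  "Ident (prod_cat C D) (A, B) = (Ident C A, Ident D B)"
  "Comp (prod_cat C D) (f', g') (f, g) = (Comp C f' f, Comp D g' g)"
  by (simp_all add: prod_cat_def)

lemma Hom_prod_cat:
  "f \<in> Hom (prod_cat C D) A B \<longleftrightarrow> fst f \<in> Hom C (fst A) (fst B) \<and> snd f \<in> Hom D (snd A) (snd B)"
  by (cases f) (auto simp: Hom_def)

lemma category_prod:
  assumes "category C" "category D"
  shows "category (prod_cat C D)"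
proof -
  interpret C: category C by fact
  interpret D: category D by fact
  show ?thesis
  proof
    fix f assume "f \<in> Arr (prod_cat C D)"
    then show "Dom (prod_cat C D) f \<in> Obj (prod_cat C D) \<and> Cod (prod_cat C D) f \<in> Obj (prod_cat C D)"
      using C.dom_cod D.dom_cod by auto
  next
    fix A assume "A \<in> Obj (prod_cat C D)"
    then show "Ident (prod_cat C D) A \<in> Hom (prod_cat C D) A A"
      using C.ident D.ident by (auto simp: Hom_prod_cat)
  next
    fix f g A B E assume "f \<in> Hom (prod_cat C D) A B" "g \<in> Hom (prod_cat C D) B E"
    then show "g \<cdot>\<^bsub>prod_cat C D\<^esub> f \<in> Hom (prod_cat C D) A E"
      using C.comp D.comp by (cases f, cases g) (auto simp: Hom_prod_cat)
  next
    fix f A B assume "f \<in> Hom (prod_cat C D) A B"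
    then show "f \<cdot>\<^bsub>prod_cat C D\<^esub> Ident (prod_cat C D) A = f"
      using C.comp_ident D.comp_ident by (cases f, cases A) (auto simp: Hom_prod_cat)
  next
    fix f A B assume "f \<in> Hom (prod_cat C D) A B"
    then show "Ident (prod_cat C D) B \<cdot>\<^bsub>prod_cat C D\<^esub> f = f"
      using C.ident_comp D.ident_comp by (cases f, cases B) (auto simp: Hom_prod_cat)
  next
    fix f g h A B E F
    assume "f \<in> Hom (prod_cat C D) A B" "g \<in> Hom (prod_cat C D) B E" "h \<in> Hom (prod_cat C D) E F"
    then show "(h \<cdot>\<^bsub>prod_cat C D\<^esub> g) \<cdot>\<^bsub>prod_cat C D\<^esub> f = h \<cdot>\<^bsub>prod_cat C D\<^esub> g \<cdot>\<^bsub>prod_cat C D\<^esub> f"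
      using C.comp_assoc D.comp_assoc by (cases f, cases g, cases h) (auto simp: Hom_prod_cat)
  qed
qed


section \<open>Categories of vector spaces with structure\<close>

lemma tmap_id:
  assumes "module K M" "module K N"
  shows "tmap K M N M N (\<lambda>x\<in>carrier M. x) (\<lambda>x\<in>carrier N. x) = (\<lambda>t\<in>carrier (tensor K M N). t)"
proof (rule lin_eq[OF tmap_lin lin_id _ _ spans_pures[OF _ _ spans_carrier spans_carrier]])
  fix t assume "t \<in> pures K M N (carrier M) (carrier N)"
  then show "tmap K M N M N (\<lambda>x\<in>carrier M. x) (\<lambda>x\<in>carrier N. x) t = (\<lambda>t\<in>carrier (tensor K M N). t) t"
    by (auto simp: pures_def tmap_pure lin_id assms pure_closed)
qed (rule lin_id tensor_module assms)+

lemma tmap_compose: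
  assumes "module K M" "module K N" "module K M'" "module K N'" "module K M''" "module K N''"
    and "f \<in> lin K M M'" "g \<in> lin K N N'" "f' \<in> lin K M' M''" "g' \<in> lin K N' N''"
  shows "tmap K M N M'' N'' (compose (carrier M) f' f) (compose (carrier N) g' g) =
    compose (carrier (tensor K M N)) (tmap K M' N' M'' N'' f' g') (tmap K M N M' N' f g)"
proof (rule lin_eq[OF tmap_lin lin_compose _ _ spans_pures[OF _ _ spans_carrier spans_carrier]])
  fix t assume "t \<in> pures K M N (carrier M) (carrier N)"
  then show "tmap K M N M'' N'' (compose (carrier M) f' f) (compose (carrier N) g' g) t =
      compose (carrier (tensor K M N)) (tmap K M' N' M'' N'' f' g') (tmap K M N M' N' f g) t"
    using assms
    by (auto simp: pures_def tmap_pure lin_compose pure_closed compose_eq lin_closed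
        lin_compose[OF _ assms(7,9)] lin_compose[OF _ assms(8,10)])
qed (rule tmap_lin lin_compose tensor_module assms)+

text \<open>Isolates what the coherence arguments use: objects with underlying spaces, and homs that
  are linear and contain the structure maps. The inverse constraints are listed separately because
  \<open>hm\<close> is an arbitrary family of linear maps, in which an inverse need not lie. The
  instances are vector spaces and \<open>linear_reps\<close>.\<close>

locale tensor_category =
  fixes K :: "('k, 'r) ring_scheme" and G :: "'o set" and U :: "'o \<Rightarrow> ('k, 'a) vs"
    and hm :: "'o \<Rightarrow> 'o \<Rightarrow> (('k, 'a) univ \<Rightarrow> ('k, 'a) univ) set"
    and T :: "'o \<Rightarrow> 'o \<Rightarrow> 'o" and I :: 'o
  assumes cring: "cring K"
    and U_module: "A \<in> G \<Longrightarrow> module K (U A)"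
    and T_closed: "A \<in> G \<Longrightarrow> B \<in> G \<Longrightarrow> T A B \<in> G"
    and U_T: "U (T A B) = tensor K (U A) (U B)"
    and I_closed: "I \<in> G"
    and U_I: "U I = ground K"
    and hm_lin: "f \<in> hm A B \<Longrightarrow> f \<in> lin K (U A) (U B)"
    and hm_id: "A \<in> G \<Longrightarrow> (\<lambda>x\<in>carrier (U A). x) \<in> hm A A"
    and hm_compose: "A \<in> G \<Longrightarrow> B \<in> G \<Longrightarrow> D \<in> G \<Longrightarrow> f \<in> hm A B \<Longrightarrow> g \<in> hm B D \<Longrightarrow>
      compose (carrier (U A)) g f \<in> hm A D"
    and hm_tmap: "A \<in> G \<Longrightarrow> B \<in> G \<Longrightarrow> A' \<in> G \<Longrightarrow> B' \<in> G \<Longrightarrow> f \<in> hm A A' \<Longrightarrow> g \<in> hm B B' \<Longrightarrow>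
      tmap K (U A) (U B) (U A') (U B') f g \<in> hm (T A B) (T A' B')"
    and hm_assoc: "A \<in> G \<Longrightarrow> B \<in> G \<Longrightarrow> D \<in> G \<Longrightarrow>
      assoc_map K (U A) (U B) (U D) \<in> hm (T (T A B) D) (T A (T B D))"
    and hm_assoc_inv: "A \<in> G \<Longrightarrow> B \<in> G \<Longrightarrow> D \<in> G \<Longrightarrow>
      assoc_inv_map K (U A) (U B) (U D) \<in> hm (T A (T B D)) (T (T A B) D)"
    and hm_lunit: "A \<in> G \<Longrightarrow> lunit_map K (U A) \<in> hm (T I A) A"
    and hm_lunit_inv: "A \<in> G \<Longrightarrow> lunit_inv_map K (U A) \<in> hm A (T I A)"
    and hm_runit: "A \<in> G \<Longrightarrow> runit_map K (U A) \<in> hm (T A I) A"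
    and hm_runit_inv: "A \<in> G \<Longrightarrow> runit_inv_map K (U A) \<in> hm A (T A I)"
begin

definition "base = concrete_cat G (\<lambda>A. carrier (U A)) hm"

definition "tarr = (\<lambda>(A, f, A') (B, g, B'). (T A B, tmap K (U A) (U B) (U A') (U B') f g, T A' B'))"

definition "assoc A B D = (T (T A B) D, assoc_map K (U A) (U B) (U D), T A (T B D))"

definition "assoc_inv A B D = (T A (T B D), assoc_inv_map K (U A) (U B) (U D), T (T A B) D)"

definition "lunit A = (T I A, lunit_map K (U A), A)"

definition "runit A = (T A I, runit_map K (U A), A)"

lemma base_simps [simp]:
  "Obj base = G" "(A, f, B) \<in> Arr base \<longleftrightarrow> A \<in> G \<and> B \<in> G \<and> f \<in> hm A B"
  "Dom base (A, f, B) = A" "Cod base (A, f, B) = B" "Ident base A = (A, \<lambda>x\<in>carrier (U A). x, A)"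
  "Comp base (B', g, D) (A, f, B) = (A, compose (carrier (U A)) g f, D)"
  by (simp_all add: base_def concrete_cat_def)

lemma Hom_base: "p \<in> Hom base A B \<longleftrightarrow> (\<exists>f. p = (A, f, B) \<and> A \<in> G \<and> B \<in> G \<and> f \<in> hm A B)"
  by (cases p) (auto simp: Hom_def)

lemma tarr_simp [simp]:
  "tarr (A, f, A') (B, g, B') = (T A B, tmap K (U A) (U B) (U A') (U B') f g, T A' B')"
  by (simp add: tarr_def)

lemma hm_fun: "f \<in> hm A B \<Longrightarrow> f \<in> carrier (U A) \<rightarrow> carrier (U B)" "f \<in> hm A B \<Longrightarrow> f \<in> extensional (carrier (U A))"
  using hm_lin[of f A B] by (auto simp: lin_def PiE_def)

lemma base_category: "category base"
proof
  fix f assume "f \<in> Arr base"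
  then show "Dom base f \<in> Obj base \<and> Cod base f \<in> Obj base" by (cases f) simp
qed (auto simp: Hom_base hm_id hm_compose compose_Id[OF hm_fun] Id_compose[OF hm_fun]
    compose_assoc[OF hm_fun(1), symmetric])

lemma tensor_base_functor: "is_functor (prod_cat base base) base (\<lambda>(X, Y). T X Y) (\<lambda>(f, g). tarr f g)"
  unfolding is_functor_def
  by (auto simp: base_category category_prod T_closed Hom_base hm_tmap tmap_id U_module U_T
      tmap_compose hm_lin)

lemma assoc_inverse:
  assumes "A \<in> G" "B \<in> G" "D \<in> G"
  shows "inverse_arrows base (assoc A B D) (assoc_inv A B D)"
proof -
  note m = U_module[OF assms(1)] U_module[OF assms(2)] U_module[OF assms(3)]
  show ?thesis
    using assms assoc_inv_assoc[OF m] assoc_assoc_inv[OF m]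
    by (simp add: inverse_arrows_def assoc_def assoc_inv_def T_closed hm_assoc hm_assoc_inv U_T)
qed

text \<open>Both are bifunctoriality of \<open>tarr\<close> applied twice. The simp rules that
  unfold arrows into triples are switched off, so that arrows stay opaque and the functor laws
  match.\<close>

lemma triple_functors:
  "is_functor (prod_cat base (prod_cat base base)) base
    (\<lambda>(X, Y, Z). T (T X Y) Z) (\<lambda>(f, g, h). tarr (tarr f g) h)"
  "is_functor (prod_cat base (prod_cat base base)) base
    (\<lambda>(X, Y, Z). T X (T Y Z)) (\<lambda>(f, g, h). tarr f (tarr g h))"
proof -
  note F = tensor_base_functor[unfolded is_functor_def]
  have arr: "tarr f g \<in> Hom base (T (Dom base f) (Dom base g)) (T (Cod base f) (Cod base g))"
    if "f \<in> Arr base" "g \<in> Arr base" for f g using F that by fastforce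
  have dc: "tarr f g \<in> Arr base" "Dom base (tarr f g) = T (Dom base f) (Dom base g)"
    "Cod base (tarr f g) = T (Cod base f) (Cod base g)"
    if "f \<in> Arr base" "g \<in> Arr base" for f g using arr[OF that] by (auto simp: Hom_def)
  have id: "tarr (Ident base A) (Ident base B) = Ident base (T A B)" if "A \<in> G" "B \<in> G" for A B
    using F that by fastforce
  have comp: "tarr (f' \<cdot>\<^bsub>base\<^esub> f) (g' \<cdot>\<^bsub>base\<^esub> g) = tarr f' g' \<cdot>\<^bsub>base\<^esub> tarr f g"
    if "f \<in> Arr base" "g \<in> Arr base" "f' \<in> Arr base" "g' \<in> Arr base"
      "Dom base f' = Cod base f" "Dom base g' = Cod base g" for f g f' g'
    using F that by fastforce
  note cat = category_prod[OF base_category category_prod[OF base_category base_category]] base_category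
  show "is_functor (prod_cat base (prod_cat base base)) base
      (\<lambda>(X, Y, Z). T (T X Y) Z) (\<lambda>(f, g, h). tarr (tarr f g) h)"
    unfolding is_functor_def using cat
    by (auto simp del: base_simps(2-) tarr_simp simp: T_closed id comp dc Hom_def)
  show "is_functor (prod_cat base (prod_cat base base)) base
      (\<lambda>(X, Y, Z). T X (T Y Z)) (\<lambda>(f, g, h). tarr f (tarr g h))"
    unfolding is_functor_def using cat
    by (auto simp del: base_simps(2-) tarr_simp simp: T_closed id comp dc Hom_def)
qed

lemma assoc_naturality:
  assumes "A \<in> G" "A' \<in> G" "B \<in> G" "B' \<in> G" "D \<in> G" "D' \<in> G"
    and "f \<in> hm A A'" "g \<in> hm B B'" "h \<in> hm D D'"
  shows "tarr (A, f, A') (tarr (B, g, B') (D, h, D')) \<cdot>\<^bsub>base\<^esub> assoc A B D =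
    assoc A' B' D' \<cdot>\<^bsub>base\<^esub> tarr (tarr (A, f, A') (B, g, B')) (D, h, D')"
proof -
  note m = assms(1-6)[THEN U_module] and l = assms(7-9)[THEN hm_lin]
  let ?X = "U A" and ?Y = "U B" and ?Z = "U D"
  let ?X' = "U A'" and ?Y' = "U B'" and ?Z' = "U D'"
  let ?L = "tensor K (tensor K ?X ?Y) ?Z" and ?YZ = "tensor K ?Y ?Z" and ?YZ' = "tensor K ?Y' ?Z'"
  let ?XY = "tensor K ?X ?Y" and ?XY' = "tensor K ?X' ?Y'"
  have "compose (carrier ?L) (tmap K ?X ?YZ ?X' ?YZ' f (tmap K ?Y ?Z ?Y' ?Z' g h)) (assoc_map K ?X ?Y ?Z) =
    compose (carrier ?L) (assoc_map K ?X' ?Y' ?Z') (tmap K ?XY ?Z ?XY' ?Z' (tmap K ?X ?Y ?X' ?Y' f g) h)"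
    (is "?l = ?r")
  proof (rule lin_eq[OF lin_compose lin_compose _ _
        spans_pures[OF _ _ spans_pures[OF _ _ spans_carrier spans_carrier] spans_carrier]])
    fix t assume "t \<in> pures K ?XY ?Z (pures K ?X ?Y (carrier ?X) (carrier ?Y)) (carrier ?Z)"
    then show "?l t = ?r t"
      by (auto simp: pures_def compose_eq pure_closed assoc_map_pure_pure tmap_pure l m tensor_module
          tmap_lin[OF l(1,2)] tmap_lin[OF l(2,3)] lin_closed[OF l(1)] lin_closed[OF l(2)] lin_closed[OF l(3)])
  qed (rule assoc_map_lin tmap_lin tensor_module m l)+
  then show ?thesis by (simp add: assoc_def U_T)
qed

lemma assoc_inv_naturality:
  assumes "A \<in> G" "A' \<in> G" "B \<in> G" "B' \<in> G" "D \<in> G" "D' \<in> G"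
    and "f \<in> hm A A'" "g \<in> hm B B'" "h \<in> hm D D'"
  shows "tarr (tarr (A, f, A') (B, g, B')) (D, h, D') \<cdot>\<^bsub>base\<^esub> assoc_inv A B D =
    assoc_inv A' B' D' \<cdot>\<^bsub>base\<^esub> tarr (A, f, A') (tarr (B, g, B') (D, h, D'))"
proof -
  note m = assms(1-6)[THEN U_module] and l = assms(7-9)[THEN hm_lin]
  let ?X = "U A" and ?Y = "U B" and ?Z = "U D"
  let ?X' = "U A'" and ?Y' = "U B'" and ?Z' = "U D'"
  let ?R = "tensor K ?X (tensor K ?Y ?Z)" and ?YZ = "tensor K ?Y ?Z" and ?YZ' = "tensor K ?Y' ?Z'"
  let ?XY = "tensor K ?X ?Y" and ?XY' = "tensor K ?X' ?Y'"
  have "compose (carrier ?R) (tmap K ?XY ?Z ?XY' ?Z' (tmap K ?X ?Y ?X' ?Y' f g) h) (assoc_inv_map K ?X ?Y ?Z) =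
    compose (carrier ?R) (assoc_inv_map K ?X' ?Y' ?Z') (tmap K ?X ?YZ ?X' ?YZ' f (tmap K ?Y ?Z ?Y' ?Z' g h))"
    (is "?l = ?r")
  proof (rule lin_eq[OF lin_compose lin_compose _ _
        spans_pures[OF _ _ spans_carrier spans_pures[OF _ _ spans_carrier spans_carrier]]])
    fix t assume "t \<in> pures K ?X ?YZ (carrier ?X) (pures K ?Y ?Z (carrier ?Y) (carrier ?Z))"
    then show "?l t = ?r t"
      by (auto simp: pures_def compose_eq pure_closed assoc_inv_map_pure_pure tmap_pure l m tensor_module
          tmap_lin[OF l(1,2)] tmap_lin[OF l(2,3)] lin_closed[OF l(1)] lin_closed[OF l(2)] lin_closed[OF l(3)])
  qed (rule assoc_inv_map_lin tmap_lin tensor_module m l)+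
  then show ?thesis by (simp add: assoc_inv_def U_T)
qed

lemma assoc_iso:
  assumes "A \<in> G" "B \<in> G" "D \<in> G"
  shows "iso_arrow base (assoc A B D)" "iso_arrow base (assoc_inv A B D)"
  unfolding iso_arrow_def
  by (rule exI, rule assoc_inverse[OF assms]) (rule exI, rule inverse_arrows_sym[OF assoc_inverse[OF assms]])

lemma assoc_Hom:
  assumes "A \<in> G" "B \<in> G" "D \<in> G"
  shows "assoc A B D \<in> Hom base (T (T A B) D) (T A (T B D))"
    "assoc_inv A B D \<in> Hom base (T A (T B D)) (T (T A B) D)"
  using assms by (auto simp: assoc_def assoc_inv_def Hom_base T_closed hm_assoc hm_assoc_inv)

lemma assoc_nat_iso:
  "nat_iso (prod_cat base (prod_cat base base)) base
    (\<lambda>(X, Y, Z). T (T X Y) Z) (\<lambda>(f, g, h). tarr (tarr f g) h)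
    (\<lambda>(X, Y, Z). T X (T Y Z)) (\<lambda>(f, g, h). tarr f (tarr g h)) (\<lambda>(X, Y, Z). assoc X Y Z)"
  "nat_iso (prod_cat base (prod_cat base base)) base
    (\<lambda>(X, Y, Z). T X (T Y Z)) (\<lambda>(f, g, h). tarr f (tarr g h))
    (\<lambda>(X, Y, Z). T (T X Y) Z) (\<lambda>(f, g, h). tarr (tarr f g) h) (\<lambda>(X, Y, Z). assoc_inv X Y Z)"
  unfolding nat_iso_def
  by (simp_all add: triple_functors assoc_iso assoc_Hom split_paired_all assoc_naturality
      assoc_inv_naturality del: tarr_simp base_simps(6))

end

lemma scalar_closed: "c \<in> carrier (ground K) \<Longrightarrow> scalar c \<in> carrier K"
  by (auto simp: ground_def)

section \<open>Coherence identities\<close>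

context tensor_category
begin

text \<open>These rules also build the spanning set left open by \<open>lin_eq\<close>:
  \<open>spans_pures\<close> is tried before \<open>spans_carrier\<close>, so the set follows the
  bracketing of the domain down to its factors.\<close>

lemmas lin_rules = lin_compose tmap_lin assoc_map_lin assoc_inv_map_lin lunit_map_lin runit_map_lin
  lin_id tensor_module spans_pures spans_carrier

text \<open>Scalars are moved into the left entry of a pure tensor, which gives both sides of each
  unit law the same normal form.\<close>

lemmas pure_simps = pures_def compose_eq pure_closed assoc_map_pure_pure assoc_inv_map_pure_pure
  tmap_pure lunit_map_pure runit_map_pure lin_id tensor_module assoc_map_lin assoc_inv_map_lin
  lunit_map_lin runit_map_lin scalar_closed module.smult_closed
  pure_scalar(2) pure_scalar(1)[symmetric] lin_closed

lemmas arrow_simps = assoc_def assoc_inv_def lunit_def runit_def U_T U_I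

lemmas ground_module' = ground_module[OF cring]

lemma pentagon_identity:
  assumes "W \<in> G" "X \<in> G" "Y \<in> G" "Z \<in> G"
  shows "assoc W X (T Y Z) \<cdot>\<^bsub>base\<^esub> assoc (T W X) Y Z =
    tarr (Ident base W) (assoc X Y Z) \<cdot>\<^bsub>base\<^esub> (assoc W (T X Y) Z \<cdot>\<^bsub>base\<^esub>
      tarr (assoc W X Y) (Ident base Z))"
  unfolding arrow_simps base_simps tarr_simp prod.inject
  by (intro conjI HOL.refl, rule lin_eq, (rule lin_rules assms[THEN U_module])+,
      auto simp: pure_simps assms[THEN U_module])

lemma triangle_identity:
  assumes "X \<in> G" "Y \<in> G"
  shows "tarr (Ident base X) (lunit Y) \<cdot>\<^bsub>base\<^esub> assoc X I Y = tarr (runit X) (Ident base Y)"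
  unfolding arrow_simps base_simps tarr_simp prod.inject
  by (intro conjI HOL.refl, rule lin_eq, (rule lin_rules assms[THEN U_module] ground_module')+,
      auto simp: pure_simps assms[THEN U_module] ground_module')

lemma lunit_tensor:
  assumes "X \<in> G" "A \<in> G"
  shows "lunit (T X A) \<cdot>\<^bsub>base\<^esub> assoc I X A = tarr (lunit X) (Ident base A)"
  unfolding arrow_simps base_simps tarr_simp prod.inject
  by (intro conjI HOL.refl, rule lin_eq, (rule lin_rules assms[THEN U_module] ground_module')+,
      auto simp: pure_simps assms[THEN U_module] ground_module')

lemma runit_tensor:
  assumes "A \<in> G" "X \<in> G"
  shows "runit (T A X) \<cdot>\<^bsub>base\<^esub> assoc_inv A X I = tarr (Ident base A) (runit X)"
  unfolding arrow_simps base_simps tarr_simp prod.inject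
  by (intro conjI HOL.refl, rule lin_eq, (rule lin_rules assms[THEN U_module] ground_module')+,
      auto simp: pure_simps assms[THEN U_module] ground_module')

lemma triangle_inv:
  assumes "A \<in> G" "X \<in> G"
  shows "tarr (runit A) (Ident base X) \<cdot>\<^bsub>base\<^esub> assoc_inv A I X = tarr (Ident base A) (lunit X)"
  unfolding arrow_simps base_simps tarr_simp prod.inject
  by (intro conjI HOL.refl, rule lin_eq, (rule lin_rules assms[THEN U_module] ground_module')+,
      auto simp: pure_simps assms[THEN U_module] ground_module')

lemma pentagon_left:
  assumes "X \<in> G" "Y \<in> G" "Z \<in> G" "A \<in> G"
  shows "tarr (Ident base X) (assoc Y Z A) \<cdot>\<^bsub>base\<^esub> assoc X (T Y Z) A
      \<cdot>\<^bsub>base\<^esub> tarr (assoc X Y Z) (Ident base A) =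
    assoc X Y (T Z A) \<cdot>\<^bsub>base\<^esub> assoc (T X Y) Z A"
  using pentagon_identity[OF assms] by simp

lemma pentagon_right:
  assumes "A \<in> G" "X \<in> G" "Y \<in> G" "Z \<in> G"
  shows "tarr (assoc_inv A X Y) (Ident base Z) \<cdot>\<^bsub>base\<^esub> assoc_inv A (T X Y) Z =
    assoc_inv (T A X) Y Z \<cdot>\<^bsub>base\<^esub> assoc_inv A X (T Y Z)
      \<cdot>\<^bsub>base\<^esub> tarr (Ident base A) (assoc X Y Z)"
  unfolding arrow_simps base_simps tarr_simp prod.inject
  by (intro conjI HOL.refl, rule lin_eq, (rule lin_rules assms[THEN U_module])+,
      auto simp: pure_simps assms[THEN U_module])

lemma bimodulator_left:
  assumes "X \<in> G" "Y \<in> G" "Z \<in> G" "A \<in> G"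
  shows "tarr (assoc X Y A) (Ident base Z) \<cdot>\<^bsub>base\<^esub> assoc_inv (T X Y) A Z =
    assoc_inv X (T Y A) Z \<cdot>\<^bsub>base\<^esub> tarr (Ident base X) (assoc_inv Y A Z)
      \<cdot>\<^bsub>base\<^esub> assoc X Y (T A Z)"
  unfolding arrow_simps base_simps tarr_simp prod.inject
  by (intro conjI HOL.refl, rule lin_eq, (rule lin_rules assms[THEN U_module])+,
      auto simp: pure_simps assms[THEN U_module])

lemma bimodulator_right:
  assumes "X \<in> G" "Y \<in> G" "Z \<in> G" "A \<in> G"
  shows "assoc_inv (T X A) Y Z \<cdot>\<^bsub>base\<^esub> assoc_inv X A (T Y Z) =
    tarr (assoc_inv X A Y) (Ident base Z) \<cdot>\<^bsub>base\<^esub> assoc_inv X (T A Y) Z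
      \<cdot>\<^bsub>base\<^esub> tarr (Ident base X) (assoc_inv A Y Z)"
  unfolding arrow_simps base_simps tarr_simp prod.inject
  by (intro conjI HOL.refl, rule lin_eq, (rule lin_rules assms[THEN U_module])+,
      auto simp: pure_simps assms[THEN U_module])

lemma bimodulator_lunit:
  assumes "Y \<in> G" "A \<in> G"
  shows "tarr (lunit A) (Ident base Y) \<cdot>\<^bsub>base\<^esub> assoc_inv I A Y = lunit (T A Y)"
  unfolding arrow_simps base_simps tarr_simp prod.inject
  by (intro conjI HOL.refl, rule lin_eq, (rule lin_rules assms[THEN U_module] ground_module')+,
      auto simp: pure_simps assms[THEN U_module] ground_module')

lemma unit_functors:
  "is_functor base base (T I) (tarr (Ident base I))"
  "is_functor base base (\<lambda>X. T X I) (\<lambda>f. tarr f (Ident base I))"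
proof -
  note F = tensor_base_functor[unfolded is_functor_def]
  \<comment> \<open>The last equation writes the identity as its own square, which turns
    functoriality in one argument into an instance of bifunctoriality.\<close>
  have I: "Ident base I \<in> Arr base" "Dom base (Ident base I) = I" "Cod base (Ident base I) = I"
    "Ident base I \<cdot>\<^bsub>base\<^esub> Ident base I = Ident base I"
    using category.ident[OF base_category, of I] category.comp_ident[OF base_category, of "Ident base I" I I]
      I_closed by (auto simp: Hom_def simp del: base_simps(2-))
  show "is_functor base base (T I) (tarr (Ident base I))"
    unfolding is_functor_def
  proof (intro conjI ballI impI base_category)
    fix f g assume fg: "f \<in> Arr base" "g \<in> Arr base" "Dom base g = Cod base f"
    show "tarr (Ident base I) (g \<cdot>\<^bsub>base\<^esub> f) = tarr (Ident base I) g \<cdot>\<^bsub>base\<^esub> tarr (Ident base I) f"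
      using F[THEN conjunct2, THEN conjunct2, THEN conjunct2, THEN conjunct2, THEN conjunct2,
          THEN bspec, THEN bspec, of "(Ident base I, f)" "(Ident base I, g)"] I fg
      by (simp del: base_simps(2-) tarr_simp)
  qed (use F I I_closed in \<open>force simp del: base_simps(2-) tarr_simp\<close>)+
  show "is_functor base base (\<lambda>X. T X I) (\<lambda>f. tarr f (Ident base I))"
    unfolding is_functor_def
  proof (intro conjI ballI impI base_category)
    fix f g assume fg: "f \<in> Arr base" "g \<in> Arr base" "Dom base g = Cod base f"
    show "tarr (g \<cdot>\<^bsub>base\<^esub> f) (Ident base I) = tarr g (Ident base I) \<cdot>\<^bsub>base\<^esub> tarr f (Ident base I)"
      using F[THEN conjunct2, THEN conjunct2, THEN conjunct2, THEN conjunct2, THEN conjunct2,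
          THEN bspec, THEN bspec, of "(f, Ident base I)" "(g, Ident base I)"] I fg
      by (simp del: base_simps(2-) tarr_simp)
  qed (use F I I_closed in \<open>force simp del: base_simps(2-) tarr_simp\<close>)+
qed

lemma lunit_nat_iso: "nat_iso base base (T I) (tarr (Ident base I)) (\<lambda>X. X) (\<lambda>f. f) lunit"
proof -
  have "lunit A \<in> Hom base (T I A) A \<and> iso_arrow base (lunit A)" if A: "A \<in> G" for A
  proof -
    have "inverse_arrows base (lunit A) (A, lunit_inv_map K (U A), T I A)"
      using lunit_inv_lunit[OF U_module[OF A]] lunit_lunit_inv[OF U_module[OF A]] A
      by (simp add: inverse_arrows_def lunit_def T_closed I_closed hm_lunit hm_lunit_inv U_T U_I)
    then show ?thesis
      using A by (auto simp: iso_arrow_def lunit_def Hom_base T_closed I_closed hm_lunit)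
  qed
  moreover have "f \<cdot>\<^bsub>base\<^esub> lunit (Dom base f) = lunit (Cod base f) \<cdot>\<^bsub>base\<^esub> tarr (Ident base I) f"
    if fa: "f \<in> Arr base" for f
  proof -
    obtain A B g where f: "f = (A, g, B)" "A \<in> G" "B \<in> G" "g \<in> hm A B" using fa by (cases f) auto
    note m = U_module[OF f(2)] U_module[OF f(3)] ground_module' hm_lin[OF f(4)]
    show ?thesis
      unfolding f(1) arrow_simps base_simps tarr_simp prod.inject
      by (intro conjI HOL.refl, rule lin_eq, (rule lin_rules m)+)
        (auto simp: pure_simps m linear_onD[OF lin_linear[OF m(4)]])
  qed
  ultimately show ?thesis
    using unit_functors(1) id_functor[OF base_category] unfolding nat_iso_def base_simps(1) by blast
qed

lemma runit_nat_iso: "nat_iso base base (\<lambda>X. T X I) (\<lambda>f. tarr f (Ident base I)) (\<lambda>X. X) (\<lambda>f. f) runit"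
proof -
  have "runit A \<in> Hom base (T A I) A \<and> iso_arrow base (runit A)" if A: "A \<in> G" for A
  proof -
    have "inverse_arrows base (runit A) (A, runit_inv_map K (U A), T A I)"
      using runit_inv_runit[OF U_module[OF A]] runit_runit_inv[OF U_module[OF A]] A
      by (simp add: inverse_arrows_def runit_def T_closed I_closed hm_runit hm_runit_inv U_T U_I)
    then show ?thesis
      using A by (auto simp: iso_arrow_def runit_def Hom_base T_closed I_closed hm_runit)
  qed
  moreover have "f \<cdot>\<^bsub>base\<^esub> runit (Dom base f) = runit (Cod base f) \<cdot>\<^bsub>base\<^esub> tarr f (Ident base I)"
    if fa: "f \<in> Arr base" for f
  proof -
    obtain A B g where f: "f = (A, g, B)" "A \<in> G" "B \<in> G" "g \<in> hm A B" using fa by (cases f) auto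
    note m = U_module[OF f(2)] U_module[OF f(3)] ground_module' hm_lin[OF f(4)]
    show ?thesis
      unfolding f(1) arrow_simps base_simps tarr_simp prod.inject
      by (intro conjI HOL.refl, rule lin_eq, (rule lin_rules m)+)
        (auto simp: pure_simps m linear_onD[OF lin_linear[OF m(4)]])
  qed
  ultimately show ?thesis
    using unit_functors(2) id_functor[OF base_category] unfolding nat_iso_def base_simps(1) by blast
qed

definition "subcat S = concrete_cat S (\<lambda>A. carrier (U A)) hm"

definition "moncat S = category.extend (subcat S) (monoidal.fields T tarr I assoc lunit runit)"

lemma moncat_simps [simp]:
  "Tob (moncat S) = T" "Tarr (moncat S) = tarr" "Unit (moncat S) = I" "Assoc (moncat S) = assoc"
  "Lunit (moncat S) = lunit" "Runit (moncat S) = runit"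
  "Obj (moncat S) = S" "Comp (moncat S) = Comp base" "Ident (moncat S) = Ident base"
  "Obj (subcat S) = S" "Comp (subcat S) = Comp base" "Ident (subcat S) = Ident base"
  by (simp_all add: moncat_def subcat_def base_def category.extend_def monoidal.fields_def concrete_cat_def)

lemma full_subcategories:
  assumes "S \<subseteq> G"
  shows "full_subcategory (moncat S) base" "full_subcategory (subcat S) base"
  using assms by (auto simp: full_subcategory_def moncat_def subcat_def base_def category.extend_def
      monoidal.fields_def concrete_cat_def)

text \<open>Fullness supplies arrows, inverses and naturality; what has to be assumed is closure of
  the objects under \<open>T\<close> and \<open>I\<close>.\<close>

lemma moncat_monoidal:
  assumes "S \<subseteq> G" "\<And>X Y. X \<in> S \<Longrightarrow> Y \<in> S \<Longrightarrow> T X Y \<in> S" "I \<in> S"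
  shows "monoidal_category (moncat S)"
proof -
  note s = full_subcategories(1)[OF assms(1)]
  note F = full_subcategory_functor[OF _ _ s] and N = full_subcategory_nat_iso[OF _ _ s]
  interpret category "moncat S" using full_subcategory_category[OF s base_category] .
  show ?thesis
  proof
    show "is_functor (prod_cat (moncat S) (moncat S)) (moncat S)
        (\<lambda>(X, Y). Tob (moncat S) X Y) (\<lambda>(f, g). Tarr (moncat S) f g)"
      using F[OF tensor_base_functor full_subcategory_prod[OF s s]] assms(2) by auto
    show "Unit (moncat S) \<in> Obj (moncat S)" using assms(3) by simp
    show "nat_iso (prod_cat (moncat S) (prod_cat (moncat S) (moncat S))) (moncat S)
      (\<lambda>(X, Y, Z). Tob (moncat S) (Tob (moncat S) X Y) Z)
      (\<lambda>(f, g, h). Tarr (moncat S) (Tarr (moncat S) f g) h)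
      (\<lambda>(X, Y, Z). Tob (moncat S) X (Tob (moncat S) Y Z))
      (\<lambda>(f, g, h). Tarr (moncat S) f (Tarr (moncat S) g h)) (\<lambda>(X, Y, Z). Assoc (moncat S) X Y Z)"
      using N[OF assoc_nat_iso(1) full_subcategory_prod[OF s full_subcategory_prod[OF s s]]] assms(2)
      by auto
    show "nat_iso (moncat S) (moncat S) (Tob (moncat S) (Unit (moncat S)))
      (Tarr (moncat S) (Ident (moncat S) (Unit (moncat S)))) (\<lambda>X. X) (\<lambda>f. f) (Lunit (moncat S))"
      using N[OF lunit_nat_iso s] assms(2,3) by simp
    show "nat_iso (moncat S) (moncat S) (\<lambda>X. Tob (moncat S) X (Unit (moncat S)))
      (\<lambda>f. Tarr (moncat S) f (Ident (moncat S) (Unit (moncat S)))) (\<lambda>X. X) (\<lambda>f. f) (Runit (moncat S))"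
      using N[OF runit_nat_iso s] assms(2,3) by simp
  qed (use assms(1) pentagon_identity triangle_identity in \<open>simp_all add: subset_iff del: base_simps(2-) tarr_simp\<close>)
qed

definition "left_act = \<lparr>Lob = T, Larr = tarr, Luni = lunit, Lmul = assoc\<rparr>"

definition "right_act = \<lparr>Rob = T, Rarr = tarr, Runi = runit, Rmul = assoc_inv\<rparr>"

lemma act_simps [simp]:
  "Lob left_act = T" "Larr left_act = tarr" "Luni left_act = lunit" "Lmul left_act = assoc"
  "Rob right_act = T" "Rarr right_act = tarr" "Runi right_act = runit" "Rmul right_act = assoc_inv"
  by (simp_all add: left_act_def right_act_def)

text \<open>The class \<open>P\<close> absorbs \<open>S\<close> on both sides, like an ideal. The
  left multiplicator restricts \<open>assoc\<close>, while the right multiplicator and the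
  bimodulator both restrict \<open>assoc_inv\<close>; they differ only in which argument is taken
  from \<open>P\<close>.\<close>

lemma biactegory_subcat:
  assumes "S \<subseteq> G" "\<And>X Y. X \<in> S \<Longrightarrow> Y \<in> S \<Longrightarrow> T X Y \<in> S" "I \<in> S"
    and "P \<subseteq> G" "\<And>X M. X \<in> S \<Longrightarrow> M \<in> P \<Longrightarrow> T X M \<in> P" "\<And>M X. M \<in> P \<Longrightarrow> X \<in> S \<Longrightarrow> T M X \<in> P"
  shows "biactegory (moncat S) (subcat P) left_act right_act assoc_inv"
proof -
  note s = full_subcategories(1)[OF assms(1)] and p = full_subcategories(2)[OF assms(4)]
  note F = full_subcategory_functor[OF _ _ p] and N = full_subcategory_nat_iso[OF _ _ p]
  note prod = full_subcategory_prod
  interpret monoidal_category "moncat S" using moncat_monoidal[OF assms(1-3)] .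
  interpret M: category "subcat P" using full_subcategory_category[OF p base_category] .
  show ?thesis
  proof
    show "is_functor (prod_cat (moncat S) (subcat P)) (subcat P)
        (\<lambda>(X, A). Lob left_act X A) (\<lambda>(f, g). Larr left_act f g)"
      using F[OF tensor_base_functor prod[OF s p]] assms(5) by auto
    show "nat_iso (subcat P) (subcat P) (Lob left_act (Unit (moncat S)))
        (Larr left_act (Ident (moncat S) (Unit (moncat S)))) (\<lambda>A. A) (\<lambda>f. f) (Luni left_act)"
      using N[OF lunit_nat_iso p] assms(3,5) by simp
    show "nat_iso (prod_cat (moncat S) (prod_cat (moncat S) (subcat P))) (subcat P)
        (\<lambda>(X, Y, A). Lob left_act (Tob (moncat S) X Y) A)
        (\<lambda>(f, g, t). Larr left_act (Tarr (moncat S) f g) t)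
        (\<lambda>(X, Y, A). Lob left_act X (Lob left_act Y A))
        (\<lambda>(f, g, t). Larr left_act f (Larr left_act g t)) (\<lambda>(X, Y, A). Lmul left_act X Y A)"
      using N[OF assoc_nat_iso(1) prod[OF s prod[OF s p]]] assms(2,5) by auto
    show "is_functor (prod_cat (subcat P) (moncat S)) (subcat P)
        (\<lambda>(A, X). Rob right_act A X) (\<lambda>(g, f). Rarr right_act g f)"
      using F[OF tensor_base_functor prod[OF p s]] assms(6) by auto
    show "nat_iso (subcat P) (subcat P) (\<lambda>A. Rob right_act A (Unit (moncat S)))
        (\<lambda>f. Rarr right_act f (Ident (moncat S) (Unit (moncat S)))) (\<lambda>A. A) (\<lambda>f. f) (Runi right_act)"
      using N[OF runit_nat_iso p] assms(3,6) by simp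
    show "nat_iso (prod_cat (subcat P) (prod_cat (moncat S) (moncat S))) (subcat P)
        (\<lambda>(A, X, Y). Rob right_act A (Tob (moncat S) X Y))
        (\<lambda>(t, f, g). Rarr right_act t (Tarr (moncat S) f g))
        (\<lambda>(A, X, Y). Rob right_act (Rob right_act A X) Y)
        (\<lambda>(t, f, g). Rarr right_act (Rarr right_act t f) g) (\<lambda>(A, X, Y). Rmul right_act A X Y)"
      using N[OF assoc_nat_iso(2) prod[OF p prod[OF s s]]] assms(2,6) by auto
    show "nat_iso (prod_cat (moncat S) (prod_cat (subcat P) (moncat S))) (subcat P)
        (\<lambda>(X, A, Y). Lob left_act X (Rob right_act A Y))
        (\<lambda>(f, t, g). Larr left_act f (Rarr right_act t g))
        (\<lambda>(X, A, Y). Rob right_act (Lob left_act X A) Y)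
        (\<lambda>(f, t, g). Rarr right_act (Larr left_act f t) g) (\<lambda>(X, A, Y). assoc_inv X A Y)"
      using N[OF assoc_nat_iso(2) prod[OF s prod[OF p s]]] assms(5,6) by auto
  qed (use assms(1,4) in \<open>simp_all add: subset_iff lunit_tensor triangle_identity pentagon_left runit_tensor
      triangle_inv pentagon_right bimodulator_left bimodulator_right bimodulator_lunit
      del: base_simps(2-) tarr_simp\<close>)
qed

end

section \<open>Sweedler calculus\<close>

context hopf_algebra
begin

abbreviation sw :: "('b, 'm) ring_scheme \<Rightarrow> (('k, 'h) univ \<Rightarrow> ('k, 'h) univ \<Rightarrow> 'b) \<Rightarrow> ('k, 'h) univ \<Rightarrow> 'b" where
  "sw B f h \<equiv> tsum B f (comul H h)"

lemma comul_closed: "h \<in> carrier H \<Longrightarrow> comul H h \<in> carrier (tensor K H H)"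
  using lin_closed[OF comul_lin] .

lemma antipode_closed: "h \<in> carrier H \<Longrightarrow> antipode H h \<in> carrier H"
  using lin_closed[OF antipode_lin] .

lemma mult_closed: "h \<in> carrier H \<Longrightarrow> l \<in> carrier H \<Longrightarrow> h \<otimes>\<^bsub>H\<^esub> l \<in> carrier H"
  using ring by (simp add: ring.ring_simprules)

lemma one_closed: "\<one>\<^bsub>H\<^esub> \<in> carrier H"
  using ring by (simp add: ring.ring_simprules)

lemma cring_K: "cring K"
  using module module.axioms(1) by blast

lemma sw_closed:
  assumes "module K B" "h \<in> carrier H"
    and "\<And>a b. a \<in> carrier H \<Longrightarrow> b \<in> carrier H \<Longrightarrow> f a b \<in> carrier B"
  shows "sw B f h \<in> carrier B"
proof -
  interpret B: module K B by fact
  show ?thesis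
    using tsum_closed[OF module module B.abelian_group_axioms comul_closed[OF assms(2)] assms(3)] .
qed

lemma sw_cong:
  assumes "h \<in> carrier H" "\<And>a b. a \<in> carrier H \<Longrightarrow> b \<in> carrier H \<Longrightarrow> f a b = g a b"
  shows "sw B f h = sw B g h"
  using tsum_cong[OF module module comul_closed[OF assms(1)] assms(2)] .

lemma linear_sw:
  assumes "module K B" "module K B'" "linear_on K B B' \<phi>" "h \<in> carrier H"
    and "\<And>a b. a \<in> carrier H \<Longrightarrow> b \<in> carrier H \<Longrightarrow> f a b \<in> carrier B"
  shows "\<phi> (sw B f h) = sw B' (\<lambda>a b. \<phi> (f a b)) h"
  using linear_tsum[OF module module assms(1-3) comul_closed[OF assms(4)] assms(5)] .

lemma linear_on_sw_fun:
  assumes "module K L" "module K B" "h \<in> carrier H"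
    and "\<And>a b. a \<in> carrier H \<Longrightarrow> b \<in> carrier H \<Longrightarrow> linear_on K L B (\<lambda>m. f m a b)"
  shows "linear_on K L B (\<lambda>m. sw B (\<lambda>a b. f m a b) h)"
  using linear_on_tsum_fun[OF module module assms(1,2) comul_closed[OF assms(3)] assms(4)] .

lemma linear_on_sw_arg:
  assumes "module K B" "linear_on K L H g" "bilinear_on K H H B f"
  shows "linear_on K L B (\<lambda>m. sw B f (g m))"
  using linear_on_comp[OF linear_on_tsum[OF module module assms(1,3)]
      linear_on_comp[OF lin_linear[OF comul_lin] assms(2)]] .

lemma linear_on_mult:
  assumes "linear_on K L H g" "c \<in> carrier H"
  shows "linear_on K L H (\<lambda>m. g m \<otimes>\<^bsub>H\<^esub> c)" "linear_on K L H (\<lambda>m. c \<otimes>\<^bsub>H\<^esub> g m)"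
proof -
  interpret ring H by (rule ring)
  show "linear_on K L H (\<lambda>m. g m \<otimes>\<^bsub>H\<^esub> c)" "linear_on K L H (\<lambda>m. c \<otimes>\<^bsub>H\<^esub> g m)"
    using assms(2) linear_onD[OF assms(1)]
    by (auto intro!: linear_onI simp: l_distr r_distr smult_mult mult_smult)
qed

lemma linear_on_antipode:
  assumes "linear_on K L H g"
  shows "linear_on K L H (\<lambda>m. antipode H (g m))"
  using linear_on_comp[OF lin_linear[OF antipode_lin] assms] .

lemma linear_on_counit:
  assumes "module K B" "linear_on K L H g" "c \<in> carrier B"
  shows "linear_on K L B (\<lambda>m. counit H (g m) \<odot>\<^bsub>B\<^esub> c)"
proof -
  interpret B: module K B by fact
  show ?thesis using linear_onD[OF assms(2)] assms(3)
    by (auto intro!: linear_onI simp: counit_closed counit_add counit_smult B.smult_l_distr B.smult_assoc1)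
qed

text \<open>One rule per construct of a Sweedler expression, for linearity and for closedness:
  resolution with them derives linearity in any chosen leg from the shape of the term.\<close>

lemmas linear_rules = linear_on_id linear_on_sw_fun linear_on_sw_arg bilinear_onI linear_on_mult
  linear_on_antipode linear_on_counit linear_on_smult linear_on_pure1 linear_on_pure2
  sw_closed mult_closed antipode_closed one_closed counit_closed pure_closed
  tensor_module module module.smult_closed

lemma bilinear_on_comp1:
  assumes "bilinear_on K M N B f" "linear_on K L M g" "y \<in> carrier N"
  shows "linear_on K L B (\<lambda>x. f (g x) y)"
  using linear_on_comp[OF bilinear_onD(1)[OF assms(1,3)] assms(2)] .

lemma bilinear_on_comp2:
  assumes "bilinear_on K M N B f" "linear_on K L N g" "x \<in> carrier M"
  shows "linear_on K L B (\<lambda>y. f x (g y))"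
  using linear_on_comp[OF bilinear_onD(2)[OF assms(1,3)] assms(2)] .

lemma sw_swap:
  assumes "module K B" "h \<in> carrier H" "l \<in> carrier H"
    and "\<And>a b c d. a \<in> carrier H \<Longrightarrow> b \<in> carrier H \<Longrightarrow> c \<in> carrier H \<Longrightarrow> d \<in> carrier H \<Longrightarrow>
      f a b c d \<in> carrier B"
  shows "sw B (\<lambda>a b. sw B (\<lambda>c d. f a b c d) l) h = sw B (\<lambda>c d. sw B (\<lambda>a b. f a b c d) h) l"
  using tsum_swap[OF module module module module assms(1) comul_closed[OF assms(2)]
      comul_closed[OF assms(3)] assms(4)] .

lemma sw_one:
  assumes "module K B" "bilinear_on K H H B f"
  shows "sw B f \<one>\<^bsub>H\<^esub> = f \<one>\<^bsub>H\<^esub> \<one>\<^bsub>H\<^esub>"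
  unfolding comul_one by (rule tsum_pure[OF module module assms one_closed one_closed])

text \<open>The axiom \<open>comul_mult\<close> presents the coproduct of the product as a double
  sum of pure tensors, and the linear map induced by \<open>f\<close> passes through both
  sums.\<close>

lemma sw_mult:
  assumes "module K B" "bilinear_on K H H B f" "h \<in> carrier H" "l \<in> carrier H"
  shows "sw B f (h \<otimes>\<^bsub>H\<^esub> l) = sw B (\<lambda>a b. sw B (\<lambda>c d. f (a \<otimes>\<^bsub>H\<^esub> c) (b \<otimes>\<^bsub>H\<^esub> d)) l) h"
proof -
  note T = tensor_module[OF module module] and L = linear_on_tsum[OF module module assms(1,2)]
  have "sw B f (h \<otimes>\<^bsub>H\<^esub> l) = sw B (\<lambda>a b. tsum B f (sw (tensor K H H)
      (\<lambda>c d. pure K H H (a \<otimes>\<^bsub>H\<^esub> c) (b \<otimes>\<^bsub>H\<^esub> d)) l)) h"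
    unfolding comul_mult[OF assms(3,4)]
    by (rule linear_sw[OF T assms(1) L assms(3)]) (assumption | rule linear_rules T assms)+
  also have "\<dots> = sw B (\<lambda>a b. sw B (\<lambda>c d. tsum B f (pure K H H (a \<otimes>\<^bsub>H\<^esub> c) (b \<otimes>\<^bsub>H\<^esub> d))) l) h"
    by (intro sw_cong assms linear_sw[OF T assms(1) L assms(4)]) (assumption | rule linear_rules T assms)+
  also have "\<dots> = sw B (\<lambda>a b. sw B (\<lambda>c d. f (a \<otimes>\<^bsub>H\<^esub> c) (b \<otimes>\<^bsub>H\<^esub> d)) l) h"
    by (intro sw_cong assms tsum_pure[OF module module assms(1,2)] mult_closed)
  finally show ?thesis .
qed

text \<open>The axiom \<open>coassoc\<close> equates two elements of the triple tensor product. The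
  linear map induced there by the trilinear \<open>f\<close>, built in two stages as
  \<open>?F\<close> and \<open>tsum B ?F\<close>, sends them to the two sides.\<close>

lemma sw_coassoc:
  assumes B: "module K B" and h: "h \<in> carrier H"
    and f: "\<And>b c. b \<in> carrier H \<Longrightarrow> c \<in> carrier H \<Longrightarrow> linear_on K H B (\<lambda>a. f a b c)"
      "\<And>a c. a \<in> carrier H \<Longrightarrow> c \<in> carrier H \<Longrightarrow> linear_on K H B (\<lambda>b. f a b c)"
      "\<And>a b. a \<in> carrier H \<Longrightarrow> b \<in> carrier H \<Longrightarrow> linear_on K H B (\<lambda>c. f a b c)"
  shows "sw B (\<lambda>a b. sw B (\<lambda>c d. f c d b) a) h = sw B (\<lambda>a b. sw B (\<lambda>c d. f a c d) b) h"
proof -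
  let ?HH = "tensor K H H" and ?F = "\<lambda>x s. tsum B (\<lambda>c d. f x c d) s"
  let ?L = "tensor K ?HH H" and ?R = "tensor K H ?HH"
  let ?i = "\<lambda>x\<in>carrier H. x"
  note HH = tensor_module[OF module module]
  note R = tensor_module[OF module HH] and L = tensor_module[OF HH module]
  have F: "bilinear_on K H ?HH B ?F"
    using f by (intro bilinear_on_tsum2 module B)
  note \<Phi> = linear_on_tsum[OF module HH B F] and \<Phi>_pure = tsum_pure[OF module HH B F]
  have f2: "bilinear_on K H H B (\<lambda>c d. f a c d)" if "a \<in> carrier H" for a
    using f that by (intro bilinear_onI)
  note assoc = assoc_map_lin[OF module module module]
  have "assoc_map K H H H (tmap K H H ?HH H (comul H) ?i (comul H h)) =
      assoc_map K H H H (sw ?L (\<lambda>a b. pure K ?HH H (comul H a) b) h)"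
    using h by (simp add: tmap_def comul_closed cong: sw_cong)
  also have "\<dots> = sw ?R (\<lambda>a b. assoc_map K H H H (pure K ?HH H (comul H a) b)) h"
    by (rule linear_sw[OF L R lin_linear[OF assoc] h]) (intro pure_closed comul_closed)
  also have "\<dots> = sw ?R (\<lambda>a b. sw ?R (\<lambda>c d. pure K H ?HH c (pure K H H d b)) a) h"
    using h by (simp add: assoc_map_pure[OF module module module] comul_closed cong: sw_cong)
  finally have 1: "assoc_map K H H H (tmap K H H ?HH H (comul H) ?i (comul H h)) = \<dots>" .
  have 2: "tmap K H H H ?HH ?i (comul H) (comul H h) = sw ?R (\<lambda>a b. pure K H ?HH a (comul H b)) h"
    using h by (simp add: tmap_def comul_closed cong: sw_cong)
  have "sw B (\<lambda>a b. sw B (\<lambda>c d. f c d b) a) h =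
      sw B (\<lambda>a b. sw B (\<lambda>c d. tsum B ?F (pure K H ?HH c (pure K H H d b))) a) h"
  proof (intro sw_cong h)
    fix a b c d assume "a \<in> carrier H" "b \<in> carrier H" "c \<in> carrier H" "d \<in> carrier H"
    then show "f c d b = tsum B ?F (pure K H ?HH c (pure K H H d b))"
      using \<Phi>_pure[OF _ pure_closed[of d H b H K], of c] tsum_pure[OF module module B f2, of c d b] by simp
  qed
  also have "\<dots> = sw B (\<lambda>a b. tsum B ?F (sw ?R (\<lambda>c d. pure K H ?HH c (pure K H H d b)) a)) h"
    by (intro sw_cong h linear_sw[OF R B \<Phi>, symmetric] pure_closed)
  also have "\<dots> = tsum B ?F (sw ?R (\<lambda>a b. sw ?R (\<lambda>c d. pure K H ?HH c (pure K H H d b)) a) h)"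
    by (intro linear_sw[OF R B \<Phi>, symmetric] h sw_closed R pure_closed)
  also have "\<dots> = tsum B ?F (sw ?R (\<lambda>a b. pure K H ?HH a (comul H b)) h)"
    using coassoc[OF h] unfolding 1 2 by simp
  also have "\<dots> = sw B (\<lambda>a b. tsum B ?F (pure K H ?HH a (comul H b))) h"
    by (intro linear_sw[OF R B \<Phi>] h pure_closed comul_closed)
  also have "\<dots> = sw B (\<lambda>a b. sw B (\<lambda>c d. f a c d) b) h"
    by (intro sw_cong h \<Phi>_pure comul_closed)
  finally show ?thesis .
qed

lemma sw_counit_left:
  assumes "module K B" "linear_on K H B \<phi>" "h \<in> carrier H"
  shows "sw B (\<lambda>a b. counit H a \<odot>\<^bsub>B\<^esub> \<phi> b) h = \<phi> h"
proof -
  interpret H: module K H by (rule module)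
  have "\<phi> (sw H (\<lambda>a b. counit H a \<odot>\<^bsub>H\<^esub> b) h) = sw B (\<lambda>a b. \<phi> (counit H a \<odot>\<^bsub>H\<^esub> b)) h"
    by (intro linear_sw module assms H.smult_closed counit_closed)
  also have "\<dots> = sw B (\<lambda>a b. counit H a \<odot>\<^bsub>B\<^esub> \<phi> b) h"
    by (intro sw_cong assms linear_onD(3)[OF assms(2)] counit_closed)
  finally show ?thesis using counit_left[OF assms(3)] by simp
qed

lemma sw_counit_right:
  assumes "module K B" "linear_on K H B \<phi>" "h \<in> carrier H"
  shows "sw B (\<lambda>a b. counit H b \<odot>\<^bsub>B\<^esub> \<phi> a) h = \<phi> h"
proof -
  interpret H: module K H by (rule module)
  have "\<phi> (sw H (\<lambda>a b. counit H b \<odot>\<^bsub>H\<^esub> a) h) = sw B (\<lambda>a b. \<phi> (counit H b \<odot>\<^bsub>H\<^esub> a)) h"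
    by (intro linear_sw module assms H.smult_closed counit_closed)
  also have "\<dots> = sw B (\<lambda>a b. counit H b \<odot>\<^bsub>B\<^esub> \<phi> a) h"
    by (intro sw_cong assms linear_onD(3)[OF assms(2)] counit_closed)
  finally show ?thesis using counit_right[OF assms(3)] by simp
qed

lemma sw_antipode_left:
  assumes "module K B" "linear_on K H B \<phi>" "h \<in> carrier H"
  shows "sw B (\<lambda>a b. \<phi> (antipode H a \<otimes>\<^bsub>H\<^esub> b)) h = counit H h \<odot>\<^bsub>B\<^esub> \<phi> \<one>\<^bsub>H\<^esub>"
proof -
  have "\<phi> (sw H (\<lambda>a b. antipode H a \<otimes>\<^bsub>H\<^esub> b) h) = sw B (\<lambda>a b. \<phi> (antipode H a \<otimes>\<^bsub>H\<^esub> b)) h"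
    by (intro linear_sw module assms mult_closed antipode_closed)
  then show ?thesis
    using antipode_left[OF assms(3)] linear_onD(3)[OF assms(2) counit_closed[OF assms(3)] one_closed] by simp
qed

lemma sw_antipode_right:
  assumes "module K B" "linear_on K H B \<phi>" "h \<in> carrier H"
  shows "sw B (\<lambda>a b. \<phi> (a \<otimes>\<^bsub>H\<^esub> antipode H b)) h = counit H h \<odot>\<^bsub>B\<^esub> \<phi> \<one>\<^bsub>H\<^esub>"
proof -
  have "\<phi> (sw H (\<lambda>a b. a \<otimes>\<^bsub>H\<^esub> antipode H b) h) = sw B (\<lambda>a b. \<phi> (a \<otimes>\<^bsub>H\<^esub> antipode H b)) h"
    by (intro linear_sw module assms mult_closed antipode_closed)
  then show ?thesis
    using antipode_right[OF assms(3)] linear_onD(3)[OF assms(2) counit_closed[OF assms(3)] one_closed] by simp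
qed

text \<open>Both sides are the sum over \<open>h\<^sub>(\<^sub>1\<^sub>) \<otimes> h\<^sub>(\<^sub>2\<^sub>) \<otimes> h\<^sub>(\<^sub>3\<^sub>) \<otimes> h\<^sub>(\<^sub>4\<^sub>)\<close>; on the right the
  two inner factors are bracketed together.\<close>

lemma sw_coassoc4:
  assumes B: "module K B" and h: "h \<in> carrier H"
    and J: "\<And>b c d. b \<in> carrier H \<Longrightarrow> c \<in> carrier H \<Longrightarrow> d \<in> carrier H \<Longrightarrow> linear_on K H B (\<lambda>a. J a b c d)"
      "\<And>a c d. a \<in> carrier H \<Longrightarrow> c \<in> carrier H \<Longrightarrow> d \<in> carrier H \<Longrightarrow> linear_on K H B (\<lambda>b. J a b c d)"
      "\<And>a b d. a \<in> carrier H \<Longrightarrow> b \<in> carrier H \<Longrightarrow> d \<in> carrier H \<Longrightarrow> linear_on K H B (\<lambda>c. J a b c d)"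
      "\<And>a b c. a \<in> carrier H \<Longrightarrow> b \<in> carrier H \<Longrightarrow> c \<in> carrier H \<Longrightarrow> linear_on K H B (\<lambda>d. J a b c d)"
  shows "sw B (\<lambda>a b. sw B (\<lambda>c d. sw B (\<lambda>a' b'. J a' b' c d) a) b) h =
    sw B (\<lambda>a d. sw B (\<lambda>w d. sw B (\<lambda>b c. J a b c d) w) d) h"
proof -
  note Jc = linear_onD(1)[OF J(1)]
  have "sw B (\<lambda>a b. sw B (\<lambda>c d. sw B (\<lambda>a' b'. J a' b' c d) a) b) h =
      sw B (\<lambda>a b. sw B (\<lambda>a' b'. sw B (\<lambda>c d. J a' b' c d) b) a) h"
    by (intro sw_cong h sw_swap B Jc)
  also have "\<dots> = sw B (\<lambda>a b. sw B (\<lambda>x y. sw B (\<lambda>c d. J a x c d) y) b) h"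
    by (rule sw_coassoc[OF B h]) (assumption | rule linear_rules B J)+
  also have "\<dots> = sw B (\<lambda>a b. sw B (\<lambda>w d. sw B (\<lambda>x c. J a x c d) w) b) h"
    by (intro sw_cong h sw_coassoc[symmetric] B J)
  finally show ?thesis .
qed

text \<open>Both \<open>\<Delta> \<circ> S\<close> and \<open>h \<mapsto> S(h\<^sub>(\<^sub>2\<^sub>)) \<otimes> S(h\<^sub>(\<^sub>1\<^sub>))\<close> are convolution inverses of \<open>\<Delta>\<close>; the double sum
  below is their product with \<open>\<Delta>\<close> in the middle.\<close>

lemma sw_antipode:
  assumes B: "module K B" and f: "bilinear_on K H H B f" and h: "h \<in> carrier H"
  shows "sw B f (antipode H h) = sw B (\<lambda>a b. f (antipode H b) (antipode H a)) h"
proof -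
  let ?S = "antipode H"
  interpret H: ring H by (rule ring)
  note f1 = bilinear_on_comp1[OF f] and f2 = bilinear_on_comp2[OF f] and fc = bilinear_onD(3)[OF f]
  note rules = linear_rules B f1 f2 fc
  \<comment> \<open>With \<open>\<Delta> d = d1 \<otimes> d2\<close>, this is \<open>f\<close> on
    the product of \<open>\<Delta> z\<close> and \<open>S d2 \<otimes> S d1\<close>; convolution
    products with the candidate inverse take this form.\<close>
  define D where "D z d = sw B (\<lambda>d1 d2. sw B (\<lambda>p q. f (p \<otimes>\<^bsub>H\<^esub> ?S d2) (q \<otimes>\<^bsub>H\<^esub> ?S d1)) z) d" for z d
  have D: "D z d \<in> carrier B" "linear_on K H B (\<lambda>z. D z d)" "linear_on K H B (\<lambda>d. D z d)"
    if "z \<in> carrier H" "d \<in> carrier H" for z d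
    unfolding D_def using that by - (assumption | rule rules)+
  have D1: "linear_on K L B (\<lambda>x. D (g x) d)" if "linear_on K L H g" "d \<in> carrier H" for g d L
    using linear_on_comp[OF D(2)[OF one_closed that(2)] that(1)] .
  \<comment> \<open>One half of the cancellation: \<open>\<Delta>\<close> times the candidate
    inverse is the counit. The factor \<open>z\<close> is carried along on the left because the
    double sum has the antipode of a further leg there.\<close>
  have inner: "sw B (\<lambda>c d. D (z \<otimes>\<^bsub>H\<^esub> c) d) b = counit H b \<odot>\<^bsub>B\<^esub> sw B f z"
    if z: "z \<in> carrier H" and b: "b \<in> carrier H" for z b
  proof -
    let ?J = "\<lambda>p q c1 c2 d1 d2. f (p \<otimes>\<^bsub>H\<^esub> c1 \<otimes>\<^bsub>H\<^esub> ?S d2) (q \<otimes>\<^bsub>H\<^esub> c2 \<otimes>\<^bsub>H\<^esub> ?S d1)"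
    have J: "sw B (\<lambda>c d. sw B (\<lambda>d1 d2. sw B (\<lambda>c1 c2. ?J p q c1 c2 d1 d2) c) d) b = counit H b \<odot>\<^bsub>B\<^esub> f p q"
      if p: "p \<in> carrier H" and q: "q \<in> carrier H" for p q
    proof -
      \<comment> \<open>Of the four legs of \<open>b\<close>, the two inner ones meet in the second
        argument as \<open>x\<close> times \<open>S d1\<close> and collapse to a counit; after that
        \<open>u\<close> and \<open>S v\<close> meet in the first argument.\<close>
      have "sw B (\<lambda>c d. sw B (\<lambda>d1 d2. sw B (\<lambda>c1 c2. ?J p q c1 c2 d1 d2) c) d) b =
          sw B (\<lambda>u v. sw B (\<lambda>w d2. sw B (\<lambda>x d1. ?J p q u x d1 d2) w) v) b"
        by (rule sw_coassoc4[OF B b]) (assumption | rule rules p q)+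
      also have "\<dots> = sw B (\<lambda>u v. sw B (\<lambda>w d2. counit H w \<odot>\<^bsub>B\<^esub> f (p \<otimes>\<^bsub>H\<^esub> u \<otimes>\<^bsub>H\<^esub> ?S d2) q) v) b"
      proof (intro sw_cong b)
        fix u v w d2 assume H: "u \<in> carrier H" "v \<in> carrier H" "w \<in> carrier H" "d2 \<in> carrier H"
        have "linear_on K H B (\<lambda>y. f (p \<otimes>\<^bsub>H\<^esub> u \<otimes>\<^bsub>H\<^esub> ?S d2) (q \<otimes>\<^bsub>H\<^esub> y))"
          using H p q by - (assumption | rule rules)+
        from sw_antipode_right[OF B this H(3)] H p q
        show "sw B (\<lambda>x d1. ?J p q u x d1 d2) w = counit H w \<odot>\<^bsub>B\<^esub> f (p \<otimes>\<^bsub>H\<^esub> u \<otimes>\<^bsub>H\<^esub> ?S d2) q"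
          by (simp add: H.m_assoc antipode_closed cong: sw_cong)
      qed
      also have "\<dots> = sw B (\<lambda>u v. f (p \<otimes>\<^bsub>H\<^esub> u \<otimes>\<^bsub>H\<^esub> ?S v) q) b"
        by (intro sw_cong b sw_counit_left B) (assumption | rule rules p q)+
      also have "\<dots> = sw B (\<lambda>u v. f (p \<otimes>\<^bsub>H\<^esub> (u \<otimes>\<^bsub>H\<^esub> ?S v)) q) b"
        using p q b by (simp add: H.m_assoc antipode_closed cong: sw_cong)
      also have "\<dots> = counit H b \<odot>\<^bsub>B\<^esub> f (p \<otimes>\<^bsub>H\<^esub> \<one>\<^bsub>H\<^esub>) q"
        by (rule sw_antipode_right[OF B _ b]) (assumption | rule rules p q)+
      finally show ?thesis using p by simp
    qed
    have "sw B (\<lambda>c d. D (z \<otimes>\<^bsub>H\<^esub> c) d) b =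
        sw B (\<lambda>c d. sw B (\<lambda>d1 d2. sw B (\<lambda>p q. sw B (\<lambda>c1 c2. ?J p q c1 c2 d1 d2) c) z) d) b"
      unfolding D_def by (intro sw_cong b sw_mult B z) (assumption | rule rules)+
    also have "\<dots> = sw B (\<lambda>c d. sw B (\<lambda>p q. sw B (\<lambda>d1 d2. sw B (\<lambda>c1 c2. ?J p q c1 c2 d1 d2) c) d) z) b"
      by (intro sw_cong b sw_swap B z) (assumption | rule rules)+
    also have "\<dots> = sw B (\<lambda>p q. sw B (\<lambda>c d. sw B (\<lambda>d1 d2. sw B (\<lambda>c1 c2. ?J p q c1 c2 d1 d2) c) d) b) z"
      by (intro b sw_swap B z) (assumption | rule rules)+
    also have "\<dots> = sw B (\<lambda>p q. counit H b \<odot>\<^bsub>B\<^esub> f p q) z"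
      by (intro sw_cong z J)
    also have "\<dots> = counit H b \<odot>\<^bsub>B\<^esub> sw B f z"
      by (rule linear_sw[OF B B _ z, symmetric]) (assumption | rule rules b)+
    finally show ?thesis .
  qed
  \<comment> \<open>The double sum takes three legs \<open>a\<close>, \<open>c\<close>,
    \<open>d\<close> of \<open>h\<close> and evaluates \<open>D\<close> at the product of
    \<open>S a\<close> with \<open>c\<close> and at \<open>d\<close>. Grouping \<open>c\<close> with
    \<open>d\<close> gives the coproduct of the antipode, by \<open>inner\<close>; grouping
    \<open>a\<close> with \<open>c\<close> cancels these two and leaves the reversed
    antipodes.\<close>
  have "sw B f (?S h) = sw B (\<lambda>a b. counit H b \<odot>\<^bsub>B\<^esub> sw B f (?S a)) h"
    by (rule sw_counit_right[OF B _ h, symmetric]) (assumption | rule rules)+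
  also have "\<dots> = sw B (\<lambda>a b. sw B (\<lambda>c d. D (?S a \<otimes>\<^bsub>H\<^esub> c) d) b) h"
    by (intro sw_cong h inner[symmetric] antipode_closed)
  also have "\<dots> = sw B (\<lambda>w d. sw B (\<lambda>a c. D (?S a \<otimes>\<^bsub>H\<^esub> c) d) w) h"
    by (rule sw_coassoc[OF B h, symmetric]) (assumption | rule D1 D(3) rules)+
  also have "\<dots> = sw B (\<lambda>w d. counit H w \<odot>\<^bsub>B\<^esub> D \<one>\<^bsub>H\<^esub> d) h"
    by (intro sw_cong h sw_antipode_left[OF B]) (assumption | rule D1 rules)+
  also have "\<dots> = D \<one>\<^bsub>H\<^esub> h"
    by (rule sw_counit_left[OF B D(3)[OF one_closed one_closed] h])
  also have "\<dots> = sw B (\<lambda>a b. f (?S b) (?S a)) h"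
    unfolding D_def
  proof (intro sw_cong h)
    fix a b assume ab: "a \<in> carrier H" "b \<in> carrier H"
    have "bilinear_on K H H B (\<lambda>p q. f (p \<otimes>\<^bsub>H\<^esub> ?S b) (q \<otimes>\<^bsub>H\<^esub> ?S a))"
      using ab by - (assumption | rule rules)+
    from sw_one[OF B this] ab
    show "sw B (\<lambda>p q. f (p \<otimes>\<^bsub>H\<^esub> ?S b) (q \<otimes>\<^bsub>H\<^esub> ?S a)) \<one>\<^bsub>H\<^esub> = f (?S b) (?S a)"
      by (simp add: antipode_closed)
  qed
  finally show ?thesis .
qed

end

section \<open>Representations\<close>

lemma End_simps:
  "carrier (End_alg K M) = lin K M M" "\<one>\<^bsub>End_alg K M\<^esub> = (\<lambda>x\<in>carrier M. x)"
  "f \<otimes>\<^bsub>End_alg K M\<^esub> g = compose (carrier M) f g"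
  "f \<oplus>\<^bsub>End_alg K M\<^esub> g = (\<lambda>x\<in>carrier M. f x \<oplus>\<^bsub>M\<^esub> g x)"
  "a \<odot>\<^bsub>End_alg K M\<^esub> f = (\<lambda>x\<in>carrier M. a \<odot>\<^bsub>M\<^esub> f x)"
  by (simp_all add: End_alg_def)

text \<open>The operations of \<open>End_alg\<close> are pointwise and restricted by definition,
  whatever functions they are applied to.\<close>

lemma tsum_End:
  "m \<in> carrier M \<Longrightarrow> tsum (End_alg K M) F t m = tsum M (\<lambda>a b. F a b m) t"
  "tsum (End_alg K M) F t \<in> extensional (carrier M)"
proof -
  have "lsum (End_alg K M) F l m = lsum M (\<lambda>a b. F a b m) l" if "m \<in> carrier M" for l
    using that by (induction l) (auto simp: End_alg_def)
  then show "m \<in> carrier M \<Longrightarrow> tsum (End_alg K M) F t m = tsum M (\<lambda>a b. F a b m) t"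
    by (simp add: tsum_lsum)
  have "lsum (End_alg K M) F l \<in> extensional (carrier M)" for l
    by (cases l) (auto simp: End_alg_def)
  then show "tsum (End_alg K M) F t \<in> extensional (carrier M)"
    by (simp add: tsum_lsum)
qed

text \<open>Currying, with both layers of extensionality kept visible; the bilinear form is the one
  that the linearity rules for Sweedler sums can handle.\<close>

lemma lin_End_iff:
  assumes "module K H" "module K M"
  shows "\<pi> \<in> lin K H (End_alg K M) \<longleftrightarrow>
    \<pi> \<in> extensional (carrier H) \<and> (\<forall>h\<in>carrier H. \<pi> h \<in> extensional (carrier M)) \<and> bilinear_on K H M M \<pi>"
proof -
  interpret H: module K H by fact
  interpret M: module K M by fact
  have "linear_on K H (End_alg K M) \<pi> \<longleftrightarrow>
      (\<forall>h\<in>carrier H. \<pi> h \<in> extensional (carrier M)) \<and> bilinear_on K H M M \<pi>"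
  proof (intro iffI conjI)
    assume L: "linear_on K H (End_alg K M) \<pi>"
    note D = linear_onD[OF L, unfolded End_simps]
    have "linear_on K M M (\<pi> h)" if "h \<in> carrier H" for h using D(1)[OF that] by (rule lin_linear)
    moreover have "linear_on K H M (\<lambda>h. \<pi> h m)" if "m \<in> carrier M" for m
      using that D(2,3) lin_closed[OF D(1)] by (intro linear_onI) auto
    ultimately show "bilinear_on K H M M \<pi>" by (intro bilinear_onI)
    show "\<forall>h\<in>carrier H. \<pi> h \<in> extensional (carrier M)" using D(1) by (simp add: lin_iff)
  next
    assume R: "(\<forall>h\<in>carrier H. \<pi> h \<in> extensional (carrier M)) \<and> bilinear_on K H M M \<pi>"
    note D = bilinear_onD[OF R[THEN conjunct2]]
    show "linear_on K H (End_alg K M) \<pi>"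
      unfolding linear_on_def End_simps
    proof (intro conjI ballI)
      fix h assume "h \<in> carrier H"
      then show "\<pi> h \<in> lin K M M" using R D(2) by (simp add: lin_iff)
    next
      fix h l assume "h \<in> carrier H" "l \<in> carrier H"
      then show "\<pi> (h \<oplus>\<^bsub>H\<^esub> l) = (\<lambda>x\<in>carrier M. \<pi> h x \<oplus>\<^bsub>M\<^esub> \<pi> l x)"
        using R linear_onD(2)[OF D(1)] by (intro extensionalityI) auto
    next
      fix a h assume "a \<in> carrier K" "h \<in> carrier H"
      then show "\<pi> (a \<odot>\<^bsub>H\<^esub> h) = (\<lambda>x\<in>carrier M. a \<odot>\<^bsub>M\<^esub> \<pi> h x)"
        using R linear_onD(3)[OF D(1)] by (intro extensionalityI) auto
    qed
  qed
  then show ?thesis by (auto simp: lin_iff)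
qed

context hopf_algebra
begin

text \<open>The ambient class of objects: it demands nothing about products in \<open>H\<close> or
  its unit, so that it contains both global and partial modules and their mixed tensor products can
  be formed in one place.\<close>

definition linear_reps :: "('k, 'h, 'a) rep set" where
  "linear_reps = {(M, \<pi>). module K M \<and> \<pi> \<in> lin K H (End_alg K M)}"

definition multiplicative :: "('k, 'a) vs \<Rightarrow> (('k, 'h) univ \<Rightarrow> ('k, 'a) univ \<Rightarrow> ('k, 'a) univ) \<Rightarrow> bool" where
  "multiplicative M \<pi> \<longleftrightarrow> (\<forall>h\<in>carrier H. \<forall>l\<in>carrier H. \<forall>x\<in>carrier M. \<pi> (h \<otimes>\<^bsub>H\<^esub> l) x = \<pi> h (\<pi> l x))"

definition partially_multiplicative ::
  "('k, 'a) vs \<Rightarrow> (('k, 'h) univ \<Rightarrow> ('k, 'a) univ \<Rightarrow> ('k, 'a) univ) \<Rightarrow> bool" where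
  "partially_multiplicative M \<pi> \<longleftrightarrow> (\<forall>h\<in>carrier H. \<forall>l\<in>carrier H. \<forall>x\<in>carrier M.
     sw M (\<lambda>a b. \<pi> h (\<pi> a (\<pi> (antipode H b) x))) l = sw M (\<lambda>a b. \<pi> (h \<otimes>\<^bsub>H\<^esub> a) (\<pi> (antipode H b) x)) l \<and>
     sw M (\<lambda>a b. \<pi> a (\<pi> (antipode H b) (\<pi> l x))) h = sw M (\<lambda>a b. \<pi> a (\<pi> (antipode H b \<otimes>\<^bsub>H\<^esub> l) x)) h)"

definition unital :: "('k, 'a) vs \<Rightarrow> (('k, 'h) univ \<Rightarrow> ('k, 'a) univ \<Rightarrow> ('k, 'a) univ) \<Rightarrow> bool" where
  "unital M \<pi> \<longleftrightarrow> (\<forall>x\<in>carrier M. \<pi> \<one>\<^bsub>H\<^esub> x = x)"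

lemma unital_iff:
  assumes "(M, \<pi>) \<in> linear_reps"
  shows "\<pi> \<one>\<^bsub>H\<^esub> = \<one>\<^bsub>End_alg K M\<^esub> \<longleftrightarrow> unital M \<pi>"
proof -
  have "\<pi> \<one>\<^bsub>H\<^esub> \<in> extensional (carrier M)"
    using assms lin_End_iff[OF module] one_closed by (auto simp: linear_reps_def)
  then show ?thesis
    by (auto simp: unital_def End_simps intro: extensionalityI[OF _ restrict_extensional])
qed

lemma global_rep_iff:
  assumes "(M, \<pi>) \<in> linear_reps"
  shows "global_rep K H (End_alg K M) \<pi> \<longleftrightarrow> unital M \<pi> \<and> multiplicative M \<pi>"
proof -
  have M: "module K M" "\<pi> \<in> lin K H (End_alg K M)" using assms by (auto simp: linear_reps_def)
  note D = linear_onD[OF lin_linear[OF M(2)]]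
  have *: "\<pi> h \<in> lin K M M" if "h \<in> carrier H" for h using D(1)[OF that] by (simp add: End_simps)
  have "\<pi> (h \<otimes>\<^bsub>H\<^esub> l) = \<pi> h \<otimes>\<^bsub>End_alg K M\<^esub> \<pi> l \<longleftrightarrow> (\<forall>x\<in>carrier M. \<pi> (h \<otimes>\<^bsub>H\<^esub> l) x = \<pi> h (\<pi> l x))"
    if "h \<in> carrier H" "l \<in> carrier H" for h l
    using lin_eqI[OF *[OF mult_closed[OF that]] lin_compose[OF M(1) *[OF that(2)] *[OF that(1)]]]
    by (auto simp: End_simps compose_eq)
  then have "(\<forall>h\<in>carrier H. \<forall>l\<in>carrier H. \<pi> (h \<otimes>\<^bsub>H\<^esub> l) = \<pi> h \<otimes>\<^bsub>End_alg K M\<^esub> \<pi> l) \<longleftrightarrow> multiplicative M \<pi>"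
    by (simp add: multiplicative_def)
  then show ?thesis
    using M(2) D unital_iff[OF assms] by (auto simp: global_rep_def ring_hom_def)
qed

text \<open>Equality in \<open>End_alg\<close> is tested pointwise, which moves the Sweedler sums
  from the endomorphism algebra into \<open>M\<close>.\<close>

lemma partial_rep_iff:
  assumes "(M, \<pi>) \<in> linear_reps"
  shows "partial_rep K H (End_alg K M) \<pi> \<longleftrightarrow> unital M \<pi> \<and> partially_multiplicative M \<pi>"
proof -
  have M: "module K M" "\<pi> \<in> lin K H (End_alg K M)" using assms by (auto simp: linear_reps_def)
  have cl: "\<pi> h x \<in> carrier M" if "h \<in> carrier H" "x \<in> carrier M" for h x
    using M(2) that bilinear_onD(3)[of K H M M \<pi>] by (simp add: lin_End_iff[OF module M(1)])
  have eq: "tsum (End_alg K M) F t = tsum (End_alg K M) F' t' \<longleftrightarrow>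
      (\<forall>x\<in>carrier M. tsum M (\<lambda>a b. F a b x) t = tsum M (\<lambda>a b. F' a b x) t')" (is "?l = ?r \<longleftrightarrow> ?R")
    for F F' and t t' :: "('k, 'h) univ"
  proof
    assume "?l = ?r"
    then have "?l x = ?r x" for x by simp
    then show ?R by (simp add: tsum_End(1)[of _ M K, symmetric])
  next
    assume ?R
    then show "?l = ?r"
      by (intro extensionalityI[OF tsum_End(2) tsum_End(2)]) (simp add: tsum_End(1))
  qed
  have "sw M (\<lambda>a b. (\<pi> h \<otimes>\<^bsub>End_alg K M\<^esub> \<pi> a \<otimes>\<^bsub>End_alg K M\<^esub> \<pi> (antipode H b)) x) l =
        sw M (\<lambda>a b. \<pi> h (\<pi> a (\<pi> (antipode H b) x))) l"
      "sw M (\<lambda>a b. (\<pi> (h \<otimes>\<^bsub>H\<^esub> a) \<otimes>\<^bsub>End_alg K M\<^esub> \<pi> (antipode H b)) x) l =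
        sw M (\<lambda>a b. \<pi> (h \<otimes>\<^bsub>H\<^esub> a) (\<pi> (antipode H b) x)) l"
      "sw M (\<lambda>a b. (\<pi> a \<otimes>\<^bsub>End_alg K M\<^esub> \<pi> (antipode H b) \<otimes>\<^bsub>End_alg K M\<^esub> \<pi> l) x) h =
        sw M (\<lambda>a b. \<pi> a (\<pi> (antipode H b) (\<pi> l x))) h"
      "sw M (\<lambda>a b. (\<pi> a \<otimes>\<^bsub>End_alg K M\<^esub> \<pi> (antipode H b \<otimes>\<^bsub>H\<^esub> l)) x) h =
        sw M (\<lambda>a b. \<pi> a (\<pi> (antipode H b \<otimes>\<^bsub>H\<^esub> l) x)) h"
    if "h \<in> carrier H" "l \<in> carrier H" "x \<in> carrier M" for h l x
    using that by (simp_all add: End_simps compose_eq cl antipode_closed mult_closed cong: sw_cong)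
  then have "(\<forall>x\<in>carrier M. sw M (\<lambda>a b. \<pi> h (\<pi> a (\<pi> (antipode H b) x))) l =
        sw M (\<lambda>a b. \<pi> (h \<otimes>\<^bsub>H\<^esub> a) (\<pi> (antipode H b) x)) l) \<longleftrightarrow>
      tsum (End_alg K M) (\<lambda>a b. \<pi> h \<otimes>\<^bsub>End_alg K M\<^esub> \<pi> a \<otimes>\<^bsub>End_alg K M\<^esub> \<pi> (antipode H b)) (comul H l) =
        tsum (End_alg K M) (\<lambda>a b. \<pi> (h \<otimes>\<^bsub>H\<^esub> a) \<otimes>\<^bsub>End_alg K M\<^esub> \<pi> (antipode H b)) (comul H l)"
      "(\<forall>x\<in>carrier M. sw M (\<lambda>a b. \<pi> a (\<pi> (antipode H b) (\<pi> l x))) h =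
        sw M (\<lambda>a b. \<pi> a (\<pi> (antipode H b \<otimes>\<^bsub>H\<^esub> l) x)) h) \<longleftrightarrow>
      tsum (End_alg K M) (\<lambda>a b. \<pi> a \<otimes>\<^bsub>End_alg K M\<^esub> \<pi> (antipode H b) \<otimes>\<^bsub>End_alg K M\<^esub> \<pi> l) (comul H h) =
        tsum (End_alg K M) (\<lambda>a b. \<pi> a \<otimes>\<^bsub>End_alg K M\<^esub> \<pi> (antipode H b \<otimes>\<^bsub>H\<^esub> l)) (comul H h)"
    if "h \<in> carrier H" "l \<in> carrier H" for h l
    using that unfolding eq by simp_all
  then show ?thesis
    using M(2) unital_iff[OF assms]
    unfolding partial_rep_def partially_multiplicative_def by (auto simp: ball_conj_distrib)
qed

end

section \<open>Tensor product of two linear representations\<close>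

locale rep_pair = hopf_algebra K H
  for K :: "('k, 'r) ring_scheme" and H :: "('k, ('k, 'h) univ, 'z) hopf_scheme" +
  fixes X :: "('k, 'a) vs" and \<rho> :: "('k, 'h) univ \<Rightarrow> ('k, 'a) univ \<Rightarrow> ('k, 'a) univ"
    and Y :: "('k, 'a) vs" and \<sigma> :: "('k, 'h) univ \<Rightarrow> ('k, 'a) univ \<Rightarrow> ('k, 'a) univ"
  assumes X_rep: "(X, \<rho>) \<in> linear_reps" and Y_rep: "(Y, \<sigma>) \<in> linear_reps"
begin

abbreviation T where "T \<equiv> tensor K X Y"
abbreviation p where "p \<equiv> pure K X Y"
abbreviation S where "S \<equiv> antipode H"

definition \<tau> where "\<tau> = snd (tensor_rep K H (X, \<rho>) (Y, \<sigma>))"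

lemma X: "module K X" and Y: "module K Y" and T: "module K T"
  using X_rep Y_rep by (auto simp: linear_reps_def tensor_module)

lemma \<rho>: "bilinear_on K H X X \<rho>" and \<sigma>: "bilinear_on K H Y Y \<sigma>"
  using X_rep Y_rep lin_End_iff[OF module] by (auto simp: linear_reps_def)

lemma \<rho>_lin: "h \<in> carrier H \<Longrightarrow> \<rho> h \<in> lin K X X" and \<sigma>_lin: "h \<in> carrier H \<Longrightarrow> \<sigma> h \<in> lin K Y Y"
  using X_rep Y_rep lin_closed by (fastforce simp: linear_reps_def End_simps)+

lemmas rules = linear_rules X Y T
  bilinear_on_comp1[OF \<rho>] bilinear_on_comp2[OF \<rho>] bilinear_onD(3)[OF \<rho>]
  bilinear_on_comp1[OF \<sigma>] bilinear_on_comp2[OF \<sigma>] bilinear_onD(3)[OF \<sigma>]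

lemma \<tau>_sw: "h \<in> carrier H \<Longrightarrow> t \<in> carrier T \<Longrightarrow>
    \<tau> h t = sw T (\<lambda>a b. tmap K X Y X Y (\<rho> a) (\<sigma> b) t) h"
  by (simp add: \<tau>_def tensor_rep_def tsum_End(1))

lemma \<tau>_pure:
  assumes "h \<in> carrier H" "x \<in> carrier X" "y \<in> carrier Y"
  shows "\<tau> h (p x y) = sw T (\<lambda>a b. p (\<rho> a x) (\<sigma> b y)) h"
  using assms by (simp add: \<tau>_sw pure_closed tmap_pure[OF \<rho>_lin \<sigma>_lin X Y X Y] cong: sw_cong)

lemma \<tau>_linear: "h \<in> carrier H \<Longrightarrow> linear_on K T T (\<tau> h)"
proof -
  assume h: "h \<in> carrier H"
  have "linear_on K T T (\<lambda>t. sw T (\<lambda>a b. tmap K X Y X Y (\<rho> a) (\<sigma> b) t) h)"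
    by (intro linear_on_sw_fun T h lin_linear[OF tmap_lin] \<rho>_lin \<sigma>_lin X Y)
  then show ?thesis
    by (rule linear_on_cong[OF T, THEN iffD2, rotated]) (rule \<tau>_sw[OF h])
qed

text \<open>For fixed \<open>t\<close> the value is a sum over the list stored in \<open>t\<close>,
  and each summand is bilinear in \<open>a\<close> and \<open>b\<close>.\<close>

lemma tmap_bilinear:
  assumes "t \<in> carrier T"
  shows "bilinear_on K H H T (\<lambda>a b. tmap K X Y X Y (\<rho> a) (\<sigma> b) t)"
proof -
  have "tmap K X Y X Y (\<rho> a) (\<sigma> b) t = tsum T (\<lambda>x y. p (\<rho> a x) (\<sigma> b y)) t" for a b
    using assms by (simp add: tmap_def)
  moreover have "bilinear_on K H H T (\<lambda>a b. tsum T (\<lambda>x y. p (\<rho> a x) (\<sigma> b y)) t)"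
    by (intro bilinear_onI linear_on_tsum_fun[OF X Y module T assms]) (assumption | rule rules)+
  ultimately show ?thesis by simp
qed

lemma \<tau>_bilinear: "bilinear_on K H T T \<tau>"
proof (rule bilinear_onI)
  fix t assume t: "t \<in> carrier T"
  have "linear_on K H T (\<lambda>h. sw T (\<lambda>a b. tmap K X Y X Y (\<rho> a) (\<sigma> b) t) h)"
    by (intro linear_on_sw_arg T linear_on_id tmap_bilinear[OF t])
  then show "linear_on K H T (\<lambda>h. \<tau> h t)"
    by (rule linear_on_cong[OF module, THEN iffD2, rotated]) (rule \<tau>_sw[OF _ t])
qed (rule \<tau>_linear)

lemma tensor_rep_eq: "tensor_rep K H (X, \<rho>) (Y, \<sigma>) = (T, \<tau>)"
  by (simp add: \<tau>_def tensor_rep_def)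

lemma \<tau>_rep: "(T, \<tau>) \<in> linear_reps"
  unfolding linear_reps_def using T
  by (auto simp: lin_End_iff[OF module T] \<tau>_bilinear)
    (auto simp: \<tau>_def tensor_rep_def tsum_End(2))

lemma \<tau>_of_sw:
  assumes "h \<in> carrier H" "l \<in> carrier H"
    and "\<And>a b. a \<in> carrier H \<Longrightarrow> b \<in> carrier H \<Longrightarrow> f a b \<in> carrier T"
  shows "\<tau> h (sw T f l) = sw T (\<lambda>a b. \<tau> h (f a b)) l"
  by (rule linear_sw[OF T T \<tau>_linear[OF assms(1)] assms(2,3)])

lemma \<tau>_unital:
  assumes "unital X \<rho>" "unital Y \<sigma>"
  shows "unital T \<tau>"
  unfolding unital_def
proof (intro ballI)
  fix t assume t: "t \<in> carrier T"
  show "\<tau> \<one>\<^bsub>H\<^esub> t = t"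
  proof (rule tensor_ext[OF X Y T \<tau>_linear[OF one_closed] linear_on_id _ t])
    fix x y assume xy: "x \<in> carrier X" "y \<in> carrier Y"
    have "bilinear_on K H H T (\<lambda>a b. p (\<rho> a x) (\<sigma> b y))"
      by (assumption | rule rules xy)+
    from sw_one[OF T this] show "\<tau> \<one>\<^bsub>H\<^esub> (p x y) = p x y"
      using assms xy by (simp add: \<tau>_pure one_closed unital_def)
  qed
qed

lemma \<tau>_pure_mult:
  assumes "h \<in> carrier H" "l \<in> carrier H" "x \<in> carrier X" "y \<in> carrier Y"
  shows "\<tau> (h \<otimes>\<^bsub>H\<^esub> l) (p x y) =
    sw T (\<lambda>a b. sw T (\<lambda>c d. p (\<rho> (a \<otimes>\<^bsub>H\<^esub> c) x) (\<sigma> (b \<otimes>\<^bsub>H\<^esub> d) y)) l) h"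
  unfolding \<tau>_pure[OF mult_closed[OF assms(1,2)] assms(3,4)]
  by (rule sw_mult[OF T _ assms(1,2)]) (assumption | rule rules assms)+

lemma \<tau>_multiplicative:
  assumes "multiplicative X \<rho>" "multiplicative Y \<sigma>"
  shows "multiplicative T \<tau>"
  unfolding multiplicative_def
proof (intro ballI)
  fix h l t assume h: "h \<in> carrier H" and l: "l \<in> carrier H" and t: "t \<in> carrier T"
  show "\<tau> (h \<otimes>\<^bsub>H\<^esub> l) t = \<tau> h (\<tau> l t)"
  proof (rule tensor_ext[OF X Y T \<tau>_linear[OF mult_closed[OF h l]]
        linear_on_comp[OF \<tau>_linear[OF h] \<tau>_linear[OF l]] _ t])
    fix x y assume xy: "x \<in> carrier X" "y \<in> carrier Y"
    have "\<tau> h (\<tau> l (p x y)) = sw T (\<lambda>c d. sw T (\<lambda>a b. p (\<rho> a (\<rho> c x)) (\<sigma> b (\<sigma> d y))) h) l"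
      unfolding \<tau>_pure[OF l xy]
      by (subst \<tau>_of_sw[OF h l], (assumption | rule rules xy)+)
        (intro sw_cong l \<tau>_pure h, (assumption | rule rules xy)+)
    also have "\<dots> = sw T (\<lambda>a b. sw T (\<lambda>c d. p (\<rho> a (\<rho> c x)) (\<sigma> b (\<sigma> d y))) l) h"
      by (rule sw_swap[OF T l h]) (assumption | rule rules xy)+
    also have "\<dots> = \<tau> (h \<otimes>\<^bsub>H\<^esub> l) (p x y)"
      using assms xy h l by (simp add: \<tau>_pure_mult multiplicative_def cong: sw_cong)
    finally show "\<tau> (h \<otimes>\<^bsub>H\<^esub> l) (p x y) = \<tau> h (\<tau> l (p x y))" ..
  qed
qed

text \<open>The antipode reverses the order of the legs, so the left factor receives
  \<open>S d\<close> and the right one \<open>S c\<close>. This crossing is what later nests the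
  four legs into an outer and an inner pair.\<close>

lemma \<tau>_antipode:
  assumes "b \<in> carrier H" "x \<in> carrier X" "y \<in> carrier Y"
  shows "\<tau> (S b) (p x y) = sw T (\<lambda>c d. p (\<rho> (S d) x) (\<sigma> (S c) y)) b"
  unfolding \<tau>_pure[OF antipode_closed[OF assms(1)] assms(2,3)]
  by (rule sw_antipode[OF T _ assms(1)]) (assumption | rule rules assms)+

lemma \<tau>_\<tau>_antipode:
  assumes "a \<in> carrier H" "b \<in> carrier H" "x \<in> carrier X" "y \<in> carrier Y"
  shows "\<tau> a (\<tau> (S b) (p x y)) =
    sw T (\<lambda>c d. sw T (\<lambda>a' b'. p (\<rho> a' (\<rho> (S d) x)) (\<sigma> b' (\<sigma> (S c) y))) a) b"
  unfolding \<tau>_antipode[OF assms(2-4)]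
  by (subst \<tau>_of_sw[OF assms(1,2)], (assumption | rule rules assms)+)
    (intro sw_cong assms \<tau>_pure, (assumption | rule rules assms)+)

text \<open>Here and in the next three lemmas the four sides of the two axioms are brought, on pure
  tensors, into one shape: \<open>a\<close> splits into \<open>a'\<close>, \<open>b'\<close> and
  \<open>b\<close> into \<open>c\<close>, \<open>d\<close>; the left factor sees \<open>a'\<close>
  and \<open>S d\<close>, the right one \<open>b'\<close> and \<open>S c\<close>; the sum over the
  other Hopf element is innermost. This is the left-hand side of \<open>sw_coassoc4\<close>.\<close>

lemma expand1:
  assumes "h \<in> carrier H" "l \<in> carrier H" "x \<in> carrier X" "y \<in> carrier Y"
  shows "sw T (\<lambda>a b. \<tau> h (\<tau> a (\<tau> (S b) (p x y)))) l =
    sw T (\<lambda>a b. sw T (\<lambda>c d. sw T (\<lambda>a' b'.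
      sw T (\<lambda>h1 h2. p (\<rho> h1 (\<rho> a' (\<rho> (S d) x))) (\<sigma> h2 (\<sigma> b' (\<sigma> (S c) y)))) h) a) b) l"
proof (intro sw_cong assms)
  fix a b assume ab: "a \<in> carrier H" "b \<in> carrier H"
  have "\<tau> h (\<tau> a (\<tau> (S b) (p x y))) =
      sw T (\<lambda>c d. \<tau> h (sw T (\<lambda>a' b'. p (\<rho> a' (\<rho> (S d) x)) (\<sigma> b' (\<sigma> (S c) y))) a)) b"
    unfolding \<tau>_\<tau>_antipode[OF ab assms(3,4)]
    by (rule \<tau>_of_sw[OF assms(1) ab(2)]) (assumption | rule rules assms ab)+
  also have "\<dots> = sw T (\<lambda>c d. sw T (\<lambda>a' b'. \<tau> h (p (\<rho> a' (\<rho> (S d) x)) (\<sigma> b' (\<sigma> (S c) y)))) a) b"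
    by (intro sw_cong ab \<tau>_of_sw[OF assms(1) ab(1)]) (assumption | rule rules assms ab)+
  also have "\<dots> = sw T (\<lambda>c d. sw T (\<lambda>a' b'.
      sw T (\<lambda>h1 h2. p (\<rho> h1 (\<rho> a' (\<rho> (S d) x))) (\<sigma> h2 (\<sigma> b' (\<sigma> (S c) y)))) h) a) b"
    by (intro sw_cong ab \<tau>_pure assms) (assumption | rule rules assms ab)+
  finally show "\<tau> h (\<tau> a (\<tau> (S b) (p x y))) = \<dots>" .
qed

lemma expand2:
  assumes "h \<in> carrier H" "l \<in> carrier H" "x \<in> carrier X" "y \<in> carrier Y"
  shows "sw T (\<lambda>a b. \<tau> (h \<otimes>\<^bsub>H\<^esub> a) (\<tau> (S b) (p x y))) l =
    sw T (\<lambda>a b. sw T (\<lambda>c d. sw T (\<lambda>a' b'.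
      sw T (\<lambda>h1 h2. p (\<rho> (h1 \<otimes>\<^bsub>H\<^esub> a') (\<rho> (S d) x)) (\<sigma> (h2 \<otimes>\<^bsub>H\<^esub> b') (\<sigma> (S c) y))) h) a) b) l"
proof (intro sw_cong assms)
  fix a b assume ab: "a \<in> carrier H" "b \<in> carrier H"
  have "\<tau> (h \<otimes>\<^bsub>H\<^esub> a) (\<tau> (S b) (p x y)) =
      sw T (\<lambda>c d. \<tau> (h \<otimes>\<^bsub>H\<^esub> a) (p (\<rho> (S d) x) (\<sigma> (S c) y))) b"
    unfolding \<tau>_antipode[OF ab(2) assms(3,4)]
    by (rule \<tau>_of_sw) (assumption | rule rules assms ab)+
  also have "\<dots> = sw T (\<lambda>c d. sw T (\<lambda>h1 h2. sw T (\<lambda>a' b'.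
      p (\<rho> (h1 \<otimes>\<^bsub>H\<^esub> a') (\<rho> (S d) x)) (\<sigma> (h2 \<otimes>\<^bsub>H\<^esub> b') (\<sigma> (S c) y))) a) h) b"
    by (intro sw_cong ab \<tau>_pure_mult assms) (assumption | rule rules assms ab)+
  also have "\<dots> = sw T (\<lambda>c d. sw T (\<lambda>a' b'. sw T (\<lambda>h1 h2.
      p (\<rho> (h1 \<otimes>\<^bsub>H\<^esub> a') (\<rho> (S d) x)) (\<sigma> (h2 \<otimes>\<^bsub>H\<^esub> b') (\<sigma> (S c) y))) h) a) b"
    by (intro sw_cong ab sw_swap T assms) (assumption | rule rules assms ab)+
  finally show "\<tau> (h \<otimes>\<^bsub>H\<^esub> a) (\<tau> (S b) (p x y)) = \<dots>" .
qed

lemma expand3: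
  assumes "h \<in> carrier H" "l \<in> carrier H" "x \<in> carrier X" "y \<in> carrier Y"
  shows "sw T (\<lambda>a b. \<tau> a (\<tau> (S b) (\<tau> l (p x y)))) h =
    sw T (\<lambda>a b. sw T (\<lambda>c d. sw T (\<lambda>a' b'.
      sw T (\<lambda>l1 l2. p (\<rho> a' (\<rho> (S d) (\<rho> l1 x))) (\<sigma> b' (\<sigma> (S c) (\<sigma> l2 y)))) l) a) b) h"
proof (intro sw_cong assms)
  fix a b assume ab: "a \<in> carrier H" "b \<in> carrier H"
  have "\<tau> a (\<tau> (S b) (\<tau> l (p x y))) = sw T (\<lambda>l1 l2. \<tau> a (\<tau> (S b) (p (\<rho> l1 x) (\<sigma> l2 y)))) l"
    unfolding \<tau>_pure[OF assms(2-4)]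
    by (rule linear_sw[OF T T linear_on_comp[OF \<tau>_linear[OF ab(1)] \<tau>_linear[OF antipode_closed[OF ab(2)]]] assms(2)])
      (assumption | rule rules assms)+
  also have "\<dots> = sw T (\<lambda>l1 l2. sw T (\<lambda>c d. sw T (\<lambda>a' b'.
      p (\<rho> a' (\<rho> (S d) (\<rho> l1 x))) (\<sigma> b' (\<sigma> (S c) (\<sigma> l2 y)))) a) b) l"
    by (intro sw_cong ab \<tau>_\<tau>_antipode assms) (assumption | rule rules assms ab)+
  also have "\<dots> = sw T (\<lambda>c d. sw T (\<lambda>l1 l2. sw T (\<lambda>a' b'.
      p (\<rho> a' (\<rho> (S d) (\<rho> l1 x))) (\<sigma> b' (\<sigma> (S c) (\<sigma> l2 y)))) a) l) b"
    by (intro ab sw_swap T assms) (assumption | rule rules assms ab)+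
  also have "\<dots> = sw T (\<lambda>c d. sw T (\<lambda>a' b'. sw T (\<lambda>l1 l2.
      p (\<rho> a' (\<rho> (S d) (\<rho> l1 x))) (\<sigma> b' (\<sigma> (S c) (\<sigma> l2 y)))) l) a) b"
    by (intro sw_cong ab sw_swap T assms) (assumption | rule rules assms ab)+
  finally show "\<tau> a (\<tau> (S b) (\<tau> l (p x y))) = \<dots>" .
qed

lemma expand4:
  assumes "h \<in> carrier H" "l \<in> carrier H" "x \<in> carrier X" "y \<in> carrier Y"
  shows "sw T (\<lambda>a b. \<tau> a (\<tau> (S b \<otimes>\<^bsub>H\<^esub> l) (p x y))) h =
    sw T (\<lambda>a b. sw T (\<lambda>c d. sw T (\<lambda>a' b'.
      sw T (\<lambda>l1 l2. p (\<rho> a' (\<rho> (S d \<otimes>\<^bsub>H\<^esub> l1) x)) (\<sigma> b' (\<sigma> (S c \<otimes>\<^bsub>H\<^esub> l2) y))) l) a) b) h"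
proof (intro sw_cong assms)
  fix a b assume ab: "a \<in> carrier H" "b \<in> carrier H"
  have "\<tau> (S b \<otimes>\<^bsub>H\<^esub> l) (p x y) =
      sw T (\<lambda>c d. sw T (\<lambda>l1 l2. p (\<rho> (S d \<otimes>\<^bsub>H\<^esub> l1) x) (\<sigma> (S c \<otimes>\<^bsub>H\<^esub> l2) y)) l) b"
    \<comment> \<open>The function \<open>f\<close> is given explicitly: it contains the whole inner
      sum over \<open>l\<close>, as a bilinear function of the two legs of
      \<open>S b\<close>.\<close>
    unfolding \<tau>_pure_mult[OF antipode_closed[OF ab(2)] assms(2-4)]
    by (rule sw_antipode[OF T _ ab(2), where f = "\<lambda>u v. sw T (\<lambda>l1 l2.
          p (\<rho> (u \<otimes>\<^bsub>H\<^esub> l1) x) (\<sigma> (v \<otimes>\<^bsub>H\<^esub> l2) y)) l"]) (assumption | rule rules assms ab)+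
  then have "\<tau> a (\<tau> (S b \<otimes>\<^bsub>H\<^esub> l) (p x y)) = \<tau> a (sw T (\<lambda>c d. sw T (\<lambda>l1 l2.
      p (\<rho> (S d \<otimes>\<^bsub>H\<^esub> l1) x) (\<sigma> (S c \<otimes>\<^bsub>H\<^esub> l2) y)) l) b)"
    by (rule arg_cong)
  also have "\<dots> =
      sw T (\<lambda>c d. \<tau> a (sw T (\<lambda>l1 l2. p (\<rho> (S d \<otimes>\<^bsub>H\<^esub> l1) x) (\<sigma> (S c \<otimes>\<^bsub>H\<^esub> l2) y)) l)) b"
    by (rule \<tau>_of_sw) (assumption | rule rules assms ab)+
  also have "\<dots> = sw T (\<lambda>c d. sw T (\<lambda>l1 l2. \<tau> a (p (\<rho> (S d \<otimes>\<^bsub>H\<^esub> l1) x) (\<sigma> (S c \<otimes>\<^bsub>H\<^esub> l2) y))) l) b"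
    by (intro sw_cong ab \<tau>_of_sw assms) (assumption | rule rules assms ab)+
  also have "\<dots> = sw T (\<lambda>c d. sw T (\<lambda>l1 l2. sw T (\<lambda>a' b'.
      p (\<rho> a' (\<rho> (S d \<otimes>\<^bsub>H\<^esub> l1) x)) (\<sigma> b' (\<sigma> (S c \<otimes>\<^bsub>H\<^esub> l2) y))) a) l) b"
    by (intro sw_cong ab \<tau>_pure assms) (assumption | rule rules assms ab)+
  also have "\<dots> = sw T (\<lambda>c d. sw T (\<lambda>a' b'. sw T (\<lambda>l1 l2.
      p (\<rho> a' (\<rho> (S d \<otimes>\<^bsub>H\<^esub> l1) x)) (\<sigma> b' (\<sigma> (S c \<otimes>\<^bsub>H\<^esub> l2) y))) l) a) b"
    by (intro sw_cong ab sw_swap T assms) (assumption | rule rules assms ab)+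
  finally show "\<tau> a (\<tau> (S b \<otimes>\<^bsub>H\<^esub> l) (p x y)) = \<dots>" .
qed

end

section \<open>Partial representations on tensor products\<close>

context hopf_algebra
begin

text \<open>The two middle legs are bracketed as the coproduct of a single \<open>w\<close>; they
  collapse to the counit of \<open>w\<close>, which the counit law absorbs, so that only the outer
  legs remain.\<close>

lemma sw_coassoc4_counit:
  assumes B: "module K B" and h: "h \<in> carrier H"
    and J: "\<And>b c d. b \<in> carrier H \<Longrightarrow> c \<in> carrier H \<Longrightarrow> d \<in> carrier H \<Longrightarrow> linear_on K H B (\<lambda>a. J a b c d)"
      "\<And>a c d. a \<in> carrier H \<Longrightarrow> c \<in> carrier H \<Longrightarrow> d \<in> carrier H \<Longrightarrow> linear_on K H B (\<lambda>b. J a b c d)"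
      "\<And>a b d. a \<in> carrier H \<Longrightarrow> b \<in> carrier H \<Longrightarrow> d \<in> carrier H \<Longrightarrow> linear_on K H B (\<lambda>c. J a b c d)"
      "\<And>a b c. a \<in> carrier H \<Longrightarrow> b \<in> carrier H \<Longrightarrow> c \<in> carrier H \<Longrightarrow> linear_on K H B (\<lambda>d. J a b c d)"
    and N: "\<And>a. a \<in> carrier H \<Longrightarrow> linear_on K H B (\<lambda>d. N a d)"
    and inner: "\<And>a d w. a \<in> carrier H \<Longrightarrow> d \<in> carrier H \<Longrightarrow> w \<in> carrier H \<Longrightarrow>
      sw B (\<lambda>b c. J a b c d) w = counit H w \<odot>\<^bsub>B\<^esub> N a d"
  shows "sw B (\<lambda>a b. sw B (\<lambda>c d. sw B (\<lambda>a' b'. J a' b' c d) a) b) h = sw B N h"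
proof -
  have "sw B (\<lambda>a b. sw B (\<lambda>c d. sw B (\<lambda>a' b'. J a' b' c d) a) b) h =
      sw B (\<lambda>a d. sw B (\<lambda>w d. sw B (\<lambda>b c. J a b c d) w) d) h"
    by (rule sw_coassoc4[OF B h J])
  also have "\<dots> = sw B (\<lambda>a d. sw B (\<lambda>w d. counit H w \<odot>\<^bsub>B\<^esub> N a d) d) h"
    by (intro sw_cong h inner)
  also have "\<dots> = sw B N h"
    by (intro sw_cong h sw_counit_left B N)
  finally show ?thesis .
qed

end

context rep_pair
begin

text \<open>Collects the sum over the legs of \<open>w\<close> inside the right entry, so that an
  identity in \<open>Y\<close> alone can be applied to it. The sums are exchanged, and a pure tensor
  is linear in that entry.\<close>

lemma sw_pure_right:
  assumes "h \<in> carrier H" "w \<in> carrier H"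
    and "\<And>a. a \<in> carrier H \<Longrightarrow> F a \<in> carrier X"
    and "\<And>a b c. a \<in> carrier H \<Longrightarrow> b \<in> carrier H \<Longrightarrow> c \<in> carrier H \<Longrightarrow> g a b c \<in> carrier Y"
  shows "sw T (\<lambda>b c. sw T (\<lambda>h1 h2. p (F h1) (g h2 b c)) h) w =
    sw T (\<lambda>h1 h2. p (F h1) (sw Y (\<lambda>b c. g h2 b c) w)) h"
proof -
  have "sw T (\<lambda>b c. sw T (\<lambda>h1 h2. p (F h1) (g h2 b c)) h) w =
      sw T (\<lambda>h1 h2. sw T (\<lambda>b c. p (F h1) (g h2 b c)) w) h"
    by (intro sw_swap T pure_closed assms)
  also have "\<dots> = sw T (\<lambda>h1 h2. p (F h1) (sw Y (\<lambda>b c. g h2 b c) w)) h"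
    by (intro sw_cong assms linear_sw[OF Y T, symmetric] linear_on_pure2 X Y linear_on_id)
  finally show ?thesis .
qed

lemma sw_pure_left:
  assumes "h \<in> carrier H" "w \<in> carrier H"
    and "\<And>a. a \<in> carrier H \<Longrightarrow> F a \<in> carrier Y"
    and "\<And>a b c. a \<in> carrier H \<Longrightarrow> b \<in> carrier H \<Longrightarrow> c \<in> carrier H \<Longrightarrow> g a b c \<in> carrier X"
  shows "sw T (\<lambda>b c. sw T (\<lambda>h1 h2. p (g h1 b c) (F h2)) h) w =
    sw T (\<lambda>h1 h2. p (sw X (\<lambda>b c. g h1 b c) w) (F h2)) h"
proof -
  have "sw T (\<lambda>b c. sw T (\<lambda>h1 h2. p (g h1 b c) (F h2)) h) w =
      sw T (\<lambda>h1 h2. sw T (\<lambda>b c. p (g h1 b c) (F h2)) w) h"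
    by (intro sw_swap T pure_closed assms)
  also have "\<dots> = sw T (\<lambda>h1 h2. p (sw X (\<lambda>b c. g h1 b c) w) (F h2)) h"
    by (intro sw_cong assms linear_sw[OF X T, symmetric] linear_on_pure1 X Y linear_on_id)
  finally show ?thesis .
qed

text \<open>The case in which the collected sum is a scalar multiple of a simpler vector; it is
  applied with the counit of \<open>w\<close> as \<open>e\<close>.\<close>

lemma sw_pure_right_smult:
  assumes "h \<in> carrier H" "w \<in> carrier H" "e \<in> carrier K"
    and "\<And>a. a \<in> carrier H \<Longrightarrow> F a \<in> carrier X" "\<And>a. a \<in> carrier H \<Longrightarrow> E a \<in> carrier Y"
    and "\<And>a b c. a \<in> carrier H \<Longrightarrow> b \<in> carrier H \<Longrightarrow> c \<in> carrier H \<Longrightarrow> g a b c \<in> carrier Y"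
    and "\<And>a. a \<in> carrier H \<Longrightarrow> sw Y (\<lambda>b c. g a b c) w = e \<odot>\<^bsub>Y\<^esub> E a"
  shows "sw T (\<lambda>b c. sw T (\<lambda>h1 h2. p (F h1) (g h2 b c)) h) w =
    e \<odot>\<^bsub>T\<^esub> sw T (\<lambda>h1 h2. p (F h1) (E h2)) h"
proof -
  have "sw T (\<lambda>b c. sw T (\<lambda>h1 h2. p (F h1) (g h2 b c)) h) w =
      sw T (\<lambda>h1 h2. p (F h1) (sw Y (\<lambda>b c. g h2 b c) w)) h"
    by (rule sw_pure_right[OF assms(1,2,4,6)])
  also have "\<dots> = sw T (\<lambda>h1 h2. e \<odot>\<^bsub>T\<^esub> p (F h1) (E h2)) h"
    by (intro sw_cong assms(1)) (simp add: assms pure_scalar[OF X Y])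
  also have "\<dots> = e \<odot>\<^bsub>T\<^esub> sw T (\<lambda>h1 h2. p (F h1) (E h2)) h"
    by (intro linear_sw[OF T T, symmetric] linear_on_smult T linear_on_id pure_closed assms)
  finally show ?thesis .
qed

lemma \<tau>_partially_multiplicativeI:
  assumes "\<And>h l x y. h \<in> carrier H \<Longrightarrow> l \<in> carrier H \<Longrightarrow> x \<in> carrier X \<Longrightarrow> y \<in> carrier Y \<Longrightarrow>
      sw T (\<lambda>a b. \<tau> h (\<tau> a (\<tau> (S b) (p x y)))) l = sw T (\<lambda>a b. \<tau> (h \<otimes>\<^bsub>H\<^esub> a) (\<tau> (S b) (p x y))) l"
    and "\<And>h l x y. h \<in> carrier H \<Longrightarrow> l \<in> carrier H \<Longrightarrow> x \<in> carrier X \<Longrightarrow> y \<in> carrier Y \<Longrightarrow>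
      sw T (\<lambda>a b. \<tau> a (\<tau> (S b) (\<tau> l (p x y)))) h = sw T (\<lambda>a b. \<tau> a (\<tau> (S b \<otimes>\<^bsub>H\<^esub> l) (p x y))) h"
  shows "partially_multiplicative T \<tau>"
  unfolding partially_multiplicative_def
proof (intro ballI conjI)
  note r = T linear_on_id linear_on_sw_fun bilinear_on_comp2[OF \<tau>_bilinear] mult_closed antipode_closed
  fix h l t assume hl: "h \<in> carrier H" "l \<in> carrier H" and t: "t \<in> carrier T"
  show "sw T (\<lambda>a b. \<tau> h (\<tau> a (\<tau> (S b) t))) l = sw T (\<lambda>a b. \<tau> (h \<otimes>\<^bsub>H\<^esub> a) (\<tau> (S b) t)) l"
    by (rule tensor_ext[OF X Y T _ _ _ t, where F = "\<lambda>t. sw T (\<lambda>a b. \<tau> h (\<tau> a (\<tau> (S b) t))) l"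
          and G = "\<lambda>t. sw T (\<lambda>a b. \<tau> (h \<otimes>\<^bsub>H\<^esub> a) (\<tau> (S b) t)) l"])
      (assumption | rule assms(1) r hl)+
  show "sw T (\<lambda>a b. \<tau> a (\<tau> (S b) (\<tau> l t))) h = sw T (\<lambda>a b. \<tau> a (\<tau> (S b \<otimes>\<^bsub>H\<^esub> l) t)) h"
    by (rule tensor_ext[OF X Y T _ _ _ t, where F = "\<lambda>t. sw T (\<lambda>a b. \<tau> a (\<tau> (S b) (\<tau> l t))) h"
          and G = "\<lambda>t. sw T (\<lambda>a b. \<tau> a (\<tau> (S b \<otimes>\<^bsub>H\<^esub> l) t)) h"])
      (assumption | rule assms(2) r hl)+
qed

text \<open>In the sum over \<open>l\<^sub>(\<^sub>1\<^sub>) \<otimes> l\<^sub>(\<^sub>2\<^sub>) \<otimes> l\<^sub>(\<^sub>3\<^sub>) \<otimes> l\<^sub>(\<^sub>4\<^sub>)\<close> produced by \<open>\<Delta> \<circ> S\<close>, the right tensor factor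
  only sees the two adjacent inner legs, so the axioms of \<open>\<sigma>\<close> apply to it.\<close>

lemma \<tau>_partial_right:
  assumes \<rho>m: "multiplicative X \<rho>" and \<sigma>m: "partially_multiplicative Y \<sigma>"
  shows "partially_multiplicative T \<tau>"
proof (rule \<tau>_partially_multiplicativeI)
  fix h l x y assume H: "h \<in> carrier H" "l \<in> carrier H" and xy: "x \<in> carrier X" "y \<in> carrier Y"
  let ?J1 = "\<lambda>a b c d. sw T (\<lambda>h1 h2. p (\<rho> h1 (\<rho> a (\<rho> (S d) x))) (\<sigma> h2 (\<sigma> b (\<sigma> (S c) y)))) h"
  let ?J2 = "\<lambda>a b c d. sw T (\<lambda>h1 h2. p (\<rho> (h1 \<otimes>\<^bsub>H\<^esub> a) (\<rho> (S d) x)) (\<sigma> (h2 \<otimes>\<^bsub>H\<^esub> b) (\<sigma> (S c) y))) h"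
  let ?J3 = "\<lambda>a b c d. sw T (\<lambda>l1 l2. p (\<rho> a (\<rho> (S d) (\<rho> l1 x))) (\<sigma> b (\<sigma> (S c) (\<sigma> l2 y)))) l"
  let ?J4 = "\<lambda>a b c d. sw T (\<lambda>l1 l2. p (\<rho> a (\<rho> (S d \<otimes>\<^bsub>H\<^esub> l1) x)) (\<sigma> b (\<sigma> (S c \<otimes>\<^bsub>H\<^esub> l2) y))) l"
  note cl = bilinear_onD(3)[OF \<rho>] bilinear_onD(3)[OF \<sigma>] antipode_closed mult_closed
  have "sw T (\<lambda>a b. \<tau> h (\<tau> a (\<tau> (S b) (p x y)))) l =
      sw T (\<lambda>a d. sw T (\<lambda>w d. sw T (\<lambda>b c. ?J1 a b c d) w) d) l"
    unfolding expand1[OF H xy]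
    by (rule sw_coassoc4[OF T H(2)]) (assumption | rule rules H xy)+
  also have "\<dots> = sw T (\<lambda>a d. sw T (\<lambda>w d. sw T (\<lambda>b c. ?J2 a b c d) w) d) l"
  proof (rule sw_cong[OF H(2)], rule sw_cong)
    fix a d' w d assume ad: "a \<in> carrier H" "d' \<in> carrier H" "w \<in> carrier H" "d \<in> carrier H"
    have "sw T (\<lambda>b c. ?J1 a b c d) w = sw T (\<lambda>h1 h2. p (\<rho> h1 (\<rho> a (\<rho> (S d) x)))
        (sw Y (\<lambda>b c. \<sigma> h2 (\<sigma> b (\<sigma> (S c) y))) w)) h"
      by (rule sw_pure_right[OF H(1) ad(3)]) (assumption | rule cl ad H xy)+
    \<comment> \<open>Both entries change at once: the left one by multiplicativity of
      \<open>\<rho>\<close>, the right one by the first axiom of \<open>\<sigma>\<close>, applied to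
      \<open>h2\<close> and the legs of \<open>w\<close>.\<close>
    also have "\<dots> = sw T (\<lambda>h1 h2. p (\<rho> (h1 \<otimes>\<^bsub>H\<^esub> a) (\<rho> (S d) x))
        (sw Y (\<lambda>b c. \<sigma> (h2 \<otimes>\<^bsub>H\<^esub> b) (\<sigma> (S c) y)) w)) h"
      using \<rho>m \<sigma>m ad xy
      by (intro sw_cong H) (simp add: multiplicative_def partially_multiplicative_def cl)
    also have "\<dots> = sw T (\<lambda>b c. ?J2 a b c d) w"
      by (rule sw_pure_right[OF H(1) ad(3), symmetric]) (assumption | rule cl ad H xy)+
    finally show "sw T (\<lambda>b c. ?J1 a b c d) w = sw T (\<lambda>b c. ?J2 a b c d) w" .
  qed
  also have "\<dots> = sw T (\<lambda>a b. \<tau> (h \<otimes>\<^bsub>H\<^esub> a) (\<tau> (S b) (p x y))) l"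
    unfolding expand2[OF H xy]
    by (rule sw_coassoc4[OF T H(2), symmetric]) (assumption | rule rules H xy)+
  finally show "sw T (\<lambda>a b. \<tau> h (\<tau> a (\<tau> (S b) (p x y)))) l =
      sw T (\<lambda>a b. \<tau> (h \<otimes>\<^bsub>H\<^esub> a) (\<tau> (S b) (p x y))) l" .
  have "sw T (\<lambda>a b. \<tau> a (\<tau> (S b) (\<tau> l (p x y)))) h =
      sw T (\<lambda>a d. sw T (\<lambda>w d. sw T (\<lambda>b c. ?J3 a b c d) w) d) h"
    unfolding expand3[OF H xy]
    by (rule sw_coassoc4[OF T H(1)]) (assumption | rule rules H xy)+
  also have "\<dots> = sw T (\<lambda>a d. sw T (\<lambda>w d. sw T (\<lambda>b c. ?J4 a b c d) w) d) h"
  proof (rule sw_cong[OF H(1)], rule sw_cong)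
    fix a d' w d assume ad: "a \<in> carrier H" "d' \<in> carrier H" "w \<in> carrier H" "d \<in> carrier H"
    have "sw T (\<lambda>b c. ?J3 a b c d) w = sw T (\<lambda>l1 l2. p (\<rho> a (\<rho> (S d) (\<rho> l1 x)))
        (sw Y (\<lambda>b c. \<sigma> b (\<sigma> (S c) (\<sigma> l2 y))) w)) l"
      by (rule sw_pure_right[OF H(2) ad(3)]) (assumption | rule cl ad H xy)+
    also have "\<dots> = sw T (\<lambda>l1 l2. p (\<rho> a (\<rho> (S d \<otimes>\<^bsub>H\<^esub> l1) x))
        (sw Y (\<lambda>b c. \<sigma> b (\<sigma> (S c \<otimes>\<^bsub>H\<^esub> l2) y)) w)) l"
      using \<rho>m \<sigma>m ad xy
      by (intro sw_cong H) (simp add: multiplicative_def partially_multiplicative_def cl)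
    also have "\<dots> = sw T (\<lambda>b c. ?J4 a b c d) w"
      by (rule sw_pure_right[OF H(2) ad(3), symmetric]) (assumption | rule cl ad H xy)+
    finally show "sw T (\<lambda>b c. ?J3 a b c d) w = sw T (\<lambda>b c. ?J4 a b c d) w" .
  qed
  also have "\<dots> = sw T (\<lambda>a b. \<tau> a (\<tau> (S b \<otimes>\<^bsub>H\<^esub> l) (p x y))) h"
    unfolding expand4[OF H xy]
    by (rule sw_coassoc4[OF T H(1), symmetric]) (assumption | rule rules H xy)+
  finally show "sw T (\<lambda>a b. \<tau> a (\<tau> (S b) (\<tau> l (p x y)))) h =
      sw T (\<lambda>a b. \<tau> a (\<tau> (S b \<otimes>\<^bsub>H\<^esub> l) (p x y))) h" .
qed

text \<open>Here the two inner legs act globally and cancel, which leaves the axioms of \<open>\<rho>\<close> for the outer legs.\<close>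

lemma \<tau>_partial_left:
  assumes \<rho>m: "partially_multiplicative X \<rho>" and \<sigma>m: "multiplicative Y \<sigma>" and \<sigma>1: "unital Y \<sigma>"
  shows "partially_multiplicative T \<tau>"
proof (rule \<tau>_partially_multiplicativeI)
  fix h l x y assume H: "h \<in> carrier H" "l \<in> carrier H" and xy: "x \<in> carrier X" "y \<in> carrier Y"
  note cl = bilinear_onD(3)[OF \<rho>] bilinear_onD(3)[OF \<sigma>] antipode_closed mult_closed
  \<comment> \<open>The products of \<open>b\<close> with \<open>S c\<close> over the legs of
    \<open>w\<close> add up to the counit of \<open>w\<close> times the unit, which acts as the
    identity. The outer operator \<open>\<sigma> g\<close> is carried along for the first axiom;
    \<open>cancel0\<close> takes \<open>g\<close> to be the unit.\<close>
  have cancel: "sw Y (\<lambda>b c. \<sigma> g (\<sigma> (b \<otimes>\<^bsub>H\<^esub> S c) v)) w = counit H w \<odot>\<^bsub>Y\<^esub> \<sigma> g v"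
    if "g \<in> carrier H" "w \<in> carrier H" "v \<in> carrier Y" for g w v
  proof -
    have "linear_on K H Y (\<lambda>u. \<sigma> g (\<sigma> u v))" by (assumption | rule rules that)+
    from sw_antipode_right[OF Y this that(2)] show ?thesis
      using \<sigma>1 that(3) by (simp add: unital_def)
  qed
  have \<sigma>: "\<sigma> (g \<otimes>\<^bsub>H\<^esub> b) v = \<sigma> g (\<sigma> b v)" if "g \<in> carrier H" "b \<in> carrier H" "v \<in> carrier Y" for g b v
    using \<sigma>m that by (simp add: multiplicative_def)
  have cancel1: "sw Y (\<lambda>b c. \<sigma> g (\<sigma> b (\<sigma> (S c) v))) w = counit H w \<odot>\<^bsub>Y\<^esub> \<sigma> g v"
    if "g \<in> carrier H" "w \<in> carrier H" "v \<in> carrier Y" for g w v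
    using cancel[OF that] that by (simp add: \<sigma> cl cong: sw_cong)
  have cancel0: "sw Y (\<lambda>b c. \<sigma> b (\<sigma> (S c) v)) w = counit H w \<odot>\<^bsub>Y\<^esub> v"
    if "w \<in> carrier H" "v \<in> carrier Y" for w v
    using cancel1[OF one_closed that] \<sigma>1 that by (simp add: cl unital_def cong: sw_cong)
  let ?J1 = "\<lambda>a b c d. sw T (\<lambda>h1 h2. p (\<rho> h1 (\<rho> a (\<rho> (S d) x))) (\<sigma> h2 (\<sigma> b (\<sigma> (S c) y)))) h"
  let ?J2 = "\<lambda>a b c d. sw T (\<lambda>h1 h2. p (\<rho> (h1 \<otimes>\<^bsub>H\<^esub> a) (\<rho> (S d) x)) (\<sigma> (h2 \<otimes>\<^bsub>H\<^esub> b) (\<sigma> (S c) y))) h"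
  let ?J3 = "\<lambda>a b c d. sw T (\<lambda>l1 l2. p (\<rho> a (\<rho> (S d) (\<rho> l1 x))) (\<sigma> b (\<sigma> (S c) (\<sigma> l2 y)))) l"
  let ?J4 = "\<lambda>a b c d. sw T (\<lambda>l1 l2. p (\<rho> a (\<rho> (S d \<otimes>\<^bsub>H\<^esub> l1) x)) (\<sigma> b (\<sigma> (S c \<otimes>\<^bsub>H\<^esub> l2) y))) l"
  let ?N1 = "\<lambda>a d. sw T (\<lambda>h1 h2. p (\<rho> h1 (\<rho> a (\<rho> (S d) x))) (\<sigma> h2 y)) h"
  let ?N2 = "\<lambda>a d. sw T (\<lambda>h1 h2. p (\<rho> (h1 \<otimes>\<^bsub>H\<^esub> a) (\<rho> (S d) x)) (\<sigma> h2 y)) h"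
  let ?N3 = "\<lambda>a d. sw T (\<lambda>l1 l2. p (\<rho> a (\<rho> (S d) (\<rho> l1 x))) (\<sigma> l2 y)) l"
  let ?N4 = "\<lambda>a d. sw T (\<lambda>l1 l2. p (\<rho> a (\<rho> (S d \<otimes>\<^bsub>H\<^esub> l1) x)) (\<sigma> l2 y)) l"
  have i1: "sw T (\<lambda>b c. ?J1 a b c d) w = counit H w \<odot>\<^bsub>T\<^esub> ?N1 a d"
    if "a \<in> carrier H" "d \<in> carrier H" "w \<in> carrier H" for a d w
    by (rule sw_pure_right_smult[OF H(1)]) (assumption | rule cl that H xy counit_closed cancel1)+
  have i2: "sw T (\<lambda>b c. ?J2 a b c d) w = counit H w \<odot>\<^bsub>T\<^esub> ?N2 a d"
    if "a \<in> carrier H" "d \<in> carrier H" "w \<in> carrier H" for a d w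
  proof (rule sw_pure_right_smult[OF H(1)])
    show "sw Y (\<lambda>b c. \<sigma> (g \<otimes>\<^bsub>H\<^esub> b) (\<sigma> (S c) y)) w = counit H w \<odot>\<^bsub>Y\<^esub> \<sigma> g y" if "g \<in> carrier H" for g
      using cancel1[OF \<open>g \<in> carrier H\<close> \<open>w \<in> carrier H\<close> xy(2)] that \<open>w \<in> carrier H\<close> xy
      by (simp add: \<sigma> cl cong: sw_cong)
  qed (assumption | rule cl that H xy counit_closed)+
  have i3: "sw T (\<lambda>b c. ?J3 a b c d) w = counit H w \<odot>\<^bsub>T\<^esub> ?N3 a d"
    if "a \<in> carrier H" "d \<in> carrier H" "w \<in> carrier H" for a d w
    by (rule sw_pure_right_smult[OF H(2)]) (assumption | rule cl that H xy counit_closed cancel0)+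
  have i4: "sw T (\<lambda>b c. ?J4 a b c d) w = counit H w \<odot>\<^bsub>T\<^esub> ?N4 a d"
    if "a \<in> carrier H" "d \<in> carrier H" "w \<in> carrier H" for a d w
  proof (rule sw_pure_right_smult[OF H(2)])
    show "sw Y (\<lambda>b c. \<sigma> b (\<sigma> (S c \<otimes>\<^bsub>H\<^esub> g) y)) w = counit H w \<odot>\<^bsub>Y\<^esub> \<sigma> g y" if "g \<in> carrier H" for g
      using cancel0[OF \<open>w \<in> carrier H\<close>, of "\<sigma> g y"] that \<open>w \<in> carrier H\<close> xy
      by (simp add: \<sigma> cl cong: sw_cong)
  qed (assumption | rule cl that H xy counit_closed)+
  have "sw T (\<lambda>a b. \<tau> h (\<tau> a (\<tau> (S b) (p x y)))) l = sw T ?N1 l"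
    unfolding expand1[OF H xy]
    by (rule sw_coassoc4_counit[OF T H(2) _ _ _ _ _ i1]) (assumption | rule rules H xy)+
  \<comment> \<open>Only the outer legs \<open>a\<close> and \<open>d\<close> of \<open>l\<close>
    are left. They act on the left factor alone, so their sum is moved there, where the first axiom
    of \<open>\<rho>\<close> applies.\<close>
  also have "\<dots> = sw T (\<lambda>h1 h2. p (sw X (\<lambda>a d. \<rho> h1 (\<rho> a (\<rho> (S d) x))) l) (\<sigma> h2 y)) h"
    by (rule sw_pure_left[OF H]) (assumption | rule cl H xy)+
  also have "\<dots> = sw T (\<lambda>h1 h2. p (sw X (\<lambda>a d. \<rho> (h1 \<otimes>\<^bsub>H\<^esub> a) (\<rho> (S d) x)) l) (\<sigma> h2 y)) h"
    using \<rho>m H xy by (intro sw_cong H) (simp add: partially_multiplicative_def)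
  also have "\<dots> = sw T ?N2 l"
    by (rule sw_pure_left[OF H, symmetric]) (assumption | rule cl H xy)+
  also have "\<dots> = sw T (\<lambda>a b. \<tau> (h \<otimes>\<^bsub>H\<^esub> a) (\<tau> (S b) (p x y))) l"
    unfolding expand2[OF H xy]
    by (rule sw_coassoc4_counit[OF T H(2) _ _ _ _ _ i2, symmetric]) (assumption | rule rules H xy)+
  finally show "sw T (\<lambda>a b. \<tau> h (\<tau> a (\<tau> (S b) (p x y)))) l =
      sw T (\<lambda>a b. \<tau> (h \<otimes>\<^bsub>H\<^esub> a) (\<tau> (S b) (p x y))) l" .
  have "sw T (\<lambda>a b. \<tau> a (\<tau> (S b) (\<tau> l (p x y)))) h = sw T ?N3 h"
    unfolding expand3[OF H xy]
    by (rule sw_coassoc4_counit[OF T H(1) _ _ _ _ _ i3]) (assumption | rule rules H xy)+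
  also have "\<dots> = sw T (\<lambda>l1 l2. p (sw X (\<lambda>a d. \<rho> a (\<rho> (S d) (\<rho> l1 x))) h) (\<sigma> l2 y)) l"
    by (rule sw_pure_left[OF H(2,1)]) (assumption | rule cl H xy)+
  also have "\<dots> = sw T (\<lambda>l1 l2. p (sw X (\<lambda>a d. \<rho> a (\<rho> (S d \<otimes>\<^bsub>H\<^esub> l1) x)) h) (\<sigma> l2 y)) l"
    using \<rho>m H xy by (intro sw_cong H) (simp add: partially_multiplicative_def)
  also have "\<dots> = sw T ?N4 h"
    by (rule sw_pure_left[OF H(2,1), symmetric]) (assumption | rule cl H xy)+
  also have "\<dots> = sw T (\<lambda>a b. \<tau> a (\<tau> (S b \<otimes>\<^bsub>H\<^esub> l) (p x y))) h"
    unfolding expand4[OF H xy]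
    by (rule sw_coassoc4_counit[OF T H(1) _ _ _ _ _ i4, symmetric]) (assumption | rule rules H xy)+
  finally show "sw T (\<lambda>a b. \<tau> a (\<tau> (S b) (\<tau> l (p x y)))) h =
      sw T (\<lambda>a b. \<tau> a (\<tau> (S b \<otimes>\<^bsub>H\<^esub> l) (p x y))) h" .
qed

end

section \<open>Equivariance of the structure maps\<close>

context hopf_algebra
begin

lemma rep_homI:
  assumes "f \<in> lin K M N"
    and "\<And>h x. h \<in> carrier H \<Longrightarrow> x \<in> carrier M \<Longrightarrow> f (\<pi> h x) = \<sigma> h (f x)"
  shows "f \<in> rep_hom K H (M, \<pi>) (N, \<sigma>)"
  using assms by (simp add: rep_hom_def)

lemma rep_homD:
  assumes "f \<in> rep_hom K H (M, \<pi>) (N, \<sigma>)"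
  shows "f \<in> lin K M N"
    and "\<And>h x. h \<in> carrier H \<Longrightarrow> x \<in> carrier M \<Longrightarrow> f (\<pi> h x) = \<sigma> h (f x)"
  using assms by (simp_all add: rep_hom_def)

lemma linear_reps_action:
  assumes "(M, \<pi>) \<in> linear_reps"
  shows "module K M" "bilinear_on K H M M \<pi>"
  using assms lin_End_iff[OF module] by (auto simp: linear_reps_def)

lemma rep_hom_spansI:
  assumes f: "f \<in> lin K M N" and M: "(M, \<pi>) \<in> linear_reps" and N: "(N, \<sigma>) \<in> linear_reps"
    and A: "spans K M A" and eq: "\<And>h x. h \<in> carrier H \<Longrightarrow> x \<in> A \<Longrightarrow> f (\<pi> h x) = \<sigma> h (f x)"
  shows "f \<in> rep_hom K H (M, \<pi>) (N, \<sigma>)"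
proof (rule rep_homI[OF f])
  fix h x assume h: "h \<in> carrier H" and x: "x \<in> carrier M"
  note M' = linear_reps_action[OF M] and N' = linear_reps_action[OF N]
  show "f (\<pi> h x) = \<sigma> h (f x)"
    by (rule linear_on_eq[OF A M'(1) N'(1)
          linear_on_comp[OF lin_linear[OF f] bilinear_onD(2)[OF M'(2) h]]
          linear_on_comp[OF bilinear_onD(2)[OF N'(2) h] lin_linear[OF f]] eq[OF h] x])
qed

text \<open>Equivariance of \<open>f\<close> at \<open>g y\<close> becomes equivariance of
  \<open>g\<close> once \<open>g\<close> is applied to it. This spares separate Sweedler
  computations for the inverse constraints.\<close>

lemma rep_hom_inverse:
  assumes f: "f \<in> rep_hom K H (M, \<pi>) (N, \<sigma>)" and g: "g \<in> lin K N M" and M: "(M, \<pi>) \<in> linear_reps"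
    and gf: "compose (carrier M) g f = (\<lambda>x\<in>carrier M. x)"
    and fg: "compose (carrier N) f g = (\<lambda>y\<in>carrier N. y)"
  shows "g \<in> rep_hom K H (N, \<sigma>) (M, \<pi>)"
proof (rule rep_homI[OF g])
  fix h y assume h: "h \<in> carrier H" and y: "y \<in> carrier N"
  have gy: "g y \<in> carrier M" using lin_closed[OF g y] .
  then have "\<pi> h (g y) \<in> carrier M" using bilinear_onD(3)[OF linear_reps_action(2)[OF M] h] by simp
  then have "g (f (\<pi> h (g y))) = \<pi> h (g y)" using fun_cong[OF gf, of "\<pi> h (g y)"] by (simp add: compose_eq)
  moreover have "f (g y) = y" using fun_cong[OF fg, of y] y by (simp add: compose_eq)
  ultimately show "g (\<sigma> h y) = \<pi> h (g y)" using rep_homD(2)[OF f h gy] by simp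
qed

lemma rep_pairI: "A \<in> linear_reps \<Longrightarrow> B \<in> linear_reps \<Longrightarrow> rep_pair K H (fst A) (snd A) (fst B) (snd B)"
  by unfold_locales auto

lemma tensor_rep_closed:
  assumes "A \<in> linear_reps" "B \<in> linear_reps"
  shows "tensor_rep K H A B \<in> linear_reps"
proof -
  interpret rep_pair K H "fst A" "snd A" "fst B" "snd B" by (rule rep_pairI[OF assms])
  show ?thesis using \<tau>_rep tensor_rep_eq by simp
qed

lemma fst_tensor_rep: "fst (tensor_rep K H A B) = tensor K (fst A) (fst B)"
  by (simp add: tensor_rep_def split: prod.split)

lemma tmap_rep_hom:
  assumes AB: "(X, \<rho>) \<in> linear_reps" "(Y, \<sigma>) \<in> linear_reps" "(X', \<rho>') \<in> linear_reps" "(Y', \<sigma>') \<in> linear_reps"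
    and f: "f \<in> rep_hom K H (X, \<rho>) (X', \<rho>')" and g: "g \<in> rep_hom K H (Y, \<sigma>) (Y', \<sigma>')"
  shows "tmap K X Y X' Y' f g \<in>
    rep_hom K H (tensor_rep K H (X, \<rho>) (Y, \<sigma>)) (tensor_rep K H (X', \<rho>') (Y', \<sigma>'))"
proof -
  interpret D: rep_pair K H X \<rho> Y \<sigma> using AB by unfold_locales auto
  interpret E: rep_pair K H X' \<rho>' Y' \<sigma>' using AB by unfold_locales auto
  note fl = rep_homD(1)[OF f] and gl = rep_homD(1)[OF g]
  note tl = tmap_lin[OF fl gl D.X D.Y E.X E.Y] and tp = tmap_pure[OF fl gl D.X D.Y E.X E.Y]
  show ?thesis
    unfolding D.tensor_rep_eq E.tensor_rep_eq
  proof (rule rep_hom_spansI[OF tl D.\<tau>_rep E.\<tau>_rep spans_pures[OF D.X D.Y spans_carrier spans_carrier]])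
    fix h t assume h: "h \<in> carrier H" and "t \<in> pures K X Y (carrier X) (carrier Y)"
    then obtain x y where t: "t = pure K X Y x y" and xy: "x \<in> carrier X" "y \<in> carrier Y"
      by (auto simp: pures_def)
    have "tmap K X Y X' Y' f g (D.\<tau> h t) =
        sw (tensor K X' Y') (\<lambda>a b. tmap K X Y X' Y' f g (pure K X Y (\<rho> a x) (\<sigma> b y))) h"
      unfolding t D.\<tau>_pure[OF h xy]
      by (rule linear_sw[OF D.T E.T lin_linear[OF tl] h]) (assumption | rule D.rules xy)+
    also have "\<dots> = sw (tensor K X' Y') (\<lambda>a b. pure K X' Y' (\<rho>' a (f x)) (\<sigma>' b (g y))) h"
      using xy by (intro sw_cong h)
        (simp add: tp rep_homD(2)[OF f] rep_homD(2)[OF g] bilinear_onD(3)[OF D.\<rho>] bilinear_onD(3)[OF D.\<sigma>])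
    also have "\<dots> = E.\<tau> h (tmap K X Y X' Y' f g t)"
      unfolding t tp[OF xy] by (rule E.\<tau>_pure[OF h lin_closed[OF fl xy(1)] lin_closed[OF gl xy(2)], symmetric])
    finally show "tmap K X Y X' Y' f g (D.\<tau> h t) = E.\<tau> h (tmap K X Y X' Y' f g t)" .
  qed
qed

text \<open>This is coassociativity in disguise: on either side three legs of \<open>h\<close> act
  on \<open>x\<close>, \<open>y\<close>, \<open>z\<close>, obtained by splitting the first leg of
  the coproduct in one case and the second in the other.\<close>

lemma assoc_rep_hom:
  assumes R: "(X, \<rho>) \<in> linear_reps" "(Y, \<sigma>) \<in> linear_reps" "(Z, \<theta>) \<in> linear_reps"
  shows "assoc_map K X Y Z \<in> rep_hom K H
    (tensor_rep K H (tensor_rep K H (X, \<rho>) (Y, \<sigma>)) (Z, \<theta>))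
    (tensor_rep K H (X, \<rho>) (tensor_rep K H (Y, \<sigma>) (Z, \<theta>)))"
proof -
  interpret D: rep_pair K H X \<rho> Y \<sigma> using R by unfold_locales auto
  interpret E: rep_pair K H Y \<sigma> Z \<theta> using R by unfold_locales auto
  interpret F: rep_pair K H D.T D.\<tau> Z \<theta> using D.\<tau>_rep R by unfold_locales auto
  interpret G: rep_pair K H X \<rho> E.T E.\<tau> using E.\<tau>_rep R by unfold_locales auto
  let ?a = "assoc_map K X Y Z" and ?pL = "pure K D.T Z" and ?pR = "pure K X E.T"
  let ?p = "pure K X Y" and ?q = "pure K Y Z"
  note m = D.X D.Y E.Y
  note al = assoc_map_lin[OF m] and ap = assoc_map_pure_pure[OF m]
  note r = D.rules E.rules F.rules G.rules
  show ?thesis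
    unfolding D.tensor_rep_eq E.tensor_rep_eq F.tensor_rep_eq G.tensor_rep_eq
  proof (rule rep_hom_spansI[OF al F.\<tau>_rep G.\<tau>_rep spans_pures[OF D.T E.Y
          spans_pures[OF D.X D.Y spans_carrier spans_carrier] spans_carrier]])
    fix h t assume h: "h \<in> carrier H" and "t \<in> pures K D.T Z (pures K X Y (carrier X) (carrier Y)) (carrier Z)"
    then obtain x y z where t: "t = ?pL (?p x y) z"
      and xyz: "x \<in> carrier X" "y \<in> carrier Y" "z \<in> carrier Z"
      by (auto simp: pures_def)
    have xy: "?p x y \<in> carrier D.T" and yz: "?q y z \<in> carrier E.T" using xyz by (simp_all add: pure_closed)
    have lin: "linear_on K D.T G.T (\<lambda>s. ?a (?pL s v))" if "v \<in> carrier Z" for v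
      by (intro linear_on_comp[OF lin_linear[OF al]] linear_on_pure1 D.T E.Y linear_on_id that)
    have linq: "linear_on K E.T G.T (\<lambda>s. ?pR u s)" if "u \<in> carrier X" for u
      by (intro linear_on_pure2 D.X E.T linear_on_id that)
    have "?a (F.\<tau> h t) = sw G.T (\<lambda>a b. ?a (?pL (D.\<tau> a (?p x y)) (\<theta> b z))) h"
      unfolding t F.\<tau>_pure[OF h xy xyz(3)]
      by (rule linear_sw[OF F.T G.T lin_linear[OF al] h]) (assumption | rule r xy xyz)+
    also have "\<dots> = sw G.T (\<lambda>a b. ?a (?pL (sw D.T (\<lambda>c d. ?p (\<rho> c x) (\<sigma> d y)) a) (\<theta> b z))) h"
      by (intro sw_cong h) (simp add: D.\<tau>_pure xyz)
    also have "\<dots> = sw G.T (\<lambda>a b. sw G.T (\<lambda>c d. ?a (?pL (?p (\<rho> c x) (\<sigma> d y)) (\<theta> b z))) a) h"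
      by (intro sw_cong h linear_sw[OF D.T G.T lin]) (assumption | rule r xyz)+
    also have "\<dots> = sw G.T (\<lambda>a b. sw G.T (\<lambda>c d. ?pR (\<rho> c x) (?q (\<sigma> d y) (\<theta> b z))) a) h"
      by (intro sw_cong h ap) (assumption | rule r xyz)+
    also have "\<dots> = sw G.T (\<lambda>a b. sw G.T (\<lambda>c d. ?pR (\<rho> a x) (?q (\<sigma> c y) (\<theta> d z))) b) h"
      by (rule sw_coassoc[OF G.T h]) (assumption | rule r xyz)+
    also have "\<dots> = sw G.T (\<lambda>a b. ?pR (\<rho> a x) (sw E.T (\<lambda>c d. ?q (\<sigma> c y) (\<theta> d z)) b)) h"
      by (intro sw_cong h linear_sw[OF E.T G.T linq, symmetric]) (assumption | rule r xyz)+
    also have "\<dots> = sw G.T (\<lambda>a b. ?pR (\<rho> a x) (E.\<tau> b (?q y z))) h"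
      by (intro sw_cong h) (simp add: E.\<tau>_pure xyz)
    also have "\<dots> = G.\<tau> h (?a t)"
      unfolding t ap[OF xyz] by (rule G.\<tau>_pure[OF h xyz(1) yz, symmetric])
    finally show "?a (F.\<tau> h t) = G.\<tau> h (?a t)" .
  qed
qed

lemma assoc_inv_rep_hom:
  assumes R: "(X, \<rho>) \<in> linear_reps" "(Y, \<sigma>) \<in> linear_reps" "(Z, \<theta>) \<in> linear_reps"
  shows "assoc_inv_map K X Y Z \<in> rep_hom K H
    (tensor_rep K H (X, \<rho>) (tensor_rep K H (Y, \<sigma>) (Z, \<theta>)))
    (tensor_rep K H (tensor_rep K H (X, \<rho>) (Y, \<sigma>)) (Z, \<theta>))"
proof -
  interpret D: rep_pair K H X \<rho> Y \<sigma> using R by unfold_locales auto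
  interpret E: rep_pair K H Y \<sigma> Z \<theta> using R by unfold_locales auto
  interpret F: rep_pair K H D.T D.\<tau> Z \<theta> using D.\<tau>_rep R by unfold_locales auto
  interpret G: rep_pair K H X \<rho> E.T E.\<tau> using E.\<tau>_rep R by unfold_locales auto
  note m = D.X D.Y E.Y
  show ?thesis
    using assoc_rep_hom[OF R]
    unfolding D.tensor_rep_eq E.tensor_rep_eq F.tensor_rep_eq G.tensor_rep_eq
    by (rule rep_hom_inverse[OF _ assoc_inv_map_lin[OF m] F.\<tau>_rep assoc_inv_assoc[OF m] assoc_assoc_inv[OF m]])
qed

section \<open>The trivial module and equivariance of the unit constraints\<close>

definition \<epsilon>_action :: "('k, 'h) univ \<Rightarrow> ('k, 'a) univ \<Rightarrow> ('k, 'a) univ" where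
  "\<epsilon>_action = (\<lambda>h\<in>carrier H. \<lambda>c\<in>carrier (ground K). counit H h \<odot>\<^bsub>ground K\<^esub> c)"

lemma trivial_rep_eq: "trivial_rep K H = (ground K, \<epsilon>_action)"
  by (simp add: trivial_rep_def \<epsilon>_action_def)

lemma \<epsilon>_action: "h \<in> carrier H \<Longrightarrow> c \<in> carrier (ground K) \<Longrightarrow> \<epsilon>_action h c = counit H h \<odot>\<^bsub>ground K\<^esub> c"
  by (simp add: \<epsilon>_action_def)

lemma trivial_rep:
  "(ground K, \<epsilon>_action) \<in> (linear_reps :: ('k, 'h, 'a) rep set)"
  "unital (ground K :: ('k, 'a) vs) \<epsilon>_action" "multiplicative (ground K :: ('k, 'a) vs) \<epsilon>_action"
proof -
  note G = ground_module[OF cring_K]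
  interpret G: module K "ground K :: ('k, 'a) vs" by (rule G)
  interpret H: module K H by (rule module)
  have "bilinear_on K H (ground K) (ground K) (\<epsilon>_action :: _ \<Rightarrow> ('k, 'a) univ \<Rightarrow> _)"
    by (intro bilinear_onI linear_onI)
      (simp_all add: \<epsilon>_action counit_closed counit_add counit_smult G.smult_l_distr G.smult_r_distr
        G.smult_assoc1[symmetric] G.m_comm)
  then show "(ground K, \<epsilon>_action) \<in> (linear_reps :: ('k, 'h, 'a) rep set)"
    by (simp add: linear_reps_def G lin_End_iff[OF module G]) (simp add: \<epsilon>_action_def)
  show "unital (ground K :: ('k, 'a) vs) \<epsilon>_action"
    by (simp add: unital_def \<epsilon>_action one_closed counit_one)
  show "multiplicative (ground K :: ('k, 'a) vs) \<epsilon>_action"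
    by (simp add: multiplicative_def \<epsilon>_action mult_closed counit_closed counit_mult G.smult_assoc1)
qed

text \<open>The first leg of \<open>h\<close> acts on the scalar through the counit, and the counit
  law reassembles \<open>h\<close> from what remains.\<close>

lemma lunit_rep_hom:
  assumes R: "(X, \<rho>) \<in> linear_reps"
  shows "lunit_map K X \<in> rep_hom K H (tensor_rep K H (trivial_rep K H) (X, \<rho>)) (X, \<rho>)"
proof -
  interpret D: rep_pair K H "ground K" \<epsilon>_action X \<rho> using R trivial_rep by unfold_locales auto
  interpret X: module K X by (rule D.Y)
  note ll = lunit_map_lin[OF D.Y] and lp = lunit_map_pure[OF D.Y]
  show ?thesis
    unfolding trivial_rep_eq D.tensor_rep_eq
  proof (rule rep_hom_spansI[OF ll D.\<tau>_rep R spans_pures[OF D.X D.Y spans_carrier spans_carrier]])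
    fix h t assume h: "h \<in> carrier H" and "t \<in> pures K (ground K) X (carrier (ground K)) (carrier X)"
    then obtain c x where t: "t = D.p c x" and cx: "c \<in> carrier (ground K)" "x \<in> carrier X"
      by (auto simp: pures_def)
    note sc = scalar_closed[OF cx(1)]
    have "lunit_map K X (D.\<tau> h t) = sw X (\<lambda>a b. lunit_map K X (D.p (\<epsilon>_action a c) (\<rho> b x))) h"
      unfolding t D.\<tau>_pure[OF h cx]
      by (rule linear_sw[OF D.T D.Y lin_linear[OF ll] h]) (assumption | rule D.rules cx)+
    also have "\<dots> = sw X (\<lambda>a b. counit H a \<odot>\<^bsub>X\<^esub> (scalar c \<odot>\<^bsub>X\<^esub> \<rho> b x)) h"
    proof (rule sw_cong[OF h])
      fix a b assume ab: "a \<in> carrier H" "b \<in> carrier H"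
      have "scalar (\<epsilon>_action a c) = counit H a \<otimes>\<^bsub>K\<^esub> scalar c"
        using ab cx by (simp add: \<epsilon>_action ground_def)
      then show "lunit_map K X (D.p (\<epsilon>_action a c) (\<rho> b x)) = counit H a \<odot>\<^bsub>X\<^esub> (scalar c \<odot>\<^bsub>X\<^esub> \<rho> b x)"
        using ab cx sc by (simp add: lp bilinear_onD(3)[OF D.\<rho>] bilinear_onD(3)[OF D.\<sigma>] X.smult_assoc1 counit_closed)
    qed
    also have "\<dots> = scalar c \<odot>\<^bsub>X\<^esub> \<rho> h x"
      by (rule sw_counit_left[OF D.Y _ h]) (assumption | rule D.rules cx sc)+
    also have "\<dots> = \<rho> h (lunit_map K X t)"
      unfolding t lp[OF cx] using linear_onD(3)[OF bilinear_onD(2)[OF D.\<sigma> h] sc cx(2)] by simp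
    finally show "lunit_map K X (D.\<tau> h t) = \<rho> h (lunit_map K X t)" .
  qed
qed

lemma runit_rep_hom:
  assumes R: "(X, \<rho>) \<in> linear_reps"
  shows "runit_map K X \<in> rep_hom K H (tensor_rep K H (X, \<rho>) (trivial_rep K H)) (X, \<rho>)"
proof -
  interpret D: rep_pair K H X \<rho> "ground K" \<epsilon>_action using R trivial_rep by unfold_locales auto
  interpret X: module K X by (rule D.X)
  note ll = runit_map_lin[OF D.X] and lp = runit_map_pure[OF D.X]
  show ?thesis
    unfolding trivial_rep_eq D.tensor_rep_eq
  proof (rule rep_hom_spansI[OF ll D.\<tau>_rep R spans_pures[OF D.X D.Y spans_carrier spans_carrier]])
    fix h t assume h: "h \<in> carrier H" and "t \<in> pures K X (ground K) (carrier X) (carrier (ground K))"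
    then obtain c x where t: "t = D.p x c" and cx: "c \<in> carrier (ground K)" "x \<in> carrier X"
      by (auto simp: pures_def)
    note sc = scalar_closed[OF cx(1)]
    have "runit_map K X (D.\<tau> h t) = sw X (\<lambda>a b. runit_map K X (D.p (\<rho> a x) (\<epsilon>_action b c))) h"
      unfolding t D.\<tau>_pure[OF h cx(2,1)]
      by (rule linear_sw[OF D.T D.X lin_linear[OF ll] h]) (assumption | rule D.rules cx)+
    also have "\<dots> = sw X (\<lambda>a b. counit H b \<odot>\<^bsub>X\<^esub> (scalar c \<odot>\<^bsub>X\<^esub> \<rho> a x)) h"
    proof (rule sw_cong[OF h])
      fix a b assume ab: "a \<in> carrier H" "b \<in> carrier H"
      have "scalar (\<epsilon>_action b c) = counit H b \<otimes>\<^bsub>K\<^esub> scalar c"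
        using ab cx by (simp add: \<epsilon>_action ground_def)
      then show "runit_map K X (D.p (\<rho> a x) (\<epsilon>_action b c)) = counit H b \<odot>\<^bsub>X\<^esub> (scalar c \<odot>\<^bsub>X\<^esub> \<rho> a x)"
        using ab cx sc by (simp add: lp bilinear_onD(3)[OF D.\<rho>] bilinear_onD(3)[OF D.\<sigma>] X.smult_assoc1 counit_closed)
    qed
    also have "\<dots> = scalar c \<odot>\<^bsub>X\<^esub> \<rho> h x"
      by (rule sw_counit_right[OF D.X _ h]) (assumption | rule D.rules cx sc)+
    also have "\<dots> = \<rho> h (runit_map K X t)"
      unfolding t lp[OF cx] using linear_onD(3)[OF bilinear_onD(2)[OF D.\<rho> h] sc cx(2)] by simp
    finally show "runit_map K X (D.\<tau> h t) = \<rho> h (runit_map K X t)" .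
  qed
qed

lemma lunit_inv_rep_hom:
  assumes R: "(X, \<rho>) \<in> linear_reps"
  shows "lunit_inv_map K X \<in> rep_hom K H (X, \<rho>) (tensor_rep K H (trivial_rep K H) (X, \<rho>))"
proof -
  interpret D: rep_pair K H "ground K" \<epsilon>_action X \<rho> using R trivial_rep by unfold_locales auto
  show ?thesis
    using lunit_rep_hom[OF R] unfolding trivial_rep_eq D.tensor_rep_eq
    by (rule rep_hom_inverse[OF _ lunit_inv_map_lin[OF D.Y] D.\<tau>_rep lunit_inv_lunit[OF D.Y] lunit_lunit_inv[OF D.Y]])
qed

lemma runit_inv_rep_hom:
  assumes R: "(X, \<rho>) \<in> linear_reps"
  shows "runit_inv_map K X \<in> rep_hom K H (X, \<rho>) (tensor_rep K H (X, \<rho>) (trivial_rep K H))"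
proof -
  interpret D: rep_pair K H X \<rho> "ground K" \<epsilon>_action using R trivial_rep by unfold_locales auto
  show ?thesis
    using runit_rep_hom[OF R] unfolding trivial_rep_eq D.tensor_rep_eq
    by (rule rep_hom_inverse[OF _ runit_inv_map_lin[OF D.X] D.\<tau>_rep runit_inv_runit[OF D.X] runit_runit_inv[OF D.X]])
qed

section \<open>The two tensor categories and the final assembly\<close>

lemma tensor_category_reps:
  "tensor_category K (linear_reps :: ('k, 'h, 'a) rep set) fst (rep_hom K H) (tensor_rep K H) (trivial_rep K H)"
proof (rule tensor_category.intro)
  fix f A B assume "f \<in> rep_hom K H A B"
  then show "f \<in> lin K (fst A) (fst B)" by (cases A, cases B) (simp add: rep_homD(1))
next
  fix A :: "('k, 'h, 'a) rep" assume A: "A \<in> linear_reps"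
  obtain M \<pi> where M: "A = (M, \<pi>)" by (cases A)
  note act = linear_reps_action[OF A[unfolded M]]
  show "(\<lambda>x\<in>carrier (fst A). x) \<in> rep_hom K H A A"
    using act bilinear_onD(3)[OF act(2)] by (auto simp: M lin_id intro!: rep_homI)
  show "lunit_map K (fst A) \<in> rep_hom K H (tensor_rep K H (trivial_rep K H) A) A"
    "lunit_inv_map K (fst A) \<in> rep_hom K H A (tensor_rep K H (trivial_rep K H) A)"
    "runit_map K (fst A) \<in> rep_hom K H (tensor_rep K H A (trivial_rep K H)) A"
    "runit_inv_map K (fst A) \<in> rep_hom K H A (tensor_rep K H A (trivial_rep K H))"
    using A by (simp_all add: M lunit_rep_hom lunit_inv_rep_hom runit_rep_hom runit_inv_rep_hom)
next
  fix A B D :: "('k, 'h, 'a) rep" and f g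
  assume A: "A \<in> linear_reps" and B: "B \<in> linear_reps" and D: "D \<in> linear_reps"
    and f: "f \<in> rep_hom K H A B" and g: "g \<in> rep_hom K H B D"
  obtain M \<pi> N \<sigma> Q \<theta> where M: "A = (M, \<pi>)" "B = (N, \<sigma>)" "D = (Q, \<theta>)" by (cases A, cases B, cases D)
  note act = linear_reps_action[OF A[unfolded M]]
  note f = f[unfolded M] and g = g[unfolded M]
  show "compose (carrier (fst A)) g f \<in> rep_hom K H A D"
    unfolding M fst_conv
  proof (rule rep_homI[OF lin_compose[OF act(1) rep_homD(1)[OF f] rep_homD(1)[OF g]]])
    fix h x assume "h \<in> carrier H" "x \<in> carrier M"
    then show "compose (carrier M) g f (\<pi> h x) = \<theta> h (compose (carrier M) g f x)"
      using rep_homD(2)[OF f] rep_homD(2)[OF g] lin_closed[OF rep_homD(1)[OF f]] bilinear_onD(3)[OF act(2)]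
      by (simp add: compose_eq)
  qed
next
  fix A B A' B' :: "('k, 'h, 'a) rep" and f g
  assume "A \<in> linear_reps" "B \<in> linear_reps" "A' \<in> linear_reps" "B' \<in> linear_reps"
    "f \<in> rep_hom K H A A'" "g \<in> rep_hom K H B B'"
  then show "tmap K (fst A) (fst B) (fst A') (fst B') f g \<in> rep_hom K H (tensor_rep K H A B) (tensor_rep K H A' B')"
    by (cases A, cases B, cases A', cases B') (simp add: tmap_rep_hom)
next
  fix A B D :: "('k, 'h, 'a) rep"
  assume "A \<in> linear_reps" "B \<in> linear_reps" "D \<in> linear_reps"
  then show "assoc_map K (fst A) (fst B) (fst D) \<in>
      rep_hom K H (tensor_rep K H (tensor_rep K H A B) D) (tensor_rep K H A (tensor_rep K H B D))"
    "assoc_inv_map K (fst A) (fst B) (fst D) \<in>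
      rep_hom K H (tensor_rep K H A (tensor_rep K H B D)) (tensor_rep K H (tensor_rep K H A B) D)"
    by (cases A, cases B, cases D, simp add: assoc_rep_hom assoc_inv_rep_hom)+
next
  fix A :: "('k, 'h, 'a) rep" assume "A \<in> linear_reps"
  then show "module K (fst A)" by (cases A) (simp add: linear_reps_action)
qed (simp_all add: cring_K fst_tensor_rep tensor_rep_closed trivial_rep_eq trivial_rep(1))

end

lemma tensor_category_Vect:
  assumes "cring K"
  shows "tensor_category K {M. module K M} (\<lambda>M. M) (lin K) (tensor K) (ground K)"
  by (rule tensor_category.intro)
    (simp_all add: assms lin_id lin_compose tmap_lin assoc_map_lin assoc_inv_map_lin tensor_module
      ground_module lunit_map_lin lunit_inv_map_lin runit_map_lin runit_inv_map_lin)

theorem theorem2p2: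
  fixes K :: "('k, 'r) ring_scheme"
    and H :: "('k, ('k, 'h) univ) hopf"
    and V :: "(('k, 'a) vs, ('k, 'a) vs_arr) monoidal"
    and C :: "(('k, 'h, 'a) rep, ('k, 'h, 'a) rep_arr) monoidal"
    and P :: "(('k, 'h, 'a) rep, ('k, 'h, 'a) rep_arr) category"
  defines "V \<equiv> Vect K" and "C \<equiv> HMod K H" and "P \<equiv> HPMod K H"
  assumes "hopf_algebra K H" and "invertible_antipode H"
  shows "biactegory C P (left_tensor_action K H) (right_tensor_action K H) (rep_assoc_inv K H)
    \<and> left_action_lifts_strictly V C P fst forget_arr fst forget_arr (left_tensor_action K H)
    \<and> right_action_lifts_strictly V C P fst forget_arr fst forget_arr (right_tensor_action K H)
    \<and> bimodulator_lifts_strictly V C P fst fst forget_arr (rep_assoc_inv K H)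
    \<and> (\<forall>(X, \<rho>)\<in>Obj C. \<forall>(M, \<pi>)\<in>Obj P. \<forall>h\<in>carrier H. \<forall>x\<in>carrier X. \<forall>m\<in>carrier M.
         snd (Lob (left_tensor_action K H) (X, \<rho>) (M, \<pi>)) h (pure K X M x m) =
           tsum (tensor K X M) (\<lambda>h1 h2. pure K X M (\<rho> h1 x) (\<pi> h2 m)) (comul H h)
       \<and> snd (Rob (right_tensor_action K H) (M, \<pi>) (X, \<rho>)) h (pure K M X m x) =
           tsum (tensor K M X) (\<lambda>h1 h2. pure K M X (\<pi> h1 m) (\<rho> h2 x)) (comul H h))"
proof -
  interpret hopf_algebra K H by fact
  interpret W: tensor_category K "{M. module K M}" "\<lambda>M :: ('k, 'a) vs. M" "lin K" "tensor K" "ground K"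
    by (rule tensor_category_Vect[OF cring_K])
  interpret R: tensor_category K "linear_reps :: ('k, 'h, 'a) rep set" fst "rep_hom K H" "tensor_rep K H"
    "trivial_rep K H"
    by (rule tensor_category_reps)
  let ?G = "{(M, \<rho>). module K M \<and> global_rep K H (End_alg K M) \<rho>} :: ('k, 'h, 'a) rep set"
  let ?P = "{(M, \<pi>). module K M \<and> partial_rep K H (End_alg K M) \<pi>} :: ('k, 'h, 'a) rep set"
  have ops: "R.tarr = rep_tensor_arr K H" "R.assoc = rep_assoc K H" "R.assoc_inv = rep_assoc_inv K H"
    "R.lunit = rep_lunit K H" "R.runit = rep_runit K H"
    by (auto simp: R.tarr_def rep_tensor_arr_def R.assoc_def rep_assoc_def R.assoc_inv_def rep_assoc_inv_def
        R.lunit_def rep_lunit_def R.runit_def rep_runit_def fun_eq_iff)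
  have Wops: "W.tarr = (\<lambda>(M, f, M') (N, g, N'). (tensor K M N, tmap K M N M' N' f g, tensor K M' N'))"
    "W.assoc = (\<lambda>X Y Z. (tensor K (tensor K X Y) Z, assoc_map K X Y Z, tensor K X (tensor K Y Z)))"
    "W.lunit = (\<lambda>X. (tensor K (ground K) X, lunit_map K X, X))"
    "W.runit = (\<lambda>X. (tensor K X (ground K), runit_map K X, X))"
    by (auto simp: W.tarr_def W.assoc_def W.lunit_def W.runit_def fun_eq_iff)
  \<comment> \<open>Both categories are cut out of the same ambient category of linear
    representations, so the actions of the theorem are restrictions of its tensor product.\<close>
  have C: "C = R.moncat ?G" and P: "P = R.subcat ?P"
    unfolding C_def P_def HMod_def HPMod_def R.moncat_def R.subcat_def ops by simp_all
  have V: "V = W.moncat {M. module K M}"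
    unfolding V_def Vect_def W.moncat_def W.subcat_def Wops by simp
  have L: "left_tensor_action K H = R.left_act" and Ra: "right_tensor_action K H = R.right_act"
    unfolding left_tensor_action_def right_tensor_action_def R.left_act_def R.right_act_def ops by simp_all
  have G_sub: "?G \<subseteq> linear_reps" and P_sub: "?P \<subseteq> linear_reps"
    by (auto simp: linear_reps_def global_rep_def partial_rep_def)
  have G_iff: "(M, \<rho>) \<in> ?G \<longleftrightarrow> (M, \<rho>) \<in> linear_reps \<and> unital M \<rho> \<and> multiplicative M \<rho>" for M \<rho>
    using G_sub global_rep_iff[of M \<rho>] by (auto simp: linear_reps_def)
  have P_iff: "(M, \<rho>) \<in> ?P \<longleftrightarrow> (M, \<rho>) \<in> linear_reps \<and> unital M \<rho> \<and> partially_multiplicative M \<rho>" for M \<rho>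
    using P_sub partial_rep_iff[of M \<rho>] by (auto simp: linear_reps_def)
  have pair: "rep_pair K H X \<rho> Y \<sigma>" if "(X, \<rho>) \<in> linear_reps" "(Y, \<sigma>) \<in> linear_reps" for X Y :: "('k, 'a) vs" and \<rho> \<sigma>
    using rep_pairI[OF that] by simp
  have GG: "tensor_rep K H A B \<in> ?G" if "A \<in> ?G" "B \<in> ?G" for A B
  proof -
    obtain X \<rho> Y \<sigma> where AB: "A = (X, \<rho>)" "B = (Y, \<sigma>)" by (cases A, cases B)
    note a = that[unfolded AB G_iff]
    interpret rep_pair K H X \<rho> Y \<sigma> using a pair by blast
    show ?thesis unfolding AB tensor_rep_eq G_iff using a \<tau>_rep \<tau>_unital \<tau>_multiplicative by blast
  qed
  \<comment> \<open>The two mixed closure properties, here and in \<open>PG\<close>, are where the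
    axioms of a partial representation are verified for the tensor product.\<close>
  have GP: "tensor_rep K H A B \<in> ?P" if "A \<in> ?G" "B \<in> ?P" for A B
  proof -
    obtain X \<rho> Y \<sigma> where AB: "A = (X, \<rho>)" "B = (Y, \<sigma>)" by (cases A, cases B)
    note a = that[unfolded AB G_iff P_iff]
    interpret rep_pair K H X \<rho> Y \<sigma> using a pair by blast
    show ?thesis unfolding AB tensor_rep_eq P_iff using a \<tau>_rep \<tau>_unital \<tau>_partial_right by blast
  qed
  \<comment> \<open>Unitality of the global factor serves twice: for the unit axiom of the tensor
    product and for the cancellation of the inner legs.\<close>
  have PG: "tensor_rep K H A B \<in> ?P" if "A \<in> ?P" "B \<in> ?G" for A B
  proof -
    obtain X \<rho> Y \<sigma> where AB: "A = (X, \<rho>)" "B = (Y, \<sigma>)" by (cases A, cases B)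
    note a = that[unfolded AB G_iff P_iff]
    interpret rep_pair K H X \<rho> Y \<sigma> using a pair by blast
    show ?thesis unfolding AB tensor_rep_eq P_iff using a \<tau>_rep \<tau>_unital \<tau>_partial_left by blast
  qed
  have I: "trivial_rep K H \<in> ?G"
    unfolding trivial_rep_eq G_iff using trivial_rep by blast
  have biact: "biactegory C P (left_tensor_action K H) (right_tensor_action K H) (rep_assoc_inv K H)"
    unfolding C P L Ra ops(3)[symmetric] by (rule R.biactegory_subcat[OF G_sub GG I P_sub GP PG])
  have Cmon: "monoidal_category C" unfolding C by (rule R.moncat_monoidal[OF G_sub GG I])
  have Vmon: "monoidal_category V"
    unfolding V by (rule W.moncat_monoidal) (simp_all add: tensor_module ground_module cring_K)
  have ObjC: "Obj C = ?G" and ObjP: "Obj P = ?P" and ObjV: "Obj V = {M. module K M}"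
    unfolding C P V by (rule R.moncat_simps W.moncat_simps)+
  have arrC: "(A, f, B) \<in> Arr C \<longleftrightarrow> A \<in> ?G \<and> B \<in> ?G \<and> f \<in> rep_hom K H A B" for A f B
    unfolding C_def HMod_def by (auto simp: category.extend_def monoidal.fields_def concrete_cat_def)
  have arrP: "(A, f, B) \<in> Arr P \<longleftrightarrow> A \<in> ?P \<and> B \<in> ?P \<and> f \<in> rep_hom K H A B" for A f B
    unfolding P_def HPMod_def by (auto simp: concrete_cat_def)
  have arrV: "(M, f, N) \<in> Arr V \<longleftrightarrow> module K M \<and> module K N \<and> f \<in> lin K M N" for M f N
    unfolding V_def Vect_def by (auto simp: category.extend_def monoidal.fields_def concrete_cat_def)
  have sC: "Dom C (A, f, B) = A" "Cod C (A, f, B) = B" "Ident C A = (A, \<lambda>x\<in>carrier (fst A). x, A)"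
    "Comp C (B', g, D) (A, f, B) = (A, compose (carrier (fst A)) g f, D)" for A f B B' g D
    unfolding C_def HMod_def by (auto simp: category.extend_def monoidal.fields_def concrete_cat_def)
  have sP: "Dom P (A, f, B) = A" "Cod P (A, f, B) = B" "Ident P A = (A, \<lambda>x\<in>carrier (fst A). x, A)"
    "Comp P (B', g, D) (A, f, B) = (A, compose (carrier (fst A)) g f, D)" for A f B B' g D
    unfolding P_def HPMod_def by (auto simp: concrete_cat_def)
  have sV: "Dom V (M, f, N) = M" "Cod V (M, f, N) = N" "Ident V M = (M, \<lambda>x\<in>carrier M. x, M)"
    "Comp V (N', g, Q) (M, f, N) = (M, compose (carrier M) g f, Q)" for M f N N' g Q
    unfolding V_def Vect_def by (auto simp: category.extend_def monoidal.fields_def concrete_cat_def)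
  have catC: "category C" and catV: "category V"
    using Cmon Vmon by (simp_all add: monoidal_category_def)
  have catP: "category P"
    unfolding P by (rule full_subcategory_category[OF R.full_subcategories(2)[OF P_sub] R.base_category])
  have FC: "is_functor C V fst forget_arr"
    unfolding is_functor_def
    by (auto simp: catC catV ObjC ObjV arrC arrV sC sV forget_arr_def Hom_def intro: rep_homD(1))
  have FP: "is_functor P V fst forget_arr"
    unfolding is_functor_def
    by (auto simp: catP catV ObjP ObjV arrP arrV sP sV forget_arr_def Hom_def intro: rep_homD(1))
  have Vs: "Tob V = tensor K" "Tarr V = W.tarr" "Unit V = ground K" "Assoc V = W.assoc"
    "Lunit V = W.lunit" "Runit V = W.runit"
    unfolding V by (rule W.moncat_simps)+
  have Cs: "Tob C = tensor_rep K H" "Tarr C = rep_tensor_arr K H" "Unit C = trivial_rep K H"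
    "Assoc C = rep_assoc K H" "Lunit C = rep_lunit K H" "Runit C = rep_runit K H"
    unfolding C R.moncat_simps ops by simp_all
  have forget: "forget_arr (rep_tensor_arr K H f g) = W.tarr (forget_arr f) (forget_arr g)"
    "forget_arr (rep_assoc K H A B D) = W.assoc (fst A) (fst B) (fst D)"
    "forget_arr (rep_assoc_inv K H A B D) = W.assoc_inv (fst A) (fst B) (fst D)"
    "forget_arr (rep_lunit K H A) = W.lunit (fst A)" "forget_arr (rep_runit K H A) = W.runit (fst A)"
    for A B D :: "('k, 'h, 'a) rep" and f g
    by (cases f, cases g) (simp_all add: forget_arr_def rep_tensor_arr_def W.tarr_def rep_assoc_def W.assoc_def
        rep_assoc_inv_def W.assoc_inv_def rep_lunit_def W.lunit_def rep_runit_def W.runit_def fst_tensor_rep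
        trivial_rep_eq)
  have strict: "strict_monoidal_functor C V fst forget_arr"
    unfolding strict_monoidal_functor_def Vs Cs forget
    by (simp add: Cmon Vmon FC fst_tensor_rep trivial_rep_eq)
  have mod: "module K (fst A)" if "A \<in> ?G \<or> A \<in> ?P" for A using that by auto
  \<comment> \<open>Since \<open>V\<close> is the full subcategory of its ambient category on all
    objects, being mutually inverse means the same in both.\<close>
  have V_base: "inverse_arrows V f g \<longleftrightarrow> inverse_arrows W.base f g" for f g
    unfolding V using W.full_subcategories(1)[OF subset_refl]
    by (auto simp: inverse_arrows_def W.moncat_def W.subcat_def W.base_def category.extend_def
        monoidal.fields_def concrete_cat_def)
  have inv: "inverse_arrows V (W.assoc X Y Z) (W.assoc_inv X Y Z)"
    if "module K X" "module K Y" "module K Z" for X Y Z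
    unfolding V_base using that by (intro W.assoc_inverse) simp_all
  have "left_action_lifts_strictly V C P fst forget_arr fst forget_arr (left_tensor_action K H)"
    unfolding left_action_lifts_strictly_def
    by (simp add: strict FP left_tensor_action_def Vs forget fst_tensor_rep)
  moreover have "right_action_lifts_strictly V C P fst forget_arr fst forget_arr (right_tensor_action K H)"
    unfolding right_action_lifts_strictly_def ObjC ObjP right_tensor_action_def right_action.simps Vs forget
      fst_tensor_rep
    by (intro conjI ballI strict FP inv mod HOL.refl) simp_all
  moreover have "bimodulator_lifts_strictly V C P fst fst forget_arr (rep_assoc_inv K H)"
    unfolding bimodulator_lifts_strictly_def ObjC ObjP forget Vs
    by (intro ballI inv mod) simp_all
  \<comment> \<open>Stated for any two members of \<open>linear_reps\<close>, so that the formulas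
    for the left and for the right action are both instances.\<close>
  moreover have "snd (tensor_rep K H (X, \<rho>) (Y, \<sigma>)) h (pure K X Y x y) =
      tsum (tensor K X Y) (\<lambda>h1 h2. pure K X Y (\<rho> h1 x) (\<sigma> h2 y)) (comul H h)"
    if "(X, \<rho>) \<in> linear_reps" "(Y, \<sigma>) \<in> linear_reps" "h \<in> carrier H" "x \<in> carrier X" "y \<in> carrier Y"
    for X Y :: "('k, 'a) vs" and \<rho> \<sigma> h x y
  proof -
    interpret rep_pair K H X \<rho> Y \<sigma> by (rule pair[OF that(1,2)])
    show ?thesis using \<tau>_pure[OF that(3-5)] by (simp add: \<tau>_def)
  qed
  moreover have "A \<in> linear_reps" if "A \<in> ?G \<or> A \<in> ?P" for A
    using that G_sub P_sub by blast
  ultimately show ?thesis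
    unfolding ObjC ObjP left_tensor_action_def right_tensor_action_def left_action.simps right_action.simps
    using biact[unfolded left_tensor_action_def right_tensor_action_def] by blast
qed

end
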